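(* Let $f:(M^m,g)\to(N^n,h)$ be a holomorphic map between (connected) Hermitian manifolds of complex dimensions $m$ and $n$, with $M$ compact, $m\le n$, and let $1\le\ell\le m$. (a) If $S^M\ge0$ and $(N,h)$ has $Ric^{(1)}_m<0$, or if $S^M>0$ and $(N,h)$ has $Ric^{(1)}_m\le0$, then $f$ must be degenerate. The same result holds if $Ric^M\ge0$ and $S^N_m<0$, or if $Ric^M>0$ and $S^N_m\le0$. (b) Assume that the metric $g$ on $M$ is Kähler and $1\le\ell<m$. If $S^M_\ell\ge0$ and $(N,h)$ has $Ric^{(1)}_\ell<0$, or if $S^M_\ell>0$ and $(N,h)$ has $Ric^{(1)}_\ell\le0$, then $\mathrm{rank}(f)<\ell$. The same result holds if $Ric^M_\ell\ge0$ and $S^N_\ell<0$, or if $Ric^M_\ell>0$ and $S^N_\ell\le0$. (c) If $(M,g)$ has $Ric^{(2)}_\ell>0$ and $(N,h)$ has $\widetilde B^N\le0$, or if $(M,g)$ has $Ric^{(2)}_\ell\ge0$ and $(N,h)$ has $\widetilde B^N<0$, then $f$ must be constant.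
   Context: The map $f$ ($m\le n$) is called non-degenerate if $\dim f(M)=m$ and degenerate if $\dim f(M)<m$. $\mathrm{rank}(f)$ is the maximal rank over $M$ of the tangent map $\partial f:T'M\to T'N$ on holomorphic tangent bundles. Curvatures (superscripts $M$, $N$ indicate the manifold). The Chern curvature tensor of a Hermitian metric $g$ is $R_{i\overline{j}k\overline{l}}=-\frac{\partial^{2}g_{k\overline{l}}}{\partial z^{i}\partial \overline{z}^{j}}+g^{p\overline{q}}\frac{\partial g_{k\overline{q}}}{\partial z^{i}}\frac{\partial g_{p\overline{l}}}{\partial \overline{z}^{j}}$. $S^M=\sum g^{i\overline j}g^{k\overline l}R_{i\overline jk\overline l}$ is the Chern scalar curvature, and $Ric^M$ is the (first) Chern Ricci curvature, with components $R_{i\overline j}=\sum_{k,l}g^{k\overline l}R_{i\overline jk\overline l}$. For an $\ell$-dimensional complex subspace $\Sigma$ of the holomorphic tangent space at a point $q$, with unitary basis $E_1,\dots,E_\ell$, and $v\in\Sigma$, define $$Ric^{(1)}_\ell(q,\Sigma)(v,\overline v)=\sum_{i=1}^\ell R(v,\overline v,E_i,\overline{E_i}),\quad Ric^{(2)}_\ell(q,\Sigma)(v,\overline v)=\sum_{i=1}^\ell R(E_i,\overline{E_i},v,\overline v),\quad S_\ell(q,\Sigma)=\sum_{i,j=1}^\ell R(E_i,\overline{E_i},E_j,\overline{E_j}).$$ These are the $\ell$-first Ricci, $\ell$-second Ricci and $\ell$-scalar curvatures. When the metric is Kähler, $Ric^{(1)}_\ell=Ric^{(2)}_\ell$ and this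 common curvature is written $Ric_\ell$. $Ric^{(1)}_\ell<0$ means $Ric^{(1)}_\ell(q,\Sigma)(v,\overline v)<0$ for all points $q$, all $\ell$-dimensional $\Sigma$ and all nonzero $v\in\Sigma$; $S_\ell<0$ means $S_\ell(q,\Sigma)<0$ for all $q$, $\Sigma$; the other signs ($\le0$, $>0$, $\ge0$) and the other curvatures are treated analogously. Real bisectional curvature of $(N^n,h)$: for a unitary frame $e=\{e_1,\dots,e_n\}$ of the holomorphic tangent space at a point and nonnegative constants $a=\{a_1,\dots,a_n\}$ with $|a|^2=\sum a_i^2>0$, $$\widetilde B^N(e,a)=\frac1{|a|^2}\sum_{i,j=1}^nR_{i\overline ij\overline j}a_ia_j,$$ with components of the Chern curvature in the frame $e$. $\widetilde B^N<0$ (resp. $\le0$) means $\widetilde B^N(e,a)<0$ (resp. $\le0$) for all points, all unitary frames $e$ and all such $a$. *)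

theory Defs
  imports "HOL-Analysis.Analysis"
begin

section \<open>Holomorphic maps of several variables and complex manifolds\<close>

text \<open>Used for open sets only: real Frechet differentiability with complex-linear derivative.\<close>

definition holo_on :: "(complex^'m \<Rightarrow> complex^'n) \<Rightarrow> (complex^'m) set \<Rightarrow> bool" where
  "holo_on f S \<longleftrightarrow> (\<forall>z\<in>S. \<exists>D. (f has_derivative D) (at z) \<and> (\<forall>c v. D (c *s v) = c *s D v))"

text \<open>A chart is its domain together with its coordinate map; the values of the coordinate
  map outside the domain are irrelevant.\<close>

type_synonym ('a, 'm) chart = "'a set \<times> ('a \<Rightarrow> complex^'m)"

abbreviation chart_image :: "('a, 'm::finite) chart \<Rightarrow> (complex^'m) set" where
  "chart_image c \<equiv> snd c ` fst c"

definition inv_chart :: "('a, 'm::finite) chart \<Rightarrow> complex^'m \<Rightarrow> 'a" where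
  "inv_chart c = inv_into (fst c) (snd c)"

definition is_chart :: "('a::topological_space, 'm::finite) chart \<Rightarrow> bool" where
  "is_chart c \<longleftrightarrow> open (fst c) \<and> open (chart_image c) \<and>
     homeomorphism (fst c) (chart_image c) (snd c) (inv_chart c)"

definition transition :: "('a, 'm::finite) chart \<Rightarrow> ('a, 'm) chart \<Rightarrow> complex^'m \<Rightarrow> complex^'m" where
  "transition c d = snd d \<circ> inv_chart c"

definition holo_compatible :: "('a, 'm::finite) chart \<Rightarrow> ('a, 'm) chart \<Rightarrow> bool" where
  "holo_compatible c d \<longleftrightarrow>
     holo_on (transition c d) (snd c ` (fst c \<inter> fst d)) \<and>
     holo_on (transition d c) (snd d ` (fst c \<inter> fst d))"

text \<open>The manifold is the whole type \<open>'a\<close>; its complex dimension is \<open>CARD('m)\<close>.\<close>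

definition complex_atlas ::
    "('a::{t2_space, second_countable_topology}, 'm::finite) chart set \<Rightarrow> bool" where
  "complex_atlas A \<longleftrightarrow> (\<forall>c\<in>A. is_chart c) \<and> (\<Union>c\<in>A. fst c) = UNIV \<and>
     (\<forall>c\<in>A. \<forall>d\<in>A. holo_compatible c d)"

text \<open>Holomorphic coordinate systems, i.e. the charts of the maximal atlas.\<close>

definition maximal_atlas :: "('a::topological_space, 'm::finite) chart set \<Rightarrow> ('a, 'm) chart set" where
  "maximal_atlas A = {c. is_chart c \<and> (\<forall>d\<in>A. holo_compatible c d)}"


section \<open>Hermitian and Kaehler metrics\<close>

text \<open>\<open>smooth_on f S\<close>, for open \<open>S\<close>: all iterated real directional derivatives exist and are
  continuous.\<close>

primrec Ck_on :: "nat \<Rightarrow> ('a::real_normed_vector \<Rightarrow> 'b::real_normed_vector) \<Rightarrow> 'a set \<Rightarrow> bool" where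
  "Ck_on 0 f S \<longleftrightarrow> continuous_on S f"
| "Ck_on (Suc k) f S \<longleftrightarrow> (\<forall>x\<in>S. f differentiable (at x)) \<and>
     (\<forall>v. Ck_on k (\<lambda>x. frechet_derivative f (at x) v) S)"

definition smooth_on :: "('a::real_normed_vector \<Rightarrow> 'b::real_normed_vector) \<Rightarrow> 'a set \<Rightarrow> bool" where
  "smooth_on f S \<longleftrightarrow> (\<forall>k. Ck_on k f S)"

text \<open>A metric is given by its component matrices: \<open>g c z $ k $ l\<close> is the component
  $g_{k\overline{l}}$ in the chart \<open>c\<close> at the point with coordinates \<open>z\<close>. A vector
  \<open>v :: complex^'m\<close> stands for the holomorphic tangent vector
  $\sum_k v_k\,\partial/\partial z^k$ in that chart.\<close>

type_synonym ('a, 'm) metric = "('a, 'm) chart \<Rightarrow> complex^'m \<Rightarrow> complex^'m^'m"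

definition herm :: "complex^'m^'m \<Rightarrow> complex^'m \<Rightarrow> complex^'m \<Rightarrow> complex" where
  "herm G v w = (\<Sum>k\<in>UNIV. \<Sum>l\<in>UNIV. G $ k $ l * v $ k * cnj (w $ l))"

definition hermitian_metric :: "('a, 'm::finite) chart set \<Rightarrow> ('a, 'm) metric \<Rightarrow> bool" where
  "hermitian_metric A g \<longleftrightarrow>
     (\<forall>c\<in>A. \<forall>k l. smooth_on (\<lambda>z. g c z $ k $ l) (chart_image c)) \<and>
     (\<forall>c\<in>A. \<forall>z\<in>chart_image c.
        (\<forall>k l. g c z $ l $ k = cnj (g c z $ k $ l)) \<and>
        (\<forall>v. v \<noteq> 0 \<longrightarrow> Re (herm (g c z) v v) > 0)) \<and>
     (\<forall>c\<in>A. \<forall>d\<in>A. \<forall>z\<in>snd c ` (fst c \<inter> fst d). \<forall>v w.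
        herm (g c z) v w =
        herm (g d (transition c d z))
          (frechet_derivative (transition c d) (at z) v)
          (frechet_derivative (transition c d) (at z) w))"

definition hermitian_manifold ::
    "('a::{t2_space, second_countable_topology}, 'm::finite) chart set \<Rightarrow> ('a, 'm) metric \<Rightarrow> bool" where
  "hermitian_manifold A g \<longleftrightarrow> complex_atlas A \<and> hermitian_metric A g"

text \<open>The fundamental form is, up to a constant factor, the real alternating form
  $\omega(v,w) = -\mathrm{Im}\, g(v,\overline{w})$; the metric is Kaehler iff $d\omega = 0$. The cyclic
  sum below is $d\omega(u,v,w)$ for constant coordinate vector fields.\<close>

definition fundamental_form :: "complex^'m^'m \<Rightarrow> complex^'m \<Rightarrow> complex^'m \<Rightarrow> real" where
  "fundamental_form G v w = - Im (herm G v w)"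

definition kaehler_metric :: "('a, 'm::finite) chart set \<Rightarrow> ('a, 'm) metric \<Rightarrow> bool" where
  "kaehler_metric A g \<longleftrightarrow> (\<forall>c\<in>A. \<forall>z\<in>chart_image c. \<forall>u v w.
     frechet_derivative (\<lambda>y. fundamental_form (g c y) v w) (at z) u +
     frechet_derivative (\<lambda>y. fundamental_form (g c y) w u) (at z) v +
     frechet_derivative (\<lambda>y. fundamental_form (g c y) u v) (at z) w = 0)"


section \<open>Chern curvature\<close>

text \<open>Wirtinger derivatives $\partial/\partial z^i$ and $\partial/\partial\overline{z}^i$.\<close>

definition dz :: "'m \<Rightarrow> (complex^'m \<Rightarrow> complex) \<Rightarrow> complex^'m::finite \<Rightarrow> complex" where
  "dz i \<phi> z = (frechet_derivative \<phi> (at z) (axis i 1)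
     - \<i> * frechet_derivative \<phi> (at z) (axis i \<i>)) / 2"

definition dzbar :: "'m \<Rightarrow> (complex^'m \<Rightarrow> complex) \<Rightarrow> complex^'m::finite \<Rightarrow> complex" where
  "dzbar i \<phi> z = (frechet_derivative \<phi> (at z) (axis i 1)
     + \<i> * frechet_derivative \<phi> (at z) (axis i \<i>)) / 2"

text \<open>$g^{p\overline{q}}$, normalised by $\sum_q g^{p\overline{q}} g_{k\overline{q}} = \delta^p_k$;
  hence the transposed indices.\<close>

definition ginv :: "complex^'m^'m \<Rightarrow> 'm \<Rightarrow> 'm \<Rightarrow> complex" where
  "ginv G p q = matrix_inv G $ q $ p"

text \<open>The component $R_{i\overline{j}k\overline{l}}$ at \<open>z\<close>, for the component matrices \<open>G\<close> of a
  metric in one chart.\<close>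

definition chern_curv ::
    "(complex^'m \<Rightarrow> complex^'m^'m) \<Rightarrow> complex^'m \<Rightarrow> 'm::finite \<Rightarrow> 'm \<Rightarrow> 'm \<Rightarrow> 'm \<Rightarrow> complex" where
  "chern_curv G z i j k l =
     - dz i (dzbar j (\<lambda>y. G y $ k $ l)) z
     + (\<Sum>p\<in>UNIV. \<Sum>q\<in>UNIV. ginv (G z) p q *
          dz i (\<lambda>y. G y $ k $ q) z * dzbar j (\<lambda>y. G y $ p $ l) z)"

text \<open>The tensor $R(u,\overline{v},w,\overline{x})$.\<close>

definition curv_tensor ::
    "(complex^'m \<Rightarrow> complex^'m^'m) \<Rightarrow> complex^'m::finite \<Rightarrow>
     complex^'m \<Rightarrow> complex^'m \<Rightarrow> complex^'m \<Rightarrow> complex^'m \<Rightarrow> complex" where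
  "curv_tensor G z u v w x =
     (\<Sum>i\<in>UNIV. \<Sum>j\<in>UNIV. \<Sum>k\<in>UNIV. \<Sum>l\<in>UNIV.
        chern_curv G z i j k l * u $ i * cnj (v $ j) * w $ k * cnj (x $ l))"

definition chern_ricci ::
    "(complex^'m \<Rightarrow> complex^'m^'m) \<Rightarrow> complex^'m::finite \<Rightarrow> 'm \<Rightarrow> 'm \<Rightarrow> complex" where
  "chern_ricci G z i j = (\<Sum>k\<in>UNIV. \<Sum>l\<in>UNIV. ginv (G z) k l * chern_curv G z i j k l)"

definition chern_scalar :: "(complex^'m \<Rightarrow> complex^'m^'m) \<Rightarrow> complex^'m::finite \<Rightarrow> complex" where
  "chern_scalar G z = (\<Sum>i\<in>UNIV. \<Sum>j\<in>UNIV. \<Sum>k\<in>UNIV. \<Sum>l\<in>UNIV.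
     ginv (G z) i j * ginv (G z) k l * chern_curv G z i j k l)"

text \<open>\<open>E 0, \<dots>, E (\<ell> - 1)\<close> is a unitary basis of the \<open>\<ell>\<close>-dimensional complex subspace \<open>\<Sigma>\<close>.\<close>

definition unitary_basis ::
    "complex^'m^'m \<Rightarrow> nat \<Rightarrow> (complex^'m) set \<Rightarrow> (nat \<Rightarrow> complex^'m::finite) \<Rightarrow> bool" where
  "unitary_basis G l \<Sigma> E \<longleftrightarrow> vec.subspace \<Sigma> \<and> vec.dim \<Sigma> = l \<and>
     vec.span (E ` {..<l}) = \<Sigma> \<and>
     (\<forall>i<l. \<forall>j<l. herm G (E i) (E j) = (if i = j then 1 else 0))"

definition ric1 ::
    "(complex^'m \<Rightarrow> complex^'m^'m) \<Rightarrow> complex^'m::finite \<Rightarrow> nat \<Rightarrow> (nat \<Rightarrow> complex^'m) \<Rightarrow> complex^'m \<Rightarrow> complex" where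
  "ric1 G z l E v = (\<Sum>i<l. curv_tensor G z v v (E i) (E i))"

definition ric2 ::
    "(complex^'m \<Rightarrow> complex^'m^'m) \<Rightarrow> complex^'m::finite \<Rightarrow> nat \<Rightarrow> (nat \<Rightarrow> complex^'m) \<Rightarrow> complex^'m \<Rightarrow> complex" where
  "ric2 G z l E v = (\<Sum>i<l. curv_tensor G z (E i) (E i) v v)"

definition scal_l ::
    "(complex^'m \<Rightarrow> complex^'m^'m) \<Rightarrow> complex^'m::finite \<Rightarrow> nat \<Rightarrow> (nat \<Rightarrow> complex^'m) \<Rightarrow> complex" where
  "scal_l G z l E = (\<Sum>i<l. \<Sum>j<l. curv_tensor G z (E i) (E i) (E j) (E j))"

definition real_bisectional ::
    "(complex^'m \<Rightarrow> complex^'m^'m) \<Rightarrow> complex^'m::finite \<Rightarrow> ('m \<Rightarrow> complex^'m) \<Rightarrow> ('m \<Rightarrow> real) \<Rightarrow> complex" where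
  "real_bisectional G z e a =
     (\<Sum>i\<in>UNIV. \<Sum>j\<in>UNIV. curv_tensor G z (e i) (e i) (e j) (e j) * of_real (a i * a j))
       / of_real (\<Sum>i\<in>UNIV. (a i)\<^sup>2)"


section \<open>Sign conditions\<close>

text \<open>The sign is a predicate \<open>P\<close> on the reals, e.g. \<open>\<lambda>t. t < 0\<close>. All the
  curvature quantities below are real for a Hermitian metric, so \<open>Re\<close> only changes the type. They
  do not depend on the chart or on the choice of unitary basis, so quantifying
  over all charts and all unitary bases amounts to quantifying over points and subspaces.\<close>

definition scalar_sign :: "(real \<Rightarrow> bool) \<Rightarrow> ('a, 'm::finite) chart set \<Rightarrow> ('a, 'm) metric \<Rightarrow> bool" where
  "scalar_sign P A g \<longleftrightarrow> (\<forall>c\<in>A. \<forall>z\<in>chart_image c. P (Re (chern_scalar (g c) z)))"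

definition ricci_sign :: "(real \<Rightarrow> bool) \<Rightarrow> ('a, 'm::finite) chart set \<Rightarrow> ('a, 'm) metric \<Rightarrow> bool" where
  "ricci_sign P A g \<longleftrightarrow> (\<forall>c\<in>A. \<forall>z\<in>chart_image c. \<forall>v. v \<noteq> 0 \<longrightarrow>
     P (Re (\<Sum>i\<in>UNIV. \<Sum>j\<in>UNIV. chern_ricci (g c) z i j * v $ i * cnj (v $ j))))"

text \<open>For a Kaehler metric \<open>ric1\<close> and \<open>ric2\<close> agree; their common value $Ric_\ell$ is expressed by
  \<open>ric1\<close>.\<close>

definition ric1_sign :: "(real \<Rightarrow> bool) \<Rightarrow> nat \<Rightarrow> ('a, 'm::finite) chart set \<Rightarrow> ('a, 'm) metric \<Rightarrow> bool" where
  "ric1_sign P l A g \<longleftrightarrow> (\<forall>c\<in>A. \<forall>z\<in>chart_image c. \<forall>\<Sigma> E.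
     unitary_basis (g c z) l \<Sigma> E \<longrightarrow> (\<forall>v\<in>\<Sigma>. v \<noteq> 0 \<longrightarrow> P (Re (ric1 (g c) z l E v))))"

definition ric2_sign :: "(real \<Rightarrow> bool) \<Rightarrow> nat \<Rightarrow> ('a, 'm::finite) chart set \<Rightarrow> ('a, 'm) metric \<Rightarrow> bool" where
  "ric2_sign P l A g \<longleftrightarrow> (\<forall>c\<in>A. \<forall>z\<in>chart_image c. \<forall>\<Sigma> E.
     unitary_basis (g c z) l \<Sigma> E \<longrightarrow> (\<forall>v\<in>\<Sigma>. v \<noteq> 0 \<longrightarrow> P (Re (ric2 (g c) z l E v))))"

definition scal_l_sign :: "(real \<Rightarrow> bool) \<Rightarrow> nat \<Rightarrow> ('a, 'm::finite) chart set \<Rightarrow> ('a, 'm) metric \<Rightarrow> bool" where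
  "scal_l_sign P l A g \<longleftrightarrow> (\<forall>c\<in>A. \<forall>z\<in>chart_image c. \<forall>\<Sigma> E.
     unitary_basis (g c z) l \<Sigma> E \<longrightarrow> P (Re (scal_l (g c) z l E)))"

definition real_bisectional_sign ::
    "(real \<Rightarrow> bool) \<Rightarrow> ('a, 'm::finite) chart set \<Rightarrow> ('a, 'm) metric \<Rightarrow> bool" where
  "real_bisectional_sign P A g \<longleftrightarrow> (\<forall>c\<in>A. \<forall>z\<in>chart_image c. \<forall>e a.
     (\<forall>i j. herm (g c z) (e i) (e j) = (if i = j then 1 else 0)) \<and>
     (\<forall>i. a i \<ge> 0) \<and> (\<Sum>i\<in>UNIV. (a i)\<^sup>2) > 0 \<longrightarrow>
     P (Re (real_bisectional (g c) z e a)))"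


section \<open>Holomorphic maps between manifolds, rank, dimension of the image\<close>

definition coord_rep ::
    "('a, 'm::finite) chart \<Rightarrow> ('b, 'n::finite) chart \<Rightarrow> ('a \<Rightarrow> 'b) \<Rightarrow> complex^'m \<Rightarrow> complex^'n" where
  "coord_rep c d f = snd d \<circ> f \<circ> inv_chart c"

definition holomorphic_map ::
    "('a::topological_space, 'm::finite) chart set \<Rightarrow> ('b::topological_space, 'n::finite) chart set \<Rightarrow> ('a \<Rightarrow> 'b) \<Rightarrow> bool" where
  "holomorphic_map A B f \<longleftrightarrow> continuous_on UNIV f \<and>
     (\<forall>c\<in>A. \<forall>d\<in>B. holo_on (coord_rep c d f) (snd c ` (fst c \<inter> f -` fst d)))"

text \<open>The maximal rank over the manifold of the tangent map, a complex-linear map in coordinates.\<close>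

definition map_rank ::
    "('a, 'm::finite) chart set \<Rightarrow> ('b, 'n::finite) chart set \<Rightarrow> ('a \<Rightarrow> 'b) \<Rightarrow> nat" where
  "map_rank A B f = Max {vec.dim (range (frechet_derivative (coord_rep c d f) (at (snd c p)))) | c d p.
     c \<in> A \<and> d \<in> B \<and> p \<in> fst c \<and> f p \<in> fst d}"

text \<open>\<open>x\<close> is a regular point of \<open>X\<close> of dimension \<open>k\<close>: near \<open>x\<close>, the set \<open>X\<close> is a complex
  submanifold of dimension \<open>k\<close>.\<close>

definition regular_point ::
    "('b::topological_space, 'n::finite) chart set \<Rightarrow> 'b set \<Rightarrow> nat \<Rightarrow> 'b \<Rightarrow> bool" where
  "regular_point B X k x \<longleftrightarrow> x \<in> X \<and>
     (\<exists>d\<in>maximal_atlas B. \<exists>L. x \<in> fst d \<and> vec.subspace L \<and> vec.dim L = k \<and>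
        snd d ` (X \<inter> fst d) = chart_image d \<inter> L)"

text \<open>Complex dimension of an analytic subset: the largest dimension of a regular point. For a
  holomorphic map from a compact manifold the image is analytic by Remmert's proper mapping
  theorem. The set of dimensions is bounded by \<open>CARD('n)\<close>, and it is nonempty for nonempty
  analytic \<open>X\<close>, so \<open>Sup\<close> is a maximum.\<close>

definition analytic_dim :: "('b::topological_space, 'n::finite) chart set \<Rightarrow> 'b set \<Rightarrow> nat" where
  "analytic_dim B X = Sup {k. \<exists>x. regular_point B X k x}"

text \<open>A map \<open>f\<close> from \<open>(M, A)\<close> is degenerate if $\dim f(M) < \dim M$; the atlas \<open>A\<close> enters only
  through its dimension.\<close>

definition degenerate ::
    "('a, 'm::finite) chart set \<Rightarrow> ('b::topological_space, 'n::finite) chart set \<Rightarrow> ('a \<Rightarrow> 'b) \<Rightarrow> bool" where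
  "degenerate A B f \<longleftrightarrow> analytic_dim B (range f) < CARD('m)"

end

theory Submission
  imports Defs "HOL-Complex_Analysis.Complex_Analysis" "HOL-Library.Landau_Symbols"
    "Jordan_Normal_Form.Determinant"
begin

text \<open>Consider a functional of the pulled-back form \<open>f\<^sup>*h\<close> on the compact set of unitary \<open>l\<close>-frames
  of \<open>M\<close>: the determinant of its Gram matrix for the rank estimates, the trace for constancy. At a
  frame \<open>E\<close> where it is maximal, extend \<open>E\<close> along each complex line through the base point to a
  holomorphic frame whose covariant derivative vanishes there. The second-order condition for a
  maximum then compares the curvatures: for the determinant, with \<open>F\<close> a basis of the span of \<open>E\<close> whose
  image under the differential is unitary,
  \<open>\<Sum>i. R\<^sup>M(v, v, E i, E i) \<le> \<Sum>i. R\<^sup>N(f\<^sub>*v, f\<^sub>*v, f\<^sub>*F i, f\<^sub>*F i)\<close> for every \<open>v\<close>,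
  and tracing over \<open>v = E j\<close> or \<open>v = F j\<close> contradicts the sign conditions. Part (a) is the case \<open>l = m\<close>, where Sard's theorem shows that a map of
  rank less than \<open>m\<close> is degenerate. For the trace, \<open>E\<close> is chosen to diagonalise \<open>f\<^sup>*h\<close>, and the squared
  singular values become the coefficients of the real bisectional curvature.\<close>

no_notation vec_index (infixl "$" 100)
no_notation fps_nth (infixl "$" 75)
hide_fact (open) Matrix.vec_eq_iff

section \<open>Second-order jets in one complex variable\<close>

text \<open>The maximum is taken over unitary frames, but a frame that is parallel at the base point
  stays unitary only to first order, so it is not itself a competitor. For the determinant
  homogeneity repairs this: a change of frame multiplies the Gram determinants for the metric and
  for the pulled-back form by the same factor, so the maximal value bounds their ratio on all
  frames. The trace has no such scaling; there the inverse Gram matrix is replaced by its tangent 2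
  - G at the identity, a lower bound that agrees with it to the order needed. In the target the
  moving frame cannot be made parallel, because it must remain the image of a frame of M. For the
  determinant, a linear change of frame removes the part of its covariant derivative inside the
  image; the rest enters as a squared norm, which has the favourable sign. The test for a maximum
  uses only the value, the two linear coefficients and the coefficient of t * cnj t of a function of
  one complex variable. Exactly these data are propagated.\<close>

abbreviation quadratic :: "complex \<Rightarrow> complex \<Rightarrow> complex \<Rightarrow> complex \<Rightarrow> complex \<Rightarrow> complex \<Rightarrow> complex \<Rightarrow> complex" where
  "quadratic a b c d e k t \<equiv> a + b * t + c * cnj t + (d * t\<^sup>2 + e * (t * cnj t) + k * (cnj t)\<^sup>2)"

text \<open>The coefficients of t^2 and (cnj t)^2 are hidden because the test for a maximum never
  involves them; \<open>e\<close> plays the role of the mixed second Wirtinger derivative at 0. The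
  filter \<open>nhds 0\<close> includes the point 0, where t^2 vanishes, so the estimate also forces
  \<phi> 0 = \<open>a\<close>.\<close>

definition jet :: "(complex \<Rightarrow> complex) \<Rightarrow> complex \<Rightarrow> complex \<Rightarrow> complex \<Rightarrow> complex \<Rightarrow> bool" where
  "jet \<phi> a b c e \<longleftrightarrow> (\<exists>d k. (\<lambda>t. \<phi> t - quadratic a b c d e k t)
     \<in> o[nhds 0](\<lambda>t. t\<^sup>2))"

lemma jetE:
  assumes "jet \<phi> a b c e"
  obtains d k where "(\<lambda>t. \<phi> t - quadratic a b c d e k t) \<in> o[nhds 0](\<lambda>t. t\<^sup>2)"
  using assms unfolding jet_def by blast

lemma jet_cong:
  assumes "jet \<phi> a b c e" "a = a'" "b = b'" "c = c'" "e = e'"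
  shows "jet \<phi> a' b' c' e'"
  using assms by simp

lemma jet_const: "jet (\<lambda>t. a) a 0 0 0"
  unfolding jet_def by (rule exI[of _ 0], rule exI[of _ 0]) simp

lemma jet_id: "jet (\<lambda>t. t) 0 1 0 0"
  unfolding jet_def by (rule exI[of _ 0], rule exI[of _ 0]) simp

lemma jet_add:
  assumes "jet \<phi> a b c e" "jet \<psi> a' b' c' e'"
  shows "jet (\<lambda>t. \<phi> t + \<psi> t) (a + a') (b + b') (c + c') (e + e')"
proof -
  obtain d k where 1: "(\<lambda>t. \<phi> t - quadratic a b c d e k t) \<in> o[nhds 0](\<lambda>t. t\<^sup>2)"
    using jetE[OF assms(1)] .
  obtain d' k' where 2: "(\<lambda>t. \<psi> t - quadratic a' b' c' d' e' k' t) \<in> o[nhds 0](\<lambda>t. t\<^sup>2)"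
    using jetE[OF assms(2)] .
  show ?thesis unfolding jet_def
    by (rule exI[of _ "d + d'"], rule exI[of _ "k + k'"])
       (rule iffD1[OF arg_cong[of _ _ "\<lambda>f. f \<in> _"] sum_in_smallo(1)[OF 1 2]], auto simp: algebra_simps)
qed

lemma jet_bigo:
  "(\<lambda>t. cnj t) \<in> O[nhds 0](\<lambda>t. t)" "(\<lambda>t. t) \<in> o[nhds 0](\<lambda>_. 1 :: complex)"
proof -
  show "(\<lambda>t. cnj t) \<in> O[nhds 0](\<lambda>t. t)" by (rule bigoI[of _ 1]) auto
  show "(\<lambda>t. t) \<in> o[nhds 0](\<lambda>_. 1 :: complex)"
  proof (rule landau_o.smallI)
    fix r :: real assume "r > 0"
    then show "\<forall>\<^sub>F x in nhds 0. norm x \<le> r * norm (1 :: complex)"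
      unfolding eventually_nhds_metric by (intro exI[of _ r]) auto
  qed
qed

lemma jet_mult:
  assumes "jet \<phi> a b c e" "jet \<psi> a' b' c' e'"
  shows "jet (\<lambda>t. \<phi> t * \<psi> t) (a * a') (a * b' + b * a') (a * c' + c * a') (a * e' + e * a' + b * c' + c * b')"
proof -
  obtain d k where 1: "(\<lambda>t. \<phi> t - quadratic a b c d e k t) \<in> o[nhds 0](\<lambda>t. t\<^sup>2)"
    using jetE[OF assms(1)] .
  obtain d' k' where 2: "(\<lambda>t. \<psi> t - quadratic a' b' c' d' e' k' t) \<in> o[nhds 0](\<lambda>t. t\<^sup>2)"
    using jetE[OF assms(2)] .
  define p where "p \<equiv> \<lambda>t. b * t + c * cnj t"
  define p' where "p' \<equiv> \<lambda>t. b' * t + c' * cnj t"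
  define q where "q \<equiv> \<lambda>t. d * t\<^sup>2 + e * (t * cnj t) + k * (cnj t)\<^sup>2"
  define q' where "q' \<equiv> \<lambda>t. d' * t\<^sup>2 + e' * (t * cnj t) + k' * (cnj t)\<^sup>2"
  define r where "r \<equiv> \<lambda>t. \<phi> t - (a + p t + q t)"
  define r' where "r' \<equiv> \<lambda>t. \<psi> t - (a' + p' t + q' t)"
  have r: "r \<in> o[nhds 0](\<lambda>t. t\<^sup>2)" using 1 by (simp add: r_def p_def q_def algebra_simps)
  have r': "r' \<in> o[nhds 0](\<lambda>t. t\<^sup>2)" using 2 by (simp add: r'_def p'_def q'_def algebra_simps)
  note cnjO = jet_bigo(1)
  have tO: "(\<lambda>t. t) \<in> O[nhds 0](\<lambda>_. 1 :: complex)" by (rule landau_o.small_imp_big[OF jet_bigo(2)])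
  have pO: "(\<lambda>t. x * t + y * cnj t) \<in> O[nhds 0](\<lambda>t. t)" for x y
    by (intro sum_in_bigo landau_o.big.cmult_in_iff' cnjO) (auto intro: cnjO simp: landau_o.big.cmult_in_iff')
  have qO: "(\<lambda>t. x * t\<^sup>2 + y * (t * cnj t) + z * (cnj t)\<^sup>2) \<in> O[nhds 0](\<lambda>t. t\<^sup>2)" for x y z
    unfolding power2_eq_square
    by (intro sum_in_bigo) (auto intro!: landau_o.big.mult cnjO)
  have t2: "(\<lambda>t. t\<^sup>2) \<in> O[nhds 0](\<lambda>_. 1 :: complex)"
    unfolding power2_eq_square using landau_o.big.mult[OF tO tO] by simp
  have t21: "(\<lambda>t. t\<^sup>2) \<in> o[nhds 0](\<lambda>t. t :: complex)"
    unfolding power2_eq_square using landau_o.big_small_mult[OF landau_o.big_refl jet_bigo(2)] by fastforce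
  have pq: "(\<lambda>t. u t * v t) \<in> o[nhds 0](\<lambda>t. t\<^sup>2)" if "u \<in> O[nhds 0](\<lambda>t. t)" "v \<in> O[nhds 0](\<lambda>t. t\<^sup>2)" for u v :: "complex \<Rightarrow> complex"
  proof -
    have "u \<in> o[nhds 0](\<lambda>_. 1)" using landau_o.big_small_trans[OF that(1) jet_bigo(2)] .
    from landau_o.small_big_mult[OF this that(2)] show ?thesis by simp
  qed
  have ro: "(\<lambda>t. u t * v t) \<in> o[nhds 0](\<lambda>t. t\<^sup>2)" if "u \<in> o[nhds 0](\<lambda>t. t\<^sup>2)" "v \<in> O[nhds 0](\<lambda>_. 1)" for u v :: "complex \<Rightarrow> complex"
    using landau_o.small_big_mult[OF that] by simp
  have p: "p \<in> O[nhds 0](\<lambda>t. t)" "p' \<in> O[nhds 0](\<lambda>t. t)" unfolding p_def p'_def by (rule pO)+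
  have q: "q \<in> O[nhds 0](\<lambda>t. t\<^sup>2)" "q' \<in> O[nhds 0](\<lambda>t. t\<^sup>2)" unfolding q_def q'_def by (rule qO)+
  have q1: "q \<in> O[nhds 0](\<lambda>t. t)" using landau_o.big_small_trans[OF q(1) t21] landau_o.small_imp_big by blast
  have ap: "(\<lambda>t. a + p t + q t) \<in> O[nhds 0](\<lambda>_. 1)"
    by (intro sum_in_bigo) (auto intro: landau_o.big_trans[OF p(1) tO] landau_o.big_trans[OF q(1) t2])
  have psi: "(\<lambda>t. a' + p' t + q' t + r' t) \<in> O[nhds 0](\<lambda>_. 1)"
    by (intro sum_in_bigo) (auto intro: landau_o.big_trans[OF p(2) tO] landau_o.big_trans[OF q(2) t2]
       landau_o.big_trans[OF landau_o.small_imp_big[OF r'] t2])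
  \<comment> \<open>What the product contains beyond its quadratic part: products of order at least
    three, and remainders times bounded factors. Pairing \<open>r\<close> with all of \<psi> but
    \<open>r'\<close> only with the polynomial part of \<phi> counts \<open>r * r'\<close>
    once.\<close>
  have main: "(\<lambda>t. (p t * q' t + (p' t * q t + q t * q' t)) + (r t * (a' + p' t + q' t + r' t) + r' t * (a + p t + q t))) \<in> o[nhds 0](\<lambda>t. t\<^sup>2)"
    by (intro sum_in_smallo pq ro p q q1 r r' ap psi)
  show ?thesis unfolding jet_def
    \<comment> \<open>The hidden coefficients of the product, read off from t^2 and (cnj
      t)^2.\<close>
    apply (rule exI[of _ "a * d' + d * a' + b * b'"], rule exI[of _ "a * k' + k * a' + c * c'"])
    apply (rule iffD1[OF arg_cong[of _ _ "\<lambda>f. f \<in> _"] main])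
    apply (rule ext)
    apply (simp add: r_def r'_def)
    apply (simp add: p_def p'_def q_def q'_def algebra_simps power2_eq_square)
    done
qed

lemma jet_cnj:
  assumes "jet \<phi> a b c e"
  shows "jet (\<lambda>t. cnj (\<phi> t)) (cnj a) (cnj c) (cnj b) (cnj e)"
proof -
  obtain d k where 1: "(\<lambda>t. \<phi> t - quadratic a b c d e k t) \<in> o[nhds 0](\<lambda>t. t\<^sup>2)"
    using jetE[OF assms(1)] .
  then have "(\<lambda>t. cnj (\<phi> t - quadratic a b c d e k t)) \<in> o[nhds 0](\<lambda>t. t\<^sup>2)"
    by (subst landau_o.small.norm_iff[symmetric], subst complex_mod_cnj, subst landau_o.small.norm_iff)
  moreover have "(\<lambda>t. cnj (\<phi> t - quadratic a b c d e k t))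
      = (\<lambda>t. cnj (\<phi> t) - (cnj a + cnj c * t + cnj b * cnj t + (cnj k * t\<^sup>2 + cnj e * (t * cnj t) + cnj d * (cnj t)\<^sup>2)))"
    by (rule ext, simp only: complex_cnj_diff complex_cnj_add complex_cnj_mult complex_cnj_power complex_cnj_cnj, simp only: ac_simps)
  ultimately show ?thesis unfolding jet_def by (intro exI[of _ "cnj k"] exI[of _ "cnj d"]) (simp only:)
qed

lemma jet_cmult: "jet \<phi> a b c e \<Longrightarrow> jet (\<lambda>t. x * \<phi> t) (x * a) (x * b) (x * c) (x * e)"
  using jet_mult[OF jet_const[of x], of \<phi> a b c e] by simp

lemma jet_diff:
  assumes "jet \<phi> a b c e" "jet \<psi> a' b' c' e'"
  shows "jet (\<lambda>t. \<phi> t - \<psi> t) (a - a') (b - b') (c - c') (e - e')"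
  using jet_add[OF assms(1) jet_cmult[OF assms(2), of "-1"]] by simp

lemma jet_sum:
  assumes "\<And>i. i \<in> S \<Longrightarrow> jet (\<phi> i) (a i) (b i) (c i) (e i)"
  shows "jet (\<lambda>t. \<Sum>i\<in>S. \<phi> i t) (\<Sum>i\<in>S. a i) (\<Sum>i\<in>S. b i) (\<Sum>i\<in>S. c i) (\<Sum>i\<in>S. e i)"
proof (cases "finite S")
  case True
  then show ?thesis using assms
    by (induction S rule: finite_induct) (auto intro!: jet_add jet_const)
qed (simp add: jet_const)

lemma jet_transform:
  assumes "jet \<phi> a b c e" "\<forall>\<^sub>F t in nhds 0. \<phi> t = \<psi> t"
  shows "jet \<psi> a b c e"
proof -
  obtain d k where 1: "(\<lambda>t. \<phi> t - quadratic a b c d e k t) \<in> o[nhds 0](\<lambda>t. t\<^sup>2)"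
    using jetE[OF assms(1)] .
  have "(\<lambda>t. \<psi> t - quadratic a b c d e k t) \<in> o[nhds 0](\<lambda>t. t\<^sup>2)"
    by (rule iffD1[OF landau_o.small.in_cong 1]) (use assms(2) in \<open>auto elim: eventually_mono\<close>)
  then show ?thesis unfolding jet_def by blast
qed

lemma jet_smallo: "r \<in> o[nhds 0](\<lambda>t. t\<^sup>2) \<Longrightarrow> jet r 0 0 0 0"
  unfolding jet_def by (rule exI[of _ 0], rule exI[of _ 0]) simp

lemma jet_bigo_deviation:
  assumes "jet \<phi> a b c e"
  shows "(\<lambda>t. \<phi> t - a) \<in> O[nhds 0](\<lambda>t. t)"
proof -
  obtain d k where 1: "(\<lambda>t. \<phi> t - quadratic a b c d e k t) \<in> o[nhds 0](\<lambda>t. t\<^sup>2)"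
    using jetE[OF assms(1)] .
  have t1: "(\<lambda>t. t\<^sup>2) \<in> O[nhds 0](\<lambda>t. t :: complex)"
    unfolding power2_eq_square using landau_o.big.mult[OF landau_o.big_refl landau_o.small_imp_big[OF jet_bigo(2)]] by fastforce
  have t2: "(\<lambda>t. t * cnj t) \<in> O[nhds 0](\<lambda>t. t)" "(\<lambda>t. (cnj t)\<^sup>2) \<in> O[nhds 0](\<lambda>t. t)"
    by (rule landau_o.big_trans[OF _ t1], auto simp: power2_eq_square intro!: landau_o.big.mult jet_bigo(1))+
  have "(\<lambda>t. (\<phi> t - quadratic a b c d e k t)
       + (b * t + c * cnj t + (d * t\<^sup>2 + e * (t * cnj t) + k * (cnj t)\<^sup>2))) \<in> O[nhds 0](\<lambda>t. t)"
    by (intro sum_in_bigo landau_o.big_trans[OF landau_o.small_imp_big[OF 1] t1])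
       (auto intro: t1 t2 jet_bigo(1))
  then show ?thesis by simp
qed

lemma jet_tendsto: "jet \<phi> a b c e \<Longrightarrow> (\<phi> \<longlongrightarrow> a) (nhds 0)"
  using landau_o.big_small_trans[OF jet_bigo_deviation jet_bigo(2)] smalloD_tendsto[of "\<lambda>t. \<phi> t - a" "nhds 0" "\<lambda>_. 1"]
  by (simp add: LIM_zero_iff)

text \<open>The second claim averages over \<open>s\<close>, \<open>\<i>s\<close>, \<open>-s\<close>, \<open>-\<i>s\<close>, which kills every
  term up to second order except \<open>e * \<bar>t\<bar>\<^sup>2\<close>.\<close>

lemma jet_local_max:
  assumes j: "jet \<phi> a b c e" and max: "\<forall>\<^sub>F t in nhds 0. Re (\<phi> t) \<le> Re a"
  shows "b + cnj c = 0" and "Re e \<le> 0"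
proof -
  obtain d k where 1: "(\<lambda>t. \<phi> t - quadratic a b c d e k t) \<in> o[nhds 0](\<lambda>t. t\<^sup>2)"
    using jetE[OF assms(1)] .
  define p where "p \<equiv> \<lambda>t. quadratic a b c d e k t"
  \<comment> \<open>The remainder is absorbed into an arbitrarily small multiple of |t|^2, so the
    quadratic polynomial itself is almost maximal at 0.\<close>
  have ev: "\<exists>\<delta>>0. \<forall>t. norm t < \<delta> \<longrightarrow> Re (p t) \<le> Re a + r * (norm t)\<^sup>2" if "r > 0" for r
  proof -
    have "\<forall>\<^sub>F t in nhds 0. Re (p t) \<le> Re a + r * (norm t)\<^sup>2"
      using landau_o.smallD[OF 1 that] max
    proof eventually_elim
      case (elim t)
      have "Re (p t) - Re (\<phi> t) \<le> norm (\<phi> t - p t)"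
        using complex_Re_le_cmod[of "p t - \<phi> t"] by (simp add: norm_minus_commute)
      then show ?case using elim by (simp add: p_def norm_power)
    qed
    then show ?thesis by (simp add: eventually_nhds_metric)
  qed
  show "Re e \<le> 0"
  proof (rule ccontr)
    assume "\<not> Re e \<le> 0"
    then have "Re e / 2 > 0" by simp
    from ev[OF this] obtain \<delta> where \<delta>: "\<delta> > 0" "\<And>t. norm t < \<delta> \<Longrightarrow> Re (p t) \<le> Re a + Re e / 2 * (norm t)\<^sup>2" by blast
    define s where "s = \<delta> / 2"
    have s: "s > 0" "s < \<delta>" using \<delta> by (auto simp: s_def)
    have "Re (p (of_real s)) + Re (p (- of_real s)) + Re (p (\<i> * of_real s)) + Re (p (- \<i> * of_real s)) = 4 * Re a + 4 * s\<^sup>2 * Re e"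
      by (simp add: p_def power2_eq_square algebra_simps)
    moreover have "Re (p x) \<le> Re a + Re e / 2 * s\<^sup>2" if "norm x = s" for x
      using \<delta>(2)[of x] s that by simp
    from this[of "of_real s"] this[of "- of_real s"] this[of "\<i> * of_real s"] this[of "- \<i> * of_real s"] s
    have "Re (p (of_real s)) + Re (p (- of_real s)) + Re (p (\<i> * of_real s)) + Re (p (- \<i> * of_real s)) \<le> 4 * (Re a + Re e / 2 * s\<^sup>2)"
      by (simp add: norm_mult)
    ultimately have "4 * s\<^sup>2 * Re e \<le> 2 * s\<^sup>2 * Re e" by (simp add: algebra_simps)
    moreover have "s\<^sup>2 * Re e > 0" using s \<open>\<not> Re e \<le> 0\<close> by simp
    ultimately show False by linarith
  qed
  show "b + cnj c = 0"
  proof (rule ccontr)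
    assume nz: "b + cnj c \<noteq> 0"
    \<comment> \<open>The direction of steepest ascent: Re (b t + c cnj t) = Re ((b + cnj c) t),
      which at t = s w equals s |w|^2.\<close>
    define w where "w = cnj (b + cnj c)"
    define C where "C = norm (d * w\<^sup>2 + e * (w * cnj w) + k * (cnj w)\<^sup>2)"
    have w: "norm w > 0" using nz by (simp only: w_def complex_mod_cnj zero_less_norm_iff not_False_eq_True)
    from ev[of 1] obtain \<delta> where \<delta>: "\<delta> > 0" "\<And>t. norm t < \<delta> \<Longrightarrow> Re (p t) \<le> Re a + (norm t)\<^sup>2" by auto
    have ineq: "(norm w)\<^sup>2 \<le> s * (C + (norm w)\<^sup>2)" if s: "s > 0" "s * norm w < \<delta>" for s :: real
    proof -
      have "Re (p (of_real s * w)) = Re a + s * Re ((b + cnj c) * w) + s\<^sup>2 * Re (d * w\<^sup>2 + e * (w * cnj w) + k * (cnj w)\<^sup>2)"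
        by (simp add: p_def power2_eq_square algebra_simps)
      moreover have "Re ((b + cnj c) * w) = (norm w)\<^sup>2"
        by (simp add: w_def complex_mult_cnj cmod_power2 flip: complex_cnj_add)
      moreover have "Re (p (of_real s * w)) \<le> Re a + (norm (of_real s * w))\<^sup>2"
        by (rule \<delta>(2)) (use s in \<open>simp add: norm_mult\<close>)
      moreover have "- C \<le> Re (d * w\<^sup>2 + e * (w * cnj w) + k * (cnj w)\<^sup>2)"
        unfolding C_def using abs_Re_le_cmod abs_le_D2 by (metis minus_le_iff)
      then have "s\<^sup>2 * Re (d * w\<^sup>2 + e * (w * cnj w) + k * (cnj w)\<^sup>2) \<ge> s\<^sup>2 * (- C)"
        by (intro mult_left_mono) auto
      ultimately have "s * (norm w)\<^sup>2 \<le> s\<^sup>2 * C + s\<^sup>2 * (norm w)\<^sup>2"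
        using s by (simp add: norm_mult power_mult_distrib)
      then have "s * (norm w)\<^sup>2 \<le> s * (s * (C + (norm w)\<^sup>2))" by (simp add: algebra_simps power2_eq_square)
      then show ?thesis using s by simp
    qed
    have C: "C \<ge> 0" by (simp add: C_def)
    \<comment> \<open>The first bound keeps s w inside the ball of radius \<delta>; the second makes
      the quadratic error at most half of the linear gain |w|^2.\<close>
    define s where "s = min (\<delta> / (2 * norm w)) ((norm w)\<^sup>2 / (2 * (C + (norm w)\<^sup>2)))"
    have cw: "C + (norm w)\<^sup>2 > 0" using C w by (simp add: add_nonneg_pos)
    have "s > 0" using \<delta> w cw by (simp add: s_def)
    moreover have "s * norm w \<le> \<delta> / (2 * norm w) * norm w" by (intro mult_right_mono) (auto simp: s_def)
    then have "s * norm w < \<delta>" using w \<delta> by simp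
    ultimately have "(norm w)\<^sup>2 \<le> s * (C + (norm w)\<^sup>2)" by (rule ineq)
    also have "\<dots> \<le> (norm w)\<^sup>2 / (2 * (C + (norm w)\<^sup>2)) * (C + (norm w)\<^sup>2)"
      using cw by (intro mult_right_mono) (auto simp: s_def)
    also have "\<dots> = (norm w)\<^sup>2 / 2"
    proof -
      have "x / (2 * N) * N = x / 2" if "N > 0" for x N :: real using that by simp
      from this[OF cw] show ?thesis .
    qed
    finally show False using w by (simp)
  qed
qed

text \<open>Only the entries \<open>M i j\<close> with \<open>i, j < l\<close> matter; the type-indexed determinant of HOL-Analysis
  does not allow the size \<open>l\<close> to be a variable.\<close>

definition detn :: "nat \<Rightarrow> (nat \<Rightarrow> nat \<Rightarrow> complex) \<Rightarrow> complex" where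
  "detn l M = Determinant.det (Matrix.mat l l (\<lambda>(i, j). M i j))"

lemma detn_leibniz: "detn l M = (\<Sum>p | p permutes {..<l}. of_int (sign p) * (\<Prod>i<l. M i (p i)))"
proof -
  have "detn l M = (\<Sum>p | p permutes {0..<l}. of_int (sign p) * (\<Prod>i = 0..<l. Matrix.mat l l (\<lambda>(i, j). M i j) $$ (i, p i)))"
    unfolding detn_def by (subst det_def') auto
  also have "\<dots> = (\<Sum>p | p permutes {0..<l}. of_int (sign p) * (\<Prod>i = 0..<l. M i (p i)))"
  proof (intro sum.cong refl arg_cong2[where f = "(*)"] prod.cong)
    fix p i assume "p \<in> {p. p permutes {0..<l}}" "i \<in> {0..<l}"
    then have "p i < l" using permutes_in_image[of p "{0..<l}" i] by auto
    then show "Matrix.mat l l (\<lambda>(i, j). M i j) $$ (i, p i) = M i (p i)" using \<open>i \<in> _\<close> by simp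
  qed
  finally show ?thesis by (simp add: atLeast0LessThan)
qed

lemma detn_cong: "(\<And>i j. i < l \<Longrightarrow> j < l \<Longrightarrow> M i j = N i j) \<Longrightarrow> detn l M = detn l N"
  unfolding detn_def by (rule arg_cong[where f = Determinant.det]) (auto intro!: eq_matI)

lemma detn_mult: "detn l (\<lambda>i j. \<Sum>k<l. M i k * N k j) = detn l M * detn l N"
proof -
  have "Matrix.mat l l (\<lambda>(i, j). \<Sum>k<l. M i k * N k j) = Matrix.mat l l (\<lambda>(i, j). M i j) * Matrix.mat l l (\<lambda>(i, j). N i j)"
    by (rule eq_matI) (auto simp: scalar_prod_def atLeast0LessThan)
  then show ?thesis unfolding detn_def by (simp add: det_mult[where n = l])
qed

lemma detn_transpose: "detn l (\<lambda>i j. M j i) = detn l M"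
proof -
  have "Matrix.mat l l (\<lambda>(i, j). M j i) = transpose_mat (Matrix.mat l l (\<lambda>(i, j). M i j))"
    by (rule eq_matI) auto
  then show ?thesis unfolding detn_def by (simp add: det_transpose[where n = l])
qed

lemma detn_cnj: "detn l (\<lambda>i j. cnj (M i j)) = cnj (detn l M)"
  by (simp add: detn_leibniz)

lemma detn_id: "detn l (\<lambda>i j. if i = j then 1 else 0) = 1"
proof -
  have "Matrix.mat l l (\<lambda>(i, j). if i = j then 1 else 0) = (1\<^sub>m l :: complex mat)"
    by (rule eq_matI) auto
  then show ?thesis unfolding detn_def by simp
qed

lemma detn_congruence:
  "detn l (\<lambda>i j. \<Sum>p<l. \<Sum>q<l. X i p * M p q * cnj (X j q)) = detn l X * detn l M * cnj (detn l X)"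
proof -
  have "detn l (\<lambda>i j. \<Sum>p<l. \<Sum>q<l. X i p * M p q * cnj (X j q))
      = detn l (\<lambda>i j. \<Sum>q<l. (\<Sum>p<l. X i p * M p q) * cnj (X j q))"
    by (rule detn_cong, subst sum.swap) (simp add: sum_distrib_right)
  also have "\<dots> = detn l X * detn l M * cnj (detn l X)"
    by (simp add: detn_mult[where N = "\<lambda>q j. cnj (X j q)"] detn_mult
        detn_transpose[where M = "\<lambda>i j. cnj (X i j)"] detn_cnj)
  finally show ?thesis .
qed

text \<open>Since the coefficients of cnj t vanish, the cross terms of linear parts drop out of the
  mixed coefficient, which then obeys the same Leibniz rule as a first derivative.\<close>

lemma jet_prod:
  fixes a b e :: "'i \<Rightarrow> complex"
  assumes "finite S" "\<And>i. i \<in> S \<Longrightarrow> jet (\<phi> i) (a i) (b i) 0 (e i)"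
  shows "jet (\<lambda>t. \<Prod>i\<in>S. \<phi> i t) (\<Prod>i\<in>S. a i) (\<Sum>i\<in>S. b i * (\<Prod>k\<in>S - {i}. a k)) 0 (\<Sum>i\<in>S. e i * (\<Prod>k\<in>S - {i}. a k))"
  using assms
proof (induction S rule: finite_induct)
  case empty
  then show ?case by (simp add: jet_const)
next
  case (insert x S)
  have *: "(\<Sum>i\<in>insert x S. w i * (\<Prod>k\<in>insert x S - {i}. a k)) = w x * (\<Prod>k\<in>S. a k) + a x * (\<Sum>i\<in>S. w i * (\<Prod>k\<in>S - {i}. a k))"
    for w :: "'i \<Rightarrow> complex"
  proof -
    have "(\<Sum>i\<in>S. w i * (\<Prod>k\<in>insert x S - {i}. a k)) = (\<Sum>i\<in>S. a x * (w i * (\<Prod>k\<in>S - {i}. a k)))"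
    proof (rule sum.cong)
      fix i assume "i \<in> S"
      then have "insert x S - {i} = insert x (S - {i})" using insert by auto
      then show "w i * (\<Prod>k\<in>insert x S - {i}. a k) = a x * (w i * (\<Prod>k\<in>S - {i}. a k))"
        using insert by simp
    qed simp
    then show ?thesis using insert by (simp add: sum_distrib_left)
  qed
  have IH: "jet (\<lambda>t. \<Prod>i\<in>S. \<phi> i t) (\<Prod>i\<in>S. a i) (\<Sum>i\<in>S. b i * (\<Prod>k\<in>S - {i}. a k)) 0 (\<Sum>i\<in>S. e i * (\<Prod>k\<in>S - {i}. a k))"
    using insert by auto
  have x: "jet (\<phi> x) (a x) (b x) 0 (e x)" using insert by auto
  have "jet (\<lambda>t. \<phi> x t * (\<Prod>i\<in>S. \<phi> i t)) (\<Prod>i\<in>insert x S. a i)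
      (\<Sum>i\<in>insert x S. b i * (\<Prod>k\<in>insert x S - {i}. a k)) 0 (\<Sum>i\<in>insert x S. e i * (\<Prod>k\<in>insert x S - {i}. a k))"
    unfolding * by (rule jet_cong[OF jet_mult[OF x IH]]) (use insert in simp_all)
  then show ?case using insert by simp
qed

text \<open>At the identity matrix the determinant agrees with the trace in both the linear and the
  mixed coefficient: only the identity permutation contributes, because any other one has at least
  two factors with value 0.\<close>

lemma jet_detn:
  assumes "\<And>i j. i < l \<Longrightarrow> j < l \<Longrightarrow> jet (\<lambda>t. M t i j) (if i = j then 1 else 0) (b i j) 0 (e i j)"
  shows "jet (\<lambda>t. detn l (M t)) 1 (\<Sum>i<l. b i i) 0 (\<Sum>i<l. e i i)"
proof -
  let ?P = "{p. p permutes {..<l}}"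
  let ?a = "\<lambda>p. if p = id then (1::complex) else 0"
  let ?b = "\<lambda>p. if p = id then \<Sum>i<l. b i i else 0"
  let ?e = "\<lambda>p. if p = id then \<Sum>i<l. e i i else 0"
  have *: "jet (\<lambda>t. of_int (sign p) * (\<Prod>i<l. M t i (p i))) (?a p) (?b p) 0 (?e p)" if p: "p permutes {..<l}" for p
  proof -
    have "p i < l" if "i < l" for i using permutes_in_image[OF p, of i] that by auto
    then have entry: "jet (\<lambda>t. M t i (p i)) (if i = p i then 1 else 0) (b i (p i)) 0 (e i (p i))" if "i < l" for i
      using that by (intro assms)
    have "jet (\<lambda>t. \<Prod>i<l. M t i (p i)) (\<Prod>i<l. if i = p i then 1 else 0)
        (\<Sum>i<l. b i (p i) * (\<Prod>k\<in>{..<l} - {i}. if k = p k then 1 else 0)) 0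
        (\<Sum>i<l. e i (p i) * (\<Prod>k\<in>{..<l} - {i}. if k = p k then 1 else 0))"
      by (rule jet_prod, simp, rule entry, simp)
    from jet_cmult[OF this, of "of_int (sign p)"] show ?thesis
    proof (rule jet_cong)
      \<comment> \<open>A permutation other than \<open>id\<close> moves both x and p x, so after
        deletion of the factor \<open>i\<close> one vanishing factor remains.\<close>
      have **: "(\<Prod>k\<in>{..<l} - {i}. if k = p k then 1 else 0) = (if p = id then 1 else 0 :: complex)" for i
      proof (cases "p = id")
        case False
        then obtain x where x: "p x \<noteq> x" by fastforce
        have "inj p" using p permutes_inj by blast
        then have "p (p x) \<noteq> p x" using x by (simp add: inj_eq)
        moreover have "x < l" using p x unfolding permutes_def by auto
        moreover then have "p x < l" using permutes_in_image[OF p, of x] by auto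
        ultimately have "\<exists>k\<in>{..<l} - {i}. p k \<noteq> k" using x
          by (cases "i = x") auto
        then show ?thesis using False by (auto intro!: prod_zero)
      qed simp
      show "of_int (sign p) * (\<Prod>i<l. if i = p i then 1 else 0) = ?a p"
      proof (cases "p = id")
        case False
        then obtain x where x: "p x \<noteq> x" by fastforce
        then have "x < l" using p unfolding permutes_def by auto
        then show ?thesis using x False by (auto intro!: prod_zero bexI[of _ x])
      qed simp
      show "of_int (sign p) * (\<Sum>i<l. b i (p i) * (\<Prod>k\<in>{..<l} - {i}. if k = p k then 1 else 0)) = ?b p"
        unfolding ** by auto
      show "of_int (sign p) * (\<Sum>i<l. e i (p i) * (\<Prod>k\<in>{..<l} - {i}. if k = p k then 1 else 0)) = ?e p"
        unfolding ** by auto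
    qed simp
  qed
  have "jet (\<lambda>t. \<Sum>p\<in>?P. of_int (sign p) * (\<Prod>i<l. M t i (p i))) (\<Sum>p\<in>?P. ?a p) (\<Sum>p\<in>?P. ?b p) (\<Sum>p\<in>?P. 0) (\<Sum>p\<in>?P. ?e p)"
    by (rule jet_sum) (use * in auto)
  then show ?thesis unfolding detn_leibniz
    by (rule jet_cong) (auto simp: finite_permutations permutes_id sum.delta)
qed

section \<open>Taylor expansion in Wirtinger derivatives\<close>

lemma norm_vec_le_sum: "norm (x :: complex^'n::finite) \<le> (\<Sum>i\<in>UNIV. norm (x $ i))"
  unfolding norm_vec_def by (rule L2_set_le_sum) simp

lemma norm_scale_vec: "norm (c *s (v :: complex^'n::finite)) = norm c * norm v"
  by (simp add: norm_vec_def norm_mult L2_set_left_distrib L2_set_right_distrib)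

lemma linear_wirtinger:
  fixes L :: "complex^'n::finite \<Rightarrow> complex"
  assumes "linear L"
  shows "L v = (\<Sum>i\<in>UNIV. (L (axis i 1) - \<i> * L (axis i \<i>)) / 2 * v $ i
      + (L (axis i 1) + \<i> * L (axis i \<i>)) / 2 * cnj (v $ i))"
proof -
  have "v = (\<Sum>i\<in>UNIV. Re (v $ i) *\<^sub>R axis i 1 + Im (v $ i) *\<^sub>R axis i \<i>)"
  proof (rule vec_eq_iff[THEN iffD2], rule allI)
    fix k
    have "(\<Sum>i\<in>UNIV. Re (v $ i) *\<^sub>R axis i 1 + Im (v $ i) *\<^sub>R axis i \<i>) $ k
        = (\<Sum>i\<in>UNIV. if i = k then Re (v $ k) *\<^sub>R 1 + Im (v $ k) *\<^sub>R \<i> else 0)"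
      unfolding sum_component by (rule sum.cong) (auto simp: axis_def)
    also have "\<dots> = v $ k" by (simp add: sum.delta complex_eq_iff)
    finally show "v $ k = (\<Sum>i\<in>UNIV. Re (v $ i) *\<^sub>R axis i 1 + Im (v $ i) *\<^sub>R axis i \<i>) $ k" by simp
  qed
  then have "L v = L (\<Sum>i\<in>UNIV. Re (v $ i) *\<^sub>R axis i 1 + Im (v $ i) *\<^sub>R axis i \<i>)" by simp
  also have "\<dots> = (\<Sum>i\<in>UNIV. Re (v $ i) *\<^sub>R L (axis i 1) + Im (v $ i) *\<^sub>R L (axis i \<i>))"
    by (simp add: linear_sum[OF assms] linear_add[OF assms] linear_scale[OF assms])
  also have "\<dots> = (\<Sum>i\<in>UNIV. (L (axis i 1) - \<i> * L (axis i \<i>)) / 2 * v $ i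
      + (L (axis i 1) + \<i> * L (axis i \<i>)) / 2 * cnj (v $ i))"
  proof (rule sum.cong[OF refl])
    fix i
    have "(a - \<i> * b) / 2 * z + (a + \<i> * b) / 2 * cnj z = Re z *\<^sub>R a + Im z *\<^sub>R b" for a b z :: complex
      by (simp add: complex_eq_iff) (simp add: field_simps)
    then show "Re (v $ i) *\<^sub>R L (axis i 1) + Im (v $ i) *\<^sub>R L (axis i \<i>) = (L (axis i 1) - \<i> * L (axis i \<i>)) / 2 * v $ i
      + (L (axis i 1) + \<i> * L (axis i \<i>)) / 2 * cnj (v $ i)" by simp
  qed
  finally show ?thesis .
qed

lemma frechet_derivative_wirtinger:
  assumes "\<phi> differentiable at z"
  shows "frechet_derivative \<phi> (at z) v = (\<Sum>i\<in>UNIV. dz i \<phi> z * v $ i + dzbar i \<phi> z * cnj (v $ i))"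
  unfolding dz_def dzbar_def by (rule linear_wirtinger[OF linear_frechet_derivative[OF assms]])

definition wirtinger_taylor :: "(complex^'n::finite \<Rightarrow> complex) \<Rightarrow> complex^'n \<Rightarrow> complex^'n \<Rightarrow> complex" where
  "wirtinger_taylor \<phi> z \<eta> = \<phi> z + (\<Sum>j\<in>UNIV. dz j \<phi> z * \<eta> $ j + dzbar j \<phi> z * cnj (\<eta> $ j))
     + (\<Sum>j\<in>UNIV. frechet_derivative (dz j \<phi>) (at z) \<eta> * \<eta> $ j
          + frechet_derivative (dzbar j \<phi>) (at z) \<eta> * cnj (\<eta> $ j)) / 2"

text \<open>Integrating the first-order expansion of the derivative along the segment from \<open>z\<close> avoids the
  symmetry of second derivatives.\<close>

lemma wirtinger_taylor_remainder:
  fixes \<phi> :: "complex^'n::finite \<Rightarrow> complex"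
  assumes V: "open V" "z \<in> V" and d1: "\<And>y. y \<in> V \<Longrightarrow> \<phi> differentiable at y"
    and d2: "\<And>j. dz j \<phi> differentiable at z" "\<And>j. dzbar j \<phi> differentiable at z"
  shows "(\<lambda>\<eta>. \<phi> (z + \<eta>) - wirtinger_taylor \<phi> z \<eta>) \<in> o[nhds 0](\<lambda>\<eta>. complex_of_real ((norm \<eta>)\<^sup>2))"
proof (rule landau_o.smallI)
  fix r :: real assume r: "r > 0"
  \<comment> \<open>The number of summands below, one \<open>dz\<close> and one \<open>dzbar\<close>
    term per coordinate; each contributes at most \<epsilon> |\<eta>|^2.\<close>
  define N where "N = 2 * real CARD('n)"
  have N: "N > 0" by (simp add: N_def)
  define \<epsilon> where "\<epsilon> = r / N"
  have eps: "\<epsilon> > 0" using r N by (simp add: \<epsilon>_def)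
  have ev: "\<forall>\<^sub>F \<eta> in nhds 0. norm (\<psi> (z + \<eta>) - \<psi> z - frechet_derivative \<psi> (at z) \<eta>) \<le> \<epsilon> * norm \<eta>"
    if d: "\<psi> differentiable at z" for \<psi> :: "complex^'n \<Rightarrow> complex"
  proof -
    from frechet_derivative_works[THEN iffD1, OF d] eps obtain \<delta> where "\<delta> > 0"
      "\<And>y. norm (y - z) < \<delta> \<Longrightarrow> norm (\<psi> y - \<psi> z - frechet_derivative \<psi> (at z) (y - z)) \<le> \<epsilon> * norm (y - z)"
      unfolding has_derivative_at_alt by blast
    from this(1) this(2)[of "z + _"] show ?thesis
      unfolding eventually_nhds_metric by (intro exI[of _ \<delta>]) auto
  qed
  have "\<forall>\<^sub>F \<eta> in nhds 0. z + \<eta> \<in> V"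
  proof -
    from V obtain \<delta> where "\<delta> > 0" "ball z \<delta> \<subseteq> V" by (meson openE)
    then show ?thesis unfolding eventually_nhds_metric
      by (intro exI[of _ \<delta>]) (auto simp: subset_iff dist_norm)
  qed
  moreover have "\<forall>\<^sub>F \<eta> in nhds 0. \<forall>j. norm (dz j \<phi> (z + \<eta>) - dz j \<phi> z - frechet_derivative (dz j \<phi>) (at z) \<eta>) \<le> \<epsilon> * norm \<eta>"
    by (rule eventually_all_finite) (rule ev[OF d2(1)])
  moreover have "\<forall>\<^sub>F \<eta> in nhds 0. \<forall>j. norm (dzbar j \<phi> (z + \<eta>) - dzbar j \<phi> z - frechet_derivative (dzbar j \<phi>) (at z) \<eta>) \<le> \<epsilon> * norm \<eta>"
    by (rule eventually_all_finite) (rule ev[OF d2(2)])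
  ultimately have "\<forall>\<^sub>F \<eta> in nhds 0. z + \<eta> \<in> V
      \<and> (\<forall>j. norm (dz j \<phi> (z + \<eta>) - dz j \<phi> z - frechet_derivative (dz j \<phi>) (at z) \<eta>) \<le> \<epsilon> * norm \<eta>)
      \<and> (\<forall>j. norm (dzbar j \<phi> (z + \<eta>) - dzbar j \<phi> z - frechet_derivative (dzbar j \<phi>) (at z) \<eta>) \<le> \<epsilon> * norm \<eta>)"
    by eventually_elim auto
  then obtain \<delta> where \<delta>: "\<delta> > 0" and
    near: "\<And>\<eta>. norm \<eta> < \<delta> \<Longrightarrow> z + \<eta> \<in> V"
      "\<And>\<eta> j. norm \<eta> < \<delta> \<Longrightarrow> norm (dz j \<phi> (z + \<eta>) - dz j \<phi> z - frechet_derivative (dz j \<phi>) (at z) \<eta>) \<le> \<epsilon> * norm \<eta>"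
      "\<And>\<eta> j. norm \<eta> < \<delta> \<Longrightarrow> norm (dzbar j \<phi> (z + \<eta>) - dzbar j \<phi> z - frechet_derivative (dzbar j \<phi>) (at z) \<eta>) \<le> \<epsilon> * norm \<eta>"
    unfolding eventually_nhds_metric by auto
  show "\<forall>\<^sub>F \<eta> in nhds 0. norm (\<phi> (z + \<eta>) - wirtinger_taylor \<phi> z \<eta>) \<le> r * norm (complex_of_real ((norm \<eta>)\<^sup>2))"
    unfolding eventually_nhds_metric
  proof (intro exI[of _ \<delta>] conjI allI impI \<delta>)
    fix \<eta> :: "complex^'n" assume "dist \<eta> 0 < \<delta>"
    then have \<eta>: "norm \<eta> < \<delta>" by simp
    define A where "A = (\<Sum>j\<in>UNIV. dz j \<phi> z * \<eta> $ j + dzbar j \<phi> z * cnj (\<eta> $ j))"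
    define B where "B = (\<Sum>j\<in>UNIV. frechet_derivative (dz j \<phi>) (at z) \<eta> * \<eta> $ j
          + frechet_derivative (dzbar j \<phi>) (at z) \<eta> * cnj (\<eta> $ j))"
    \<comment> \<open>The Taylor error along the segment: \<psi> 1 - \<psi> 0 is the remainder to be
      bounded, and \<psi>' is the error of the first-order expansion of the derivative.\<close>
    define \<psi> where "\<psi> = (\<lambda>s::real. \<phi> (z + s *\<^sub>R \<eta>) - s *\<^sub>R A - (s\<^sup>2 / 2) *\<^sub>R B)"
    define \<psi>' where "\<psi>' = (\<lambda>s::real. frechet_derivative \<phi> (at (z + s *\<^sub>R \<eta>)) \<eta> - A - s *\<^sub>R B)"
    have s\<eta>: "norm (s *\<^sub>R \<eta>) < \<delta>" if "s \<in> {0..1}" for s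
      using that \<eta> by (auto intro: le_less_trans[OF mult_left_le_one_le])
    have der: "(\<psi> has_derivative (\<lambda>h. h *\<^sub>R \<psi>' s)) (at s within {0..1})" if s: "s \<in> {0..1}" for s
    proof -
      have "(\<phi> has_derivative frechet_derivative \<phi> (at (z + s *\<^sub>R \<eta>))) (at (z + s *\<^sub>R \<eta>))"
        using d1[OF near(1)[OF s\<eta>[OF s]]] frechet_derivative_works by blast
      moreover have "((\<lambda>s. z + s *\<^sub>R \<eta>) has_derivative (\<lambda>h. h *\<^sub>R \<eta>)) (at s within {0..1})"
        by (auto intro!: derivative_eq_intros)
      ultimately have "((\<lambda>s. \<phi> (z + s *\<^sub>R \<eta>)) has_derivative (\<lambda>h. frechet_derivative \<phi> (at (z + s *\<^sub>R \<eta>)) (h *\<^sub>R \<eta>))) (at s within {0..1})"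
        by (rule has_derivative_compose[rotated])
      moreover have "frechet_derivative \<phi> (at (z + s *\<^sub>R \<eta>)) (h *\<^sub>R \<eta>) = h *\<^sub>R frechet_derivative \<phi> (at (z + s *\<^sub>R \<eta>)) \<eta>" for h
        by (rule linear_scale[OF linear_frechet_derivative]) (rule d1[OF near(1)[OF s\<eta>[OF s]]])
      ultimately have 1: "((\<lambda>s. \<phi> (z + s *\<^sub>R \<eta>)) has_derivative (\<lambda>h. h *\<^sub>R frechet_derivative \<phi> (at (z + s *\<^sub>R \<eta>)) \<eta>)) (at s within {0..1})"
        by simp
      have 2: "((\<lambda>s. (s\<^sup>2 / 2) *\<^sub>R B) has_derivative (\<lambda>h. h *\<^sub>R s *\<^sub>R B)) (at s within {0..1})"
        by (auto intro!: derivative_eq_intros)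
      have 3: "((\<lambda>s. s *\<^sub>R A) has_derivative (\<lambda>h. h *\<^sub>R A)) (at s within {0..1})"
        by (auto intro!: derivative_eq_intros)
      show ?thesis unfolding \<psi>_def \<psi>'_def
        using has_derivative_diff[OF has_derivative_diff[OF 1 3] 2] by (simp add: scaleR_diff_right)
    qed
    have bd: "norm (\<psi>' s) \<le> r * (norm \<eta>)\<^sup>2" if s: "s \<in> {0..1}" for s
    proof -
      let ?x = "s *\<^sub>R \<eta>"
      let ?u = "\<lambda>j. dz j \<phi> (z + ?x) - dz j \<phi> z - frechet_derivative (dz j \<phi>) (at z) ?x"
      let ?w = "\<lambda>j. dzbar j \<phi> (z + ?x) - dzbar j \<phi> z - frechet_derivative (dzbar j \<phi>) (at z) ?x"
      have sc: "frechet_derivative (dz j \<phi>) (at z) ?x = s *\<^sub>R frechet_derivative (dz j \<phi>) (at z) \<eta>"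
        "frechet_derivative (dzbar j \<phi>) (at z) ?x = s *\<^sub>R frechet_derivative (dzbar j \<phi>) (at z) \<eta>" for j
        by (rule linear_scale[OF linear_frechet_derivative[OF d2(1)]], rule linear_scale[OF linear_frechet_derivative[OF d2(2)]])
      have eq: "\<psi>' s = (\<Sum>j\<in>UNIV. ?u j * \<eta> $ j + ?w j * cnj (\<eta> $ j))"
        unfolding \<psi>'_def A_def B_def frechet_derivative_wirtinger[OF d1[OF near(1)[OF s\<eta>[OF s]]]] sc scaleR_sum_right
          sum_subtractf[symmetric]
        by (rule sum.cong) (simp_all add: algebra_simps)
      have "norm (\<psi>' s) \<le> (\<Sum>j\<in>(UNIV::'n set). \<epsilon> * (norm \<eta>)\<^sup>2 + \<epsilon> * (norm \<eta>)\<^sup>2)"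
        unfolding eq
      proof (rule norm_sum[THEN order_trans], rule sum_mono)
        fix j
        have xn: "norm ?x \<le> norm \<eta>" using s by (auto intro: mult_left_le_one_le)
        have e: "a * norm (\<eta> $ j) \<le> \<epsilon> * (norm \<eta>)\<^sup>2" if "a \<le> \<epsilon> * norm ?x" for a
        proof -
          have "a * norm (\<eta> $ j) \<le> (\<epsilon> * norm \<eta>) * norm (\<eta> $ j)"
            using that xn eps by (intro mult_right_mono) (auto intro: order_trans[OF _ mult_left_mono[OF xn]])
          also have "\<dots> \<le> (\<epsilon> * norm \<eta>) * norm \<eta>"
            using eps by (intro mult_left_mono) (auto simp: Finite_Cartesian_Product.norm_nth_le)
          finally show ?thesis by (simp add: power2_eq_square mult.assoc)
        qed
        show "norm (?u j * \<eta> $ j + ?w j * cnj (\<eta> $ j)) \<le> \<epsilon> * (norm \<eta>)\<^sup>2 + \<epsilon> * (norm \<eta>)\<^sup>2"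
          using e[OF near(2)[OF s\<eta>[OF s]], of j] e[OF near(3)[OF s\<eta>[OF s]], of j]
          by (intro norm_triangle_le) (simp add: norm_mult)
      qed
      also have "\<dots> = (N * \<epsilon>) * (norm \<eta>)\<^sup>2" by (simp add: N_def)
      also have "\<dots> = r * (norm \<eta>)\<^sup>2" using N by (simp only: \<epsilon>_def) simp
      finally show ?thesis .
    qed
    have "norm (\<psi> 1 - \<psi> 0) \<le> r * (norm \<eta>)\<^sup>2 * norm (1 - 0 :: real)"
    proof (rule differentiable_bound[OF _ der])
      fix s :: real assume s: "s \<in> {0..1}"
      show "onorm (\<lambda>h. h *\<^sub>R \<psi>' s) \<le> r * (norm \<eta>)\<^sup>2"
      proof (rule onorm_le)
        fix h :: real
        have "norm (h *\<^sub>R \<psi>' s) = \<bar>h\<bar> * norm (\<psi>' s)" by simp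
        also have "\<dots> \<le> \<bar>h\<bar> * (r * (norm \<eta>)\<^sup>2)" by (rule mult_left_mono[OF bd[OF s]]) simp
        finally show "norm (h *\<^sub>R \<psi>' s) \<le> r * (norm \<eta>)\<^sup>2 * norm h" by (simp only: real_norm_def mult.commute)
      qed
    qed auto
    moreover have "\<psi> 1 - \<psi> 0 = \<phi> (z + \<eta>) - wirtinger_taylor \<phi> z \<eta>"
      by (simp add: \<psi>_def wirtinger_taylor_def A_def B_def scaleR_conv_of_real)
    ultimately show "norm (\<phi> (z + \<eta>) - wirtinger_taylor \<phi> z \<eta>) \<le> r * norm (complex_of_real ((norm \<eta>)\<^sup>2))" by (simp add: norm_power)
  qed
qed

lemma Ck_differentiable: "Ck_on (Suc k) \<phi> V \<Longrightarrow> y \<in> V \<Longrightarrow> \<phi> differentiable at y"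
  by simp

lemma Ck_differentiable_dz:
  assumes "Ck_on (Suc (Suc k)) \<phi> V" "y \<in> V"
  shows "dz j \<phi> differentiable at y" "dzbar j \<phi> differentiable at y"
proof -
  have d: "(\<lambda>x. frechet_derivative \<phi> (at x) v) differentiable at y" for v
    using assms by auto
  show "dz j \<phi> differentiable at y"
    unfolding dz_def[abs_def] by (intro derivative_intros d) simp
  show "dzbar j \<phi> differentiable at y"
    unfolding dzbar_def[abs_def] by (intro derivative_intros d) simp
qed

text \<open>Along a curve that is holomorphic to second order, only mixed derivatives of \<phi>
  reach the mixed coefficient. Both orders of differentiation appear, with weight one half each, as
  they are not identified with each other here.\<close>

lemma jet_compose:
  fixes \<phi> :: "complex^'n::finite \<Rightarrow> complex"
  assumes V: "open V" "y0 \<in> V" and C: "Ck_on (Suc (Suc 0)) \<phi> V"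
    and y: "\<And>k. jet (\<lambda>t. y t $ k) (y0 $ k) (u $ k) 0 0"
  shows "jet (\<lambda>t. \<phi> (y t)) (\<phi> y0) (\<Sum>j\<in>UNIV. dz j \<phi> y0 * u $ j) (\<Sum>j\<in>UNIV. dzbar j \<phi> y0 * cnj (u $ j))
    ((\<Sum>j\<in>UNIV. \<Sum>i\<in>UNIV. dzbar i (dz j \<phi>) y0 * cnj (u $ i) * u $ j + dz i (dzbar j \<phi>) y0 * u $ i * cnj (u $ j)) / 2)"
proof -
  define \<eta> where "\<eta> = (\<lambda>t. y t - y0)"
  have \<eta>: "jet (\<lambda>t. \<eta> t $ k) 0 (u $ k) 0 0" for k
    using jet_diff[OF y[of k] jet_const[of "y0 $ k"]] by (simp add: \<eta>_def)
  have \<eta>c: "jet (\<lambda>t. cnj (\<eta> t $ k)) 0 0 (cnj (u $ k)) 0" for k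
    using jet_cnj[OF \<eta>[of k]] by simp
  have "(\<lambda>t. \<Sum>k\<in>UNIV. norm (\<eta> t $ k)) \<in> O[nhds 0](\<lambda>t::complex. norm t)"
    using jet_bigo_deviation[OF \<eta>] by (intro big_sum_in_bigo) simp
  moreover have "(\<lambda>t. norm (\<eta> t)) \<in> O[nhds 0](\<lambda>t. \<Sum>k\<in>UNIV. norm (\<eta> t $ k))"
    by (rule bigoI[of _ 1]) (simp add: norm_vec_le_sum sum_nonneg abs_of_nonneg)
  ultimately have \<eta>O: "(\<lambda>t. norm (\<eta> t)) \<in> O[nhds 0](\<lambda>t::complex. norm t)"
    using landau_o.big_trans by blast
  have \<eta>0: "(\<eta> \<longlongrightarrow> 0) (nhds 0)"
    using jet_tendsto[OF \<eta>] by (auto intro!: vec_tendstoI)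
  have "(\<lambda>\<eta>. \<phi> (y0 + \<eta>) - wirtinger_taylor \<phi> y0 \<eta>) \<in> o[nhds 0](\<lambda>\<eta>. complex_of_real ((norm \<eta>)\<^sup>2))"
    by (rule wirtinger_taylor_remainder[OF V]) (use C V Ck_differentiable_dz[OF C] in auto)
  from landau_o.small.compose[OF this \<eta>0]
  have "(\<lambda>t. \<phi> (y0 + \<eta> t) - wirtinger_taylor \<phi> y0 (\<eta> t)) \<in> o[nhds 0](\<lambda>t. complex_of_real ((norm (\<eta> t))\<^sup>2))" .
  also have "(\<lambda>t. (norm (\<eta> t))\<^sup>2) \<in> O[nhds 0](\<lambda>t::complex. (norm t)\<^sup>2)"
    unfolding power2_eq_square by (intro landau_o.big.mult \<eta>O)
  then have "(\<lambda>t. complex_of_real ((norm (\<eta> t))\<^sup>2)) \<in> O[nhds 0](\<lambda>t::complex. t\<^sup>2)"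
    by (subst landau_o.big.norm_iff[symmetric]) (simp add: norm_power)
  finally have rem: "(\<lambda>t. \<phi> (y0 + \<eta> t) - wirtinger_taylor \<phi> y0 (\<eta> t)) \<in> o[nhds 0](\<lambda>t::complex. t\<^sup>2)" .
  have D: "frechet_derivative \<psi> (at y0) (\<eta> t) = (\<Sum>i\<in>UNIV. dz i \<psi> y0 * \<eta> t $ i + dzbar i \<psi> y0 * cnj (\<eta> t $ i))"
    if "\<psi> differentiable at y0" for \<psi> t
    by (rule frechet_derivative_wirtinger[OF that])
  have lin: "jet (\<lambda>t. \<Sum>i\<in>UNIV. dz i \<psi> y0 * \<eta> t $ i + dzbar i \<psi> y0 * cnj (\<eta> t $ i)) 0
      (\<Sum>i\<in>UNIV. dz i \<psi> y0 * u $ i) (\<Sum>i\<in>UNIV. dzbar i \<psi> y0 * cnj (u $ i)) 0" for \<psi>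
    by (rule jet_cong[OF jet_sum[OF jet_add[OF jet_cmult[OF \<eta>] jet_cmult[OF \<eta>c]]]]) simp_all
  have quad: "jet (\<lambda>t. (\<Sum>j\<in>UNIV. frechet_derivative (dz j \<phi>) (at y0) (\<eta> t) * \<eta> t $ j
          + frechet_derivative (dzbar j \<phi>) (at y0) (\<eta> t) * cnj (\<eta> t $ j))) 0 0 0
      (\<Sum>j\<in>UNIV. (\<Sum>i\<in>UNIV. dzbar i (dz j \<phi>) y0 * cnj (u $ i)) * u $ j + (\<Sum>i\<in>UNIV. dz i (dzbar j \<phi>) y0 * u $ i) * cnj (u $ j))"
    unfolding D[OF Ck_differentiable_dz(1)[OF C V(2)]] D[OF Ck_differentiable_dz(2)[OF C V(2)]]
    by (rule jet_cong[OF jet_sum[OF jet_add[OF jet_mult[OF lin \<eta>] jet_mult[OF lin \<eta>c]]]]) simp_all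
  have "jet (\<lambda>t. wirtinger_taylor \<phi> y0 (\<eta> t)) (\<phi> y0) (\<Sum>j\<in>UNIV. dz j \<phi> y0 * u $ j) (\<Sum>j\<in>UNIV. dzbar j \<phi> y0 * cnj (u $ j))
    ((\<Sum>j\<in>UNIV. \<Sum>i\<in>UNIV. dzbar i (dz j \<phi>) y0 * cnj (u $ i) * u $ j + dz i (dzbar j \<phi>) y0 * u $ i * cnj (u $ j)) / 2)"
    unfolding wirtinger_taylor_def
    using jet_add[OF jet_add[OF jet_const[of "\<phi> y0"] lin[of \<phi>]] jet_cmult[OF quad, of "1/2"]]
    by (simp add: sum_distrib_right sum.distrib)
  from jet_add[OF jet_smallo[OF rem] this] show ?thesis by (simp add: \<eta>_def)
qed

section \<open>Holomorphic maps\<close>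

text \<open>Removing the singularity of the difference quotient twice gives f t = f 0 + f' 0 t + t^2
  k t with k holomorphic; continuity of k at 0 makes t^2 (k t - k 0) negligible.\<close>

lemma holomorphic_jet:
  assumes f: "f holomorphic_on S" and S: "open S" "0 \<in> S"
  shows "jet f (f 0) (deriv f 0) 0 0"
proof -
  define g where "g = (\<lambda>z. if z = 0 then deriv f 0 else (f z - f 0) / (z - 0))"
  define k where "k = (\<lambda>z. if z = 0 then deriv g 0 else (g z - g 0) / (z - 0))"
  have g: "g holomorphic_on S" unfolding g_def by (rule pole_lemma_open[OF f S(1)])
  have k: "k holomorphic_on S" unfolding k_def by (rule pole_lemma_open[OF g S(1)])
  have fg: "f z = f 0 + z * g z" for z by (simp add: g_def)
  have gk: "g z = g 0 + z * k z" for z by (simp add: k_def)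
  have "isCont k 0" using holomorphic_on_imp_continuous_on[OF k] S continuous_on_eq_continuous_at by blast
  then have "((\<lambda>t. k t - k 0) \<longlongrightarrow> 0) (nhds 0)"
    by (simp add: LIM_zero_iff isCont_def tendsto_nhds_iff)
  then have "(\<lambda>t. k t - k 0) \<in> o[nhds 0](\<lambda>_. 1)" by (simp add: smalloI_tendsto)
  from landau_o.big_small_mult[OF landau_o.big_refl[of "\<lambda>t. t\<^sup>2"] this]
  have r: "(\<lambda>t. t\<^sup>2 * (k t - k 0)) \<in> o[nhds 0](\<lambda>t. t\<^sup>2)" by simp
  have "f t - (f 0 + deriv f 0 * t + 0 * cnj t + (k 0 * t\<^sup>2 + 0 * (t * cnj t) + 0 * (cnj t)\<^sup>2)) = t\<^sup>2 * (k t - k 0)" for t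
  proof -
    have "g 0 = deriv f 0" by (simp add: g_def)
    then show ?thesis using fg[of t] gk[of t] by (simp add: algebra_simps power2_eq_square)
  qed
  then show ?thesis unfolding jet_def using r by (intro exI[of _ "k 0"] exI[of _ 0]) simp
qed

lemma holo_on_derivative:
  assumes "holo_on F U" "z \<in> U"
  shows "(F has_derivative frechet_derivative F (at z)) (at z)"
    and "frechet_derivative F (at z) (c *s v) = c *s frechet_derivative F (at z) v"
proof -
  from assms obtain D where D: "(F has_derivative D) (at z)" "\<forall>c v. D (c *s v) = c *s D v"
    unfolding holo_on_def by blast
  then have "frechet_derivative F (at z) = D" using frechet_derivative_at by fastforce
  then show "(F has_derivative frechet_derivative F (at z)) (at z)"
    "frechet_derivative F (at z) (c *s v) = c *s frechet_derivative F (at z) v" using D by auto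
qed

lemma holo_on_line:
  assumes F: "holo_on F U" and z: "z + \<tau> *s w \<in> U"
  shows "((\<lambda>\<tau>. F (z + \<tau> *s w) $ k) has_field_derivative frechet_derivative F (at (z + \<tau> *s w)) w $ k) (at \<tau>)"
proof -
  have "bounded_linear (\<lambda>h. h *s w)"
    by (rule bounded_linear_intro[of _ "norm w"]) (auto simp: vec_eq_iff algebra_simps norm_scale_vec)
  from has_derivative_add[OF has_derivative_const bounded_linear_imp_has_derivative[OF this], of z]
  have "((\<lambda>\<tau>. z + \<tau> *s w) has_derivative (\<lambda>h. h *s w)) (at \<tau>)"
    by simp
  from has_derivative_compose[OF this holo_on_derivative(1)[OF F z]]
  have "((\<lambda>\<tau>. F (z + \<tau> *s w)) has_derivative (\<lambda>h. frechet_derivative F (at (z + \<tau> *s w)) (h *s w))) (at \<tau>)" .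
  then have "((\<lambda>\<tau>. F (z + \<tau> *s w) $ k) has_derivative (\<lambda>h. frechet_derivative F (at (z + \<tau> *s w)) (h *s w) $ k)) (at \<tau>)"
    by (rule bounded_linear.has_derivative[OF bounded_linear_vec_nth])
  then show ?thesis unfolding has_field_derivative_def
    by (rule has_derivative_eq_rhs) (simp add: fun_eq_iff holo_on_derivative(2)[OF F z] mult.commute)
qed

text \<open>\<open>holo_on\<close> requires the derivative only pointwise. Its continuity comes from
  Cauchy's inequality on a disc in direction \<open>w\<close>, applied to the difference of F along
  two parallel discs, which is uniformly small by uniform continuity of F.\<close>

lemma holo_on_continuous_derivative:
  assumes F: "holo_on F U" and U: "open U"
  shows "continuous_on U (\<lambda>z. frechet_derivative F (at z) w)"
proof -
  have "isCont (\<lambda>z. frechet_derivative F (at z) w $ k) z" if z: "z \<in> U" for z k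
  proof -
    from U z obtain r where r: "r > 0" "cball z r \<subseteq> U" using open_contains_cball by blast
    \<comment> \<open>Chosen so that R + R |w| = r: a base point at distance R and a disc of radius
      R in direction w stay inside the closed ball.\<close>
    define R where "R = r / (1 + norm w)"
    have nw: "1 + norm w > 0" by (simp add: add_pos_nonneg)
    have R: "R > 0" using r nw by (simp add: R_def)
    have "R * (1 + norm w) = r" using nw by (simp only: R_def) simp
    then have R: "R > 0" "R * norm w + R = r" using R by (simp_all add: algebra_simps)
    have inball: "z' + \<tau> *s w \<in> cball z r" if "dist z z' \<le> R" "norm \<tau> \<le> R" for z' \<tau>
    proof -
      have "dist z (z' + \<tau> *s w) \<le> norm (z - z') + norm (\<tau> *s w)"
        by (simp add: dist_norm) (metis diff_diff_eq norm_triangle_ineq4)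
      also have "\<dots> \<le> R + R * norm w"
        using that by (intro add_mono) (auto simp: norm_scale_vec dist_norm intro: mult_right_mono)
      finally show ?thesis using R by simp
    qed
    have "continuous_on U F" using F holo_on_derivative(1)[OF F]
      by (meson has_derivative_continuous continuous_at_imp_continuous_on)
    then have "continuous_on (cball z r) (\<lambda>x. F x $ k)"
      using r(2) by (intro continuous_intros) (auto elim: continuous_on_subset)
    then have uc: "uniformly_continuous_on (cball z r) (\<lambda>x. F x $ k)"
      by (rule compact_uniformly_continuous) simp
    show ?thesis unfolding continuous_at_eps_delta
    proof (intro allI impI)
      fix e :: real assume e: "e > 0"
      then have eR: "e / 2 * R > 0" using R by simp
      obtain \<delta> where \<delta>: "\<delta> > 0" "\<And>x x'. x \<in> cball z r \<Longrightarrow> x' \<in> cball z r \<Longrightarrow> dist x' x < \<delta> \<Longrightarrow> dist (F x' $ k) (F x $ k) < e / 2 * R"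
        using uniformly_continuous_onE[OF uc eR] by metis
      show "\<exists>d>0. \<forall>x'. dist x' z < d \<longrightarrow> dist (frechet_derivative F (at x') w $ k) (frechet_derivative F (at z) w $ k) < e"
      proof (intro exI[of _ "min \<delta> R"] conjI allI impI)
        show "min \<delta> R > 0" using \<delta> R by simp
        fix z' assume z': "dist z' z < min \<delta> R"
        define h where "h = (\<lambda>\<tau>. F (z' + \<tau> *s w) $ k - F (z + \<tau> *s w) $ k)"
        have hd: "(h has_field_derivative (frechet_derivative F (at (z' + \<tau> *s w)) w $ k - frechet_derivative F (at (z + \<tau> *s w)) w $ k)) (at \<tau>)"
          if "norm \<tau> \<le> R" for \<tau>
          unfolding h_def using inball[of z' \<tau>] inball[of z \<tau>] z' R that r(2)
          by (intro DERIV_diff holo_on_line[OF F]) (auto simp: dist_commute)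
        have "norm ((deriv ^^ 1) h 0) \<le> fact 1 * (e / 2 * R) / R ^ 1"
        proof (rule Cauchy_inequality)
          show "h holomorphic_on ball 0 R"
            by (rule holomorphic_onI) (auto simp: field_differentiable_def intro!: exI has_field_derivative_at_within[OF hd])
          show "continuous_on (cball 0 R) h"
            by (rule continuous_at_imp_continuous_on) (auto intro!: DERIV_isCont[OF hd])
          show "R > 0" by (rule R)
          fix \<tau> :: complex assume "norm (0 - \<tau>) = R"
          then have "dist (F (z' + \<tau> *s w) $ k) (F (z + \<tau> *s w) $ k) < e / 2 * R"
            using z' R by (intro \<delta> inball) (auto simp: dist_commute dist_norm)
          then show "norm (h \<tau>) \<le> e / 2 * R" by (simp add: h_def dist_norm)
        qed
        moreover have "deriv h 0 = frechet_derivative F (at z') w $ k - frechet_derivative F (at z) w $ k"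
          using DERIV_imp_deriv[OF hd[of 0]] R by simp
        ultimately show "dist (frechet_derivative F (at z') w $ k) (frechet_derivative F (at z) w $ k) < e"
          using R e by (simp add: dist_norm)
      qed
    qed
  qed
  then have "continuous_on U (\<lambda>z. \<chi> k. frechet_derivative F (at z) w $ k)"
    by (intro continuous_on_vec_lambda continuous_at_imp_continuous_on) auto
  then show ?thesis by simp
qed

text \<open>As a function of t, the derivative in direction \<open>w\<close> is the uniform limit of
  difference quotients, each holomorphic in t. By Weierstrass the entries of the differential are
  holomorphic along complex lines, so they have jets without antiholomorphic or mixed part.\<close>

lemma holo_on_derivative_jet:
  assumes F: "holo_on F U" and U: "open U" and z: "z \<in> U"
  shows "\<exists>b. jet (\<lambda>t. frechet_derivative F (at (z + t *s v)) w $ k) (frechet_derivative F (at z) w $ k) b 0 0"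
proof -
  from U z obtain r where r: "r > 0" "cball z r \<subseteq> U" using open_contains_cball by blast
  define N where "N = 1 + norm v + norm w"
  define R where "R = r / N"
  have N: "N > 0" by (simp add: N_def add_pos_nonneg)
  have R: "R > 0" "R * N = r" using r N by (auto simp: R_def)
  have inball: "z + t *s v + \<tau> *s w \<in> cball z r" if "norm t \<le> R" "norm \<tau> \<le> R" for t \<tau>
  proof -
    have "dist z (z + t *s v + \<tau> *s w) = norm (t *s v + \<tau> *s w)"
      by (metis add.assoc add_diff_cancel_left' dist_commute dist_norm)
    also have "\<dots> \<le> R * norm v + R * norm w"
      using that by (intro norm_triangle_le add_mono) (auto simp: norm_scale_vec intro: mult_right_mono)
    also have "\<dots> \<le> r" unfolding R(2)[symmetric] N_def using R by (simp add: algebra_simps)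
    finally show ?thesis by simp
  qed
  define D where "D = (\<lambda>x. frechet_derivative F (at x) w $ k)"
  have "continuous_on (cball z r) D" unfolding D_def
    by (intro continuous_intros continuous_on_subset[OF holo_on_continuous_derivative[OF F U] r(2)])
  then have uc: "uniformly_continuous_on (cball z r) D"
    by (rule compact_uniformly_continuous) simp
  \<comment> \<open>Step lengths of the difference quotients: nonzero, at most R, and tending to
    0.\<close>
  define \<tau> where "\<tau> = (\<lambda>n. of_real (R / (real n + 1)) :: complex)"
  have \<tau>: "norm (\<tau> n) \<le> R" "\<tau> n \<noteq> 0" for n
    using R by (auto simp: \<tau>_def norm_divide divide_simps abs_mult simp flip: of_real_add)
  have "(\<lambda>n. R * (1 / (real n + 1))) \<longlonglongrightarrow> R * 0"
    by (intro tendsto_intros LIMSEQ_ignore_initial_segment[OF lim_1_over_n, of 1, simplified add.commute[of 1]]) (use LIMSEQ_inverse_real_of_nat in \<open>simp add: inverse_eq_divide add.commute\<close>)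
  then have \<tau>0: "(\<lambda>n. norm (\<tau> n)) \<longlonglongrightarrow> 0"
    using R by (simp add: \<tau>_def norm_divide abs_of_nonneg flip: of_real_add)
  define f where "f = (\<lambda>n t. (F (z + t *s v + \<tau> n *s w) $ k - F (z + t *s v) $ k) / \<tau> n)"
  define g where "g = (\<lambda>t. D (z + t *s v))"
  have "g holomorphic_on ball 0 R"
  proof (rule holomorphic_uniform_sequence)
    show "open (ball (0::complex) R)" by simp
    show "f n holomorphic_on ball 0 R" for n
    proof (rule holomorphic_onI)
      fix t assume t: "t \<in> ball (0::complex) R"
      have 1: "((\<lambda>t. F (z + \<tau> n *s w + t *s v) $ k) has_field_derivative frechet_derivative F (at (z + \<tau> n *s w + t *s v)) v $ k) (at t)"
        using inball[of t "\<tau> n"] t r(2) \<tau>(1)[of n] by (intro holo_on_line[OF F]) (auto simp: algebra_simps)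
      have 2: "((\<lambda>t. F (z + t *s v) $ k) has_field_derivative frechet_derivative F (at (z + t *s v)) v $ k) (at t)"
        using inball[of t 0] t r(2) R by (intro holo_on_line[OF F]) auto
      have "f n = (\<lambda>t. (F (z + \<tau> n *s w + t *s v) $ k - F (z + t *s v) $ k) / \<tau> n)"
        by (simp add: f_def fun_eq_iff add_ac)
      with DERIV_cdivide[OF DERIV_diff[OF 1 2], of "\<tau> n"] show "f n field_differentiable at t within ball 0 R"
        by (auto simp: field_differentiable_def intro: has_field_derivative_at_within)
    qed
    have unif: "uniform_limit (ball 0 R) f g sequentially"
      unfolding uniform_limit_iff
    proof (intro allI impI)
      fix e :: real assume e: "e > 0"
      obtain \<delta> where \<delta>: "\<delta> > 0" "\<And>x x'. x \<in> cball z r \<Longrightarrow> x' \<in> cball z r \<Longrightarrow> dist x' x < \<delta> \<Longrightarrow> dist (D x') (D x) < e / 2"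
        using uniformly_continuous_onE[OF uc half_gt_zero[OF e]] by metis
      have "(\<lambda>n. norm (\<tau> n) * norm w) \<longlonglongrightarrow> 0 * norm w" by (intro tendsto_intros \<tau>0)
      then have "\<forall>\<^sub>F n in sequentially. norm (\<tau> n) * norm w < \<delta>"
        using \<delta>(1) by (intro order_tendstoD) auto
      then show "\<forall>\<^sub>F n in sequentially. \<forall>t\<in>ball 0 R. dist (f n t) (g t) < e"
      proof eventually_elim
        case (elim n)
        show ?case
        proof
          fix t assume t: "t \<in> ball (0::complex) R"
          \<comment> \<open>With the candidate limit subtracted as a linear term, H (\<tau> n) - H 0
            is \<tau> n times the error f n t - g t, so a bound on the derivative of H
            suffices.\<close>
          define H where "H = (\<lambda>s. F (z + t *s v + s *s w) $ k - s * g t)"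
          have "norm (H (\<tau> n) - H 0) \<le> e / 2 * norm (\<tau> n - 0)"
          proof (rule field_differentiable_bound)
            fix s assume s: "s \<in> cball (0::complex) (norm (\<tau> n))"
            then have sR: "norm s \<le> R" using \<tau>(1)[of n] by auto
            have "((\<lambda>s. F (z + t *s v + s *s w) $ k) has_field_derivative D (z + t *s v + s *s w)) (at s)"
              unfolding D_def using inball[of t s] t r(2) sR by (intro holo_on_line[OF F]) auto
            then show "(H has_field_derivative D (z + t *s v + s *s w) - g t) (at s within cball 0 (norm (\<tau> n)))"
              unfolding H_def by (auto intro!: derivative_eq_intros intro: has_field_derivative_at_within)
            have "dist (D (z + t *s v + s *s w)) (D (z + t *s v)) < e / 2"
            proof (rule \<delta>)
              show "z + t *s v \<in> cball z r" using inball[of t 0] t R by simp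
              show "z + t *s v + s *s w \<in> cball z r" using inball[of t s] t sR by simp
              have "norm s * norm w \<le> norm (\<tau> n) * norm w" using s by (intro mult_right_mono) auto
              then show "dist (z + t *s v + s *s w) (z + t *s v) < \<delta>"
                using elim by (simp add: dist_norm norm_scale_vec)
            qed
            then show "norm (D (z + t *s v + s *s w) - g t) \<le> e / 2" by (simp add: g_def dist_norm)
          qed auto
          then have "norm (f n t - g t) * norm (\<tau> n) \<le> e / 2 * norm (\<tau> n)"
          proof -
            have "(f n t - g t) * \<tau> n = H (\<tau> n) - H 0"
            proof -
              have "(x / \<tau> n - y) * \<tau> n = x - \<tau> n * y" for x y using \<tau>(2)[of n] by (simp add: field_simps)
              then show ?thesis by (simp add: H_def f_def)
            qed
            with \<open>norm (H (\<tau> n) - H 0) \<le> _\<close> show ?thesis by (simp flip: norm_mult)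
          qed
          then show "dist (f n t) (g t) < e" using \<tau>(2)[of n] e by (simp add: dist_norm)
        qed
      qed
    qed
    fix x assume "x \<in> ball (0::complex) R"
    then obtain d where "d > 0" "cball x d \<subseteq> ball 0 R"
      using open_contains_cball[of "ball (0::complex) R"] open_ball by blast
    then show "\<exists>d>0. cball x d \<subseteq> ball 0 R \<and> uniform_limit (cball x d) f g sequentially"
      using uniform_limit_on_subset[OF unif] by blast
  qed
  from holomorphic_jet[OF this] R show ?thesis by (auto simp: g_def D_def)
qed

lemma holo_on_jet:
  assumes F: "holo_on F U" and U: "open U" and z: "z \<in> U"
  shows "jet (\<lambda>t. F (z + t *s v) $ k) (F z $ k) (frechet_derivative F (at z) v $ k) 0 0"
proof -
  from U z obtain r where r: "r > 0" "cball z r \<subseteq> U" using open_contains_cball by blast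
  define R where "R = r / (1 + norm v)"
  have nv: "1 + norm v > 0" by (simp add: add_pos_nonneg)
  have R: "R > 0" "R * (1 + norm v) = r" using r nv by (auto simp: R_def)
  have inU: "z + t *s v \<in> U" if "norm t \<le> R" for t
  proof -
    have "norm t * norm v \<le> R * norm v" using that by (intro mult_right_mono) auto
    also have "\<dots> \<le> r" using R by (simp add: algebra_simps)
    finally have "z + t *s v \<in> cball z r" by (simp add: dist_norm norm_scale_vec)
    then show ?thesis using r by blast
  qed
  have d: "((\<lambda>t. F (z + t *s v) $ k) has_field_derivative frechet_derivative F (at (z + t *s v)) v $ k) (at t)"
    if "norm t \<le> R" for t
    by (rule holo_on_line[OF F inU[OF that]])
  have "(\<lambda>t. F (z + t *s v) $ k) holomorphic_on ball 0 R"
    by (rule holomorphic_onI) (auto simp: field_differentiable_def intro!: exI has_field_derivative_at_within[OF d])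
  from holomorphic_jet[OF this] R DERIV_imp_deriv[OF d[of 0]] show ?thesis by simp
qed

section \<open>Hermitian forms and orthonormal frames\<close>

definition hermitian_mat :: "complex^'m^'m \<Rightarrow> bool" where
  "hermitian_mat G \<longleftrightarrow> (\<forall>k l. G $ l $ k = cnj (G $ k $ l))"

definition pos_herm :: "complex^'m^'m \<Rightarrow> bool" where
  "pos_herm G \<longleftrightarrow> hermitian_mat G \<and> (\<forall>v. v \<noteq> 0 \<longrightarrow> Re (herm G v v) > 0)"

definition orthonormal :: "complex^'m^'m \<Rightarrow> nat \<Rightarrow> (nat \<Rightarrow> complex^'m) \<Rightarrow> bool" where
  "orthonormal G l E \<longleftrightarrow> (\<forall>i<l. \<forall>j<l. herm G (E i) (E j) = (if i = j then 1 else 0))"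

lemma herm_add_left: "herm G (u + v) w = herm G u w + herm G v w"
  by (simp add: herm_def algebra_simps sum.distrib)

lemma herm_add_right: "herm G u (v + w) = herm G u v + herm G u w"
  by (simp add: herm_def algebra_simps sum.distrib)

lemma herm_scale_left: "herm G (c *s v) w = c * herm G v w"
  by (simp add: herm_def sum_distrib_left mult_ac)

lemma herm_scale_right: "herm G v (c *s w) = cnj c * herm G v w"
  by (simp add: herm_def sum_distrib_left mult_ac)

lemma herm_zero: "herm G 0 w = 0" "herm G v 0 = 0"
  by (simp_all add: herm_def)

lemma herm_diff_left: "herm G (u - v) w = herm G u w - herm G v w"
  by (simp add: herm_def algebra_simps sum_subtractf)

lemma herm_diff_right: "herm G u (v - w) = herm G u v - herm G u w"
  by (simp add: herm_def algebra_simps sum_subtractf)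

lemma herm_sum_left: "herm G (\<Sum>i\<in>S. f i) w = (\<Sum>i\<in>S. herm G (f i) w)"
  by (induction S rule: infinite_finite_induct) (simp_all add: herm_zero herm_add_left)

lemma herm_sum_right: "herm G w (\<Sum>i\<in>S. f i) = (\<Sum>i\<in>S. herm G w (f i))"
  by (induction S rule: infinite_finite_induct) (simp_all add: herm_zero herm_add_right)

lemmas herm_linear = herm_add_left herm_add_right herm_scale_left herm_scale_right
  herm_diff_left herm_diff_right herm_sum_left herm_sum_right

lemma herm_cnj:
  assumes "hermitian_mat G"
  shows "cnj (herm G v w) = herm G w v"
proof -
  have "cnj (herm G v w) = (\<Sum>k\<in>UNIV. \<Sum>l\<in>UNIV. G $ l $ k * cnj (v $ k) * w $ l)"
  proof -
    have "cnj (G $ k $ l) = G $ l $ k" for k l using assms unfolding hermitian_mat_def by metis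
    then show ?thesis by (simp add: herm_def)
  qed
  also have "\<dots> = (\<Sum>l\<in>UNIV. \<Sum>k\<in>UNIV. G $ l $ k * cnj (v $ k) * w $ l)" by (rule sum.swap)
  also have "\<dots> = herm G w v" by (simp add: herm_def mult_ac)
  finally show ?thesis .
qed

lemma herm_real: "hermitian_mat G \<Longrightarrow> herm G v v = of_real (Re (herm G v v))"
  using herm_cnj[of G v v] by (simp add: complex_eq_iff)

lemma pos_hermD:
  assumes "pos_herm G"
  shows "hermitian_mat G" "v \<noteq> 0 \<Longrightarrow> Re (herm G v v) > 0" "Re (herm G v v) \<ge> 0"
  using assms by (auto simp: pos_herm_def less_imp_le herm_zero) (cases "v = 0"; auto simp: herm_zero less_imp_le)

section \<open>Pullback and uniform positivity of Hermitian forms\<close>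

definition pullback :: "complex^'n^'n \<Rightarrow> (complex^'m \<Rightarrow> complex^'n) \<Rightarrow> complex^'m^'m" where
  "pullback H L = (\<chi> i j. herm H (L (axis i 1)) (L (axis j 1)))"

lemma herm_pullback:
  assumes L: "linear L" "\<And>c v. L (c *s v) = c *s L v"
  shows "herm (pullback H L) v w = herm H (L v) (L w)"
proof -
  have e: "L v = (\<Sum>i\<in>UNIV. v $ i *s L (axis i 1))" for v
    by (subst basis_expansion[symmetric]) (simp only: linear_sum[OF L(1)] L(2))
  have "herm H (L v) (L w) = (\<Sum>i\<in>UNIV. \<Sum>j\<in>UNIV. v $ i * (cnj (w $ j) * herm H (L (axis i 1)) (L (axis j 1))))"
    unfolding e[of v] e[of w] herm_sum_left
    by (simp add: herm_sum_right herm_scale_left herm_scale_right sum_distrib_left mult_ac)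
  also have "\<dots> = herm (pullback H L) v w"
    unfolding herm_def[of "pullback H L"] by (simp add: pullback_def mult_ac)
  finally show ?thesis by simp
qed

lemma hermitian_pullback: "hermitian_mat H \<Longrightarrow> hermitian_mat (pullback H L)"
  unfolding hermitian_mat_def[of "pullback H L"] by (simp add: pullback_def herm_cnj)

text \<open>The minimum over the compact product of Z with the unit sphere is positive, and
  homogeneity extends the bound to all vectors. It is what bounds unitary vectors uniformly.\<close>

lemma herm_coercive:
  fixes G :: "'z::metric_space \<Rightarrow> complex^'m::finite^'m"
  assumes Z: "compact Z" and G: "\<And>k l. continuous_on Z (\<lambda>z. G z $ k $ l)" and pos: "\<And>z. z \<in> Z \<Longrightarrow> pos_herm (G z)"
  shows "\<exists>\<mu>>0. \<forall>z\<in>Z. \<forall>v. \<mu> * (norm v)\<^sup>2 \<le> Re (herm (G z) v v)"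
proof (cases "Z = {}")
  case True
  then show ?thesis by (auto intro: exI[of _ 1])
next
  case False
  let ?K = "Z \<times> sphere (0 :: complex^'m) 1"
  have K: "compact ?K" using Z by (intro compact_Times) auto
  have "norm (axis (SOME i. True) 1 :: complex^'m) = 1" by simp
  then have "?K \<noteq> {}" using False by force
  moreover have "continuous_on ?K (\<lambda>x. Re (herm (G (fst x)) (snd x) (snd x)))"
    unfolding herm_def
    by (intro continuous_intros continuous_on_compose2[OF G]) auto
  ultimately obtain x where x: "x \<in> ?K" "\<And>y. y \<in> ?K \<Longrightarrow> Re (herm (G (fst x)) (snd x) (snd x)) \<le> Re (herm (G (fst y)) (snd y) (snd y))"
    using continuous_attains_inf[OF K] by blast
  define \<mu> where "\<mu> = Re (herm (G (fst x)) (snd x) (snd x))"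
  have "snd x \<noteq> 0" using x(1) by (auto simp: mem_Times_iff)
  then have "\<mu> > 0" unfolding \<mu>_def using x(1) by (intro pos_hermD(2) pos) (auto simp: mem_Times_iff)
  moreover have "\<mu> * (norm v)\<^sup>2 \<le> Re (herm (G z) v v)" if z: "z \<in> Z" for z v
  proof (cases "v = 0")
    case False
    define u where "u = of_real (inverse (norm v)) *s v"
    have u: "norm u = 1" using False by (simp add: u_def norm_scale_vec norm_inverse)
    have v: "v = of_real (norm v) *s u" using False by (simp add: u_def vector_smult_assoc)
    have "herm (G z) v v = of_real ((norm v)\<^sup>2) * herm (G z) u u"
      by (subst (1 2) v) (simp add: herm_scale_left herm_scale_right power2_eq_square)
    then have "Re (herm (G z) v v) = (norm v)\<^sup>2 * Re (herm (G z) u u)" by simp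
    moreover have "\<mu> \<le> Re (herm (G z) u u)" using x(2)[of "(z, u)"] z u by (simp add: \<mu>_def)
    ultimately show ?thesis by (simp add: mult.commute[of \<mu>] mult_left_mono)
  qed (simp add: herm_zero)
  ultimately show ?thesis by blast
qed

text \<open>The vectors that satisfy the formula form a subspace containing every
  \<open>E i\<close>. The formula also serves for the pulled-back form, which may be degenerate on
  the whole tangent space.\<close>

lemma orthonormal_expand:
  assumes E: "orthonormal G l E" and x: "x \<in> vec.span (E ` {..<l})"
  shows "x = (\<Sum>i<l. herm G x (E i) *s E i)"
proof -
  have "vec.span (E ` {..<l}) \<subseteq> {x. x = (\<Sum>i<l. herm G x (E i) *s E i)}"
  proof (rule vec.span_minimal)
    show "E ` {..<l} \<subseteq> {x. x = (\<Sum>i<l. herm G x (E i) *s E i)}"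
    proof clarify
      fix j assume j: "j < l"
      have "(\<Sum>i<l. herm G (E j) (E i) *s E i) = (\<Sum>i<l. if i = j then E j else 0)"
        using E j by (intro sum.cong) (auto simp: orthonormal_def)
      then show "E j = (\<Sum>i<l. herm G (E j) (E i) *s E i)" using j by simp
    qed
    show "vec.subspace {x. x = (\<Sum>i<l. herm G x (E i) *s E i)}"
    proof (rule vec.subspaceI)
      fix x y assume "x \<in> {x. x = (\<Sum>i<l. herm G x (E i) *s E i)}" "y \<in> {x. x = (\<Sum>i<l. herm G x (E i) *s E i)}"
      then have x: "x = (\<Sum>i<l. herm G x (E i) *s E i)" and y: "y = (\<Sum>i<l. herm G y (E i) *s E i)" by auto
      have "(\<Sum>i<l. herm G (x + y) (E i) *s E i) = (\<Sum>i<l. herm G x (E i) *s E i) + (\<Sum>i<l. herm G y (E i) *s E i)"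
        by (simp add: herm_add_left vector_sadd_rdistrib sum.distrib)
      then show "x + y \<in> {x. x = (\<Sum>i<l. herm G x (E i) *s E i)}" using x y by simp
    next
      fix c x assume "x \<in> {x. x = (\<Sum>i<l. herm G x (E i) *s E i)}"
      then have x: "x = (\<Sum>i<l. herm G x (E i) *s E i)" by auto
      have "(\<Sum>i<l. herm G (c *s x) (E i) *s E i) = c *s (\<Sum>i<l. herm G x (E i) *s E i)"
        by (simp add: herm_scale_left vec.scale_sum_right)
      then show "c *s x \<in> {x. x = (\<Sum>i<l. herm G x (E i) *s E i)}" using x by simp
    qed (simp add: herm_zero)
  qed
  then show ?thesis using x by blast
qed

lemma orthonormal_dim:
  assumes E: "orthonormal G l (E :: nat \<Rightarrow> complex^'m::finite)"
  shows "vec.dim (vec.span (E ` {..<l})) = l"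
  using assms
proof (induction l)
  case 0
  then show ?case by (simp add: vec.dim_span)
next
  case (Suc l)
  then have l: "orthonormal G l E" by (auto simp: orthonormal_def)
  have "E l \<notin> vec.span (E ` {..<l})"
  proof
    assume "E l \<in> vec.span (E ` {..<l})"
    from orthonormal_expand[OF l this] have "E l = (\<Sum>i<l. herm G (E l) (E i) *s E i)" .
    also have "\<dots> = 0" using Suc.prems by (intro sum.neutral) (auto simp: orthonormal_def)
    finally have "E l = 0" .
    then have "herm G (E l) (E l) = 0" by (simp add: herm_zero)
    then show False using Suc.prems by (auto simp: orthonormal_def)
  qed
  then show ?case using Suc.IH[OF l] by (simp add: lessThan_Suc vec.dim_span vec.dim_insert)
qed

lemma orthonormal_unitary_basis:
  "orthonormal G l E \<Longrightarrow> unitary_basis G l (vec.span (E ` {..<l})) E"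
  unfolding unitary_basis_def using orthonormal_dim by (auto simp: orthonormal_def vec.subspace_span)

lemma orthonormal_extend_one:
  assumes G: "pos_herm G" and u: "orthonormal G k u" and S: "vec.subspace S" "\<And>i. i < k \<Longrightarrow> u i \<in> S"
    and k: "k < vec.dim S"
  shows "\<exists>x\<in>S. herm G x x = 1 \<and> (\<forall>i<k. herm G x (u i) = 0)"
proof -
  have "\<not> S \<subseteq> vec.span (u ` {..<k})"
  proof
    assume "S \<subseteq> vec.span (u ` {..<k})"
    then have "vec.dim S \<le> vec.dim (vec.span (u ` {..<k}))" by (rule vec.dim_subset)
    then show False using k orthonormal_dim[OF u] by simp
  qed
  then obtain x where x: "x \<in> S" "x \<notin> vec.span (u ` {..<k})" by blast
  define p where "p = (\<Sum>i<k. herm G x (u i) *s u i)"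
  have p: "p \<in> vec.span (u ` {..<k})" unfolding p_def
    by (intro vec.span_sum vec.span_scale vec.span_base) auto
  have pS: "p \<in> S" unfolding p_def
    by (intro vec.subspace_sum vec.subspace_scale S) auto
  define r where "r = x - p"
  have r: "r \<in> S" "r \<noteq> 0" using x p pS S by (auto simp: r_def vec.subspace_diff)
  have ortho: "herm G r (u j) = 0" if j: "j < k" for j
  proof -
    have "herm G p (u j) = (\<Sum>i<k. if i = j then herm G x (u j) else 0)"
      unfolding p_def herm_linear using u j by (intro sum.cong) (auto simp: orthonormal_def)
    then show ?thesis using j by (simp add: r_def herm_diff_left)
  qed
  define c where "c = Re (herm G r r)"
  have c: "c > 0" using pos_hermD(2)[OF G r(2)] by (simp add: c_def)
  have hc: "herm G r r = of_real c" using herm_real[OF pos_hermD(1)[OF G]] by (simp add: c_def)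
  define y where "y = of_real (1 / sqrt c) *s r"
  have "herm G y y = of_real (1 / sqrt c) * (of_real (1 / sqrt c) * of_real c)"
    by (simp add: y_def herm_scale_left herm_scale_right hc)
  also have "\<dots> = of_real (1 / sqrt c * (1 / sqrt c) * c)" by (simp only: of_real_mult mult.assoc)
  also have "1 / sqrt c * (1 / sqrt c) * c = 1" using c by (simp add: field_simps)
  finally have "herm G y y = 1" by simp
  moreover have "y \<in> S" using r S by (simp add: y_def vec.subspace_scale)
  moreover have "\<forall>i<k. herm G y (u i) = 0" using ortho by (simp add: y_def herm_scale_left)
  ultimately show ?thesis by blast
qed

lemma orthonormal_extend:
  assumes G: "pos_herm G" and u: "orthonormal G k u" and S: "vec.subspace S" "\<And>i. i < k \<Longrightarrow> u i \<in> S"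
    and "k \<le> j" "j \<le> vec.dim S"
  shows "\<exists>u'. orthonormal G j u' \<and> (\<forall>i<j. u' i \<in> S) \<and> (\<forall>i<k. u' i = u i)"
  using assms(5,6)
proof (induction j rule: dec_induct)
  case base
  then show ?case using u S by blast
next
  case (step j)
  then obtain u' where u': "orthonormal G j u'" "\<forall>i<j. u' i \<in> S" "\<forall>i<k. u' i = u i" by auto
  from orthonormal_extend_one[OF G u'(1) S(1)] u'(2) step obtain x where
    x: "x \<in> S" "herm G x x = 1" "\<forall>i<j. herm G x (u' i) = 0" by auto
  have "herm G (u' i) x = 0" if "i < j" for i
    using herm_cnj[OF pos_hermD(1)[OF G], of x "u' i"] x(3) that by simp
  then have "orthonormal G (Suc j) (u'(j := x))" using u'(1) x by (auto simp: orthonormal_def less_Suc_eq)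
  moreover have "\<forall>i<Suc j. (u'(j := x)) i \<in> S" using u' x by (auto simp: less_Suc_eq)
  moreover have "\<forall>i<k. (u'(j := x)) i = u i" using u' step by auto
  ultimately show ?case by blast
qed

lemma orthonormal_span_eq:
  assumes "orthonormal G l u" "vec.subspace S" "\<And>i. i < l \<Longrightarrow> u i \<in> S" "vec.dim S \<le> l"
  shows "vec.span (u ` {..<l}) = S"
proof (rule vec.subspace_dim_equal[OF vec.subspace_span assms(2)])
  show "vec.span (u ` {..<l}) \<subseteq> S" by (rule vec.span_minimal) (use assms in auto)
qed (use assms orthonormal_dim[OF assms(1)] in simp)

lemma orthonormal_UNIV:
  assumes "orthonormal G k (u :: nat \<Rightarrow> complex^'m::finite)" "pos_herm G" "k \<le> j" "j \<le> CARD('m)"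
  shows "\<exists>u'. orthonormal G j u' \<and> (\<forall>i<k. u' i = u i)"
  using orthonormal_extend[OF assms(2,1) vec.subspace_UNIV, of j] assms(3,4) unfolding vec_dim_card by auto

text \<open>The vectors \<open>e i\<close> may be dependent: a unitary basis of their span, which
  has dimension at most \<open>l\<close>, is completed to length \<open>l\<close>. Thus any
  \<open>l\<close>-tuple is a matrix times a unitary frame.\<close>

lemma orthonormal_spanning:
  fixes e :: "nat \<Rightarrow> complex^'m::finite"
  assumes G: "pos_herm G" and l: "l \<le> CARD('m)"
  shows "\<exists>u. orthonormal G l u \<and> (\<forall>i<l. e i \<in> vec.span (u ` {..<l}))"
proof -
  let ?S = "vec.span (e ` {..<l})"
  have "vec.dim ?S \<le> card (e ` {..<l})" by (simp add: vec.dim_span vec.dim_le_card')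
  also have "\<dots> \<le> l" using card_image_le[of "{..<l}" e] by simp
  finally have d: "vec.dim ?S \<le> l" .
  have "orthonormal G 0 e" by (simp add: orthonormal_def)
  from orthonormal_extend[OF G this vec.subspace_span, of "e ` {..<l}" "vec.dim ?S"]
  obtain u0 where u0: "orthonormal G (vec.dim ?S) u0" "\<forall>i<vec.dim ?S. u0 i \<in> ?S" by auto
  from orthonormal_UNIV[OF u0(1) G d l] obtain u where u: "orthonormal G l u" "\<forall>i<vec.dim ?S. u i = u0 i" by blast
  have "?S = vec.span (u0 ` {..<vec.dim ?S})"
    using orthonormal_span_eq[OF u0(1) vec.subspace_span[of "e ` {..<l}"]] u0(2) by simp
  also have "\<dots> \<subseteq> vec.span (u ` {..<l})"
  proof (rule vec.span_mono)
    show "u0 ` {..<vec.dim ?S} \<subseteq> u ` {..<l}"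
    proof
      fix x assume "x \<in> u0 ` {..<vec.dim ?S}"
      then obtain i where "i < vec.dim ?S" "x = u0 i" by auto
      then show "x \<in> u ` {..<l}" using u(2) d by (intro image_eqI[of _ _ i]) auto
    qed
  qed
  finally show ?thesis using u(1) vec.span_base[of _ "e ` {..<l}"] by blast
qed

section \<open>Gram matrices under a change of frame\<close>

lemma gram_change:
  assumes "\<And>i. i < l \<Longrightarrow> e i = (\<Sum>p<l. X i p *s u p)" "i < l" "j < l"
  shows "herm G (e i) (e j) = (\<Sum>p<l. \<Sum>q<l. X i p * herm G (u p) (u q) * cnj (X j q))"
  unfolding assms(1)[OF assms(2)] assms(1)[OF assms(3)] herm_sum_left
  by (simp add: herm_sum_right herm_scale_left herm_scale_right sum_distrib_left mult_ac)

text \<open>The factor |det X|^2 is the same for every form G. This common scaling is what allows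
  the determinants of two forms to be compared on frames that are not unitary.\<close>

lemma detn_gram_change:
  assumes "\<And>i. i < l \<Longrightarrow> e i = (\<Sum>p<l. X i p *s u p)"
  shows "detn l (\<lambda>i j. herm G (e i) (e j)) = of_real ((norm (detn l X))\<^sup>2) * detn l (\<lambda>i j. herm G (u i) (u j))"
proof -
  have "detn l (\<lambda>i j. herm G (e i) (e j)) = detn l (\<lambda>i j. \<Sum>p<l. \<Sum>q<l. X i p * herm G (u p) (u q) * cnj (X j q))"
    by (rule detn_cong, rule gram_change) (use assms in auto)
  also have "\<dots> = (detn l X * cnj (detn l X)) * detn l (\<lambda>i j. herm G (u i) (u j))"
    unfolding detn_congruence by (simp add: mult_ac)
  finally show ?thesis by (simp only: complex_norm_square)
qed

lemma detn_gram_orthonormal: "orthonormal G l u \<Longrightarrow> detn l (\<lambda>i j. herm G (u i) (u j)) = 1"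
  using detn_cong[of l "\<lambda>i j. herm G (u i) (u j)" "\<lambda>i j. if i = j then 1 else 0"] detn_id
  by (simp add: orthonormal_def)

text \<open>The spectral theorem on a span, by the Rayleigh quotient: a unit vector w maximising Q
  satisfies Q(x, w) = 0 for every x orthogonal to w, and the induction continues in the orthogonal
  complement of w.\<close>

lemma orthonormal_diagonalise:
  fixes G Q :: "complex^'m::finite^'m"
  assumes G: "pos_herm G" and Q: "hermitian_mat Q" and u: "orthonormal G l u"
  shows "\<exists>E. orthonormal G l E \<and> (\<forall>i<l. E i \<in> vec.span (u ` {..<l}))
      \<and> (\<forall>i<l. \<forall>j<l. i \<noteq> j \<longrightarrow> herm Q (E i) (E j) = 0)"
  using u
proof (induction l arbitrary: u)
  case 0
  then show ?case by (simp add: orthonormal_def)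
next
  case (Suc l)
  let ?S = "vec.span (u ` {..<Suc l})"
  have sub: "vec.subspace ?S" by (rule vec.subspace_span)
  have dimS: "vec.dim ?S = Suc l" by (rule orthonormal_dim[OF Suc.prems])
  define K where "K = {v \<in> ?S. herm G v v = 1}"
  obtain \<mu> where \<mu>: "\<mu> > 0" "\<And>v. \<mu> * (norm v)\<^sup>2 \<le> Re (herm G v v)"
    using herm_coercive[of "{0::real}" "\<lambda>_. G"] G by auto
  have "compact K"
  proof -
    have "subspace ?S" unfolding subspace_def
      using vec.span_zero vec.span_add vec.span_scale[of _ "u ` {..<Suc l}" "of_real _"]
      by (auto simp: scaleR_vec_def vector_scalar_mult_def scaleR_conv_of_real)
    then have "closed ?S" by (rule closed_subspace)
    moreover have "closed {v. herm G v v = 1}" unfolding herm_def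
      by (intro closed_Collect_eq continuous_intros)
    ultimately have "closed K" unfolding K_def by (simp add: closed_Int Collect_conj_eq)
    moreover have "bounded K"
    proof (rule boundedI)
      fix v assume "v \<in> K"
      then have "(norm v)\<^sup>2 \<le> 1 / \<mu>" using \<mu>(2)[of v] \<mu>(1) by (simp add: K_def field_simps)
      then show "norm v \<le> sqrt (1 / \<mu>)" by (rule real_le_rsqrt)
    qed
    ultimately show ?thesis by (simp add: compact_eq_bounded_closed)
  qed
  moreover have "u 0 \<in> K" using Suc.prems by (auto simp: K_def orthonormal_def intro: vec.span_base)
  moreover have "continuous_on K (\<lambda>v. Re (herm Q v v))" unfolding herm_def by (intro continuous_intros)
  ultimately obtain w where w: "w \<in> K" and max: "\<And>v. v \<in> K \<Longrightarrow> Re (herm Q v v) \<le> Re (herm Q w w)"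
    using continuous_attains_sup[of K] by blast
  have wS: "w \<in> ?S" "herm G w w = 1" using w by (auto simp: K_def)
  define M where "M = Re (herm Q w w)"
  have bound: "Re (herm Q v v) \<le> M * Re (herm G v v)" if v: "v \<in> ?S" for v
  proof (cases "v = 0")
    case False
    define c where "c = sqrt (Re (herm G v v))"
    have c: "c > 0" "c\<^sup>2 = Re (herm G v v)" using pos_hermD(2)[OF G False] by (auto simp: c_def)
    have vv: "herm G v v = of_real (c\<^sup>2)" using herm_real[OF pos_hermD(1)[OF G], of v] by (simp only: c(2))
    define x where "x = of_real (1 / c) *s v"
    have vx: "v = of_real c *s x" using c by (simp add: x_def vector_smult_assoc)
    have "herm G x x = 1" using c by (simp add: x_def herm_scale_left herm_scale_right vv power2_eq_square)
    then have "x \<in> K" using v by (simp add: K_def x_def vec.span_scale)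
    then have "Re (herm Q x x) \<le> M" using max by (simp add: M_def)
    moreover have "Re (herm Q v v) = c\<^sup>2 * Re (herm Q x x)"
    proof -
      have "herm Q v v = of_real (c\<^sup>2) * herm Q x x"
        by (subst (1 2) vx) (simp add: herm_scale_left herm_scale_right power2_eq_square)
      then show ?thesis by simp
    qed
    ultimately show ?thesis unfolding c(2)[symmetric] by (simp add: mult.commute[of M] mult_left_mono)
  qed (simp add: herm_zero)
  have orth: "herm Q x w = 0" if x: "x \<in> ?S" "herm G x w = 0" for x
  proof (rule ccontr)
    assume nz: "herm Q x w \<noteq> 0"
    define q where "q = herm Q x w"
    \<comment> \<open>Moving from w to w + \<tau> x with \<tau> = \<epsilon> cnj q gains 2
      \<epsilon> |q|^2 to first order against a loss of C \<epsilon>^2 |q|^2; \<epsilon> C < 2 lets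
      the gain win.\<close>
    define C where "C = M * Re (herm G x x) - Re (herm Q x x)"
    define \<epsilon> where "\<epsilon> = 1 / (\<bar>C\<bar> + 1)"
    have eps: "\<epsilon> > 0" "\<epsilon> * C < 2"
    proof -
      show "\<epsilon> > 0" by (simp add: \<epsilon>_def)
      have "\<epsilon> * C \<le> 1" using abs_ge_self[of C] by (simp add: \<epsilon>_def divide_simps)
      then show "\<epsilon> * C < 2" by simp
    qed
    define \<tau> where "\<tau> = of_real \<epsilon> * cnj q"
    let ?y = "w + \<tau> *s x"
    have xw: "herm G w x = 0" "herm Q w x = cnj q"
      using herm_cnj[OF pos_hermD(1)[OF G], of x w] herm_cnj[OF Q, of x w] x by (simp_all add: q_def)
    have tt: "\<tau> * cnj \<tau> = of_real (\<epsilon>\<^sup>2 * (norm q)\<^sup>2)" "\<tau> * q = of_real (\<epsilon> * (norm q)\<^sup>2)" "cnj \<tau> * cnj q = of_real (\<epsilon> * (norm q)\<^sup>2)"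
      using complex_norm_square[of q] by (simp_all add: \<tau>_def power2_eq_square mult_ac)
    have "?y \<in> ?S" using x wS by (intro vec.span_add vec.span_scale)
    from bound[OF this] have "Re (herm Q ?y ?y) \<le> M * Re (herm G ?y ?y)" .
    moreover have "herm Q ?y ?y = herm Q w w + \<tau> * q + cnj \<tau> * cnj q + \<tau> * cnj \<tau> * herm Q x x"
      by (simp add: herm_linear xw q_def algebra_simps)
    moreover have "herm G ?y ?y = 1 + \<tau> * cnj \<tau> * herm G x x"
      by (simp add: herm_linear xw x wS algebra_simps)
    ultimately have "M + 2 * (\<epsilon> * (norm q)\<^sup>2) + \<epsilon>\<^sup>2 * (norm q)\<^sup>2 * Re (herm Q x x) \<le> M * (1 + \<epsilon>\<^sup>2 * (norm q)\<^sup>2 * Re (herm G x x))"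
      unfolding tt by (simp add: M_def)
    then have "(\<epsilon> * (norm q)\<^sup>2) * 2 \<le> (\<epsilon> * (norm q)\<^sup>2) * (\<epsilon> * C)"
      by (simp add: C_def algebra_simps power2_eq_square)
    moreover have "\<epsilon> * (norm q)\<^sup>2 > 0" using eps nz by (simp add: q_def)
    ultimately have "2 \<le> \<epsilon> * C" by (simp only: mult_le_cancel_left_pos)
    then show False using eps by simp
  qed
  \<comment> \<open>A basis of the span starting with w leaves \<open>l\<close> further vectors
    orthogonal to w; shifted by one index, they feed the induction hypothesis. In the resulting
    frame w comes last.\<close>
  have "orthonormal G 1 (\<lambda>_. w)" using wS by (simp add: orthonormal_def)
  from orthonormal_extend[OF G this sub, of "Suc l"] wS dimS obtain v where
    v: "orthonormal G (Suc l) v" "\<forall>i<Suc l. v i \<in> ?S" "v 0 = w" by auto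
  have "orthonormal G l (\<lambda>i. v (Suc i))" using v(1) by (auto simp: orthonormal_def)
  from Suc.IH[OF this] obtain E where E: "orthonormal G l E" "\<And>i. i < l \<Longrightarrow> E i \<in> vec.span ((\<lambda>i. v (Suc i)) ` {..<l})"
    "\<And>i j. i < l \<Longrightarrow> j < l \<Longrightarrow> i \<noteq> j \<Longrightarrow> herm Q (E i) (E j) = 0" by blast
  have "vec.span ((\<lambda>i. v (Suc i)) ` {..<l}) \<subseteq> ?S \<inter> {x. herm G x w = 0}"
  proof (rule vec.span_minimal)
    show "(\<lambda>i. v (Suc i)) ` {..<l} \<subseteq> ?S \<inter> {x. herm G x w = 0}"
      using v unfolding v(3)[symmetric] by (auto simp: orthonormal_def)
    show "vec.subspace (?S \<inter> {x. herm G x w = 0})"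
      by (intro vec.subspace_inter sub vec.subspaceI) (auto simp: herm_linear herm_zero)
  qed
  then have ES: "E i \<in> ?S" "herm G (E i) w = 0" if "i < l" for i using E(2)[OF that] by auto
  have ES': "herm G w (E i) = 0" if "i < l" for i
    using herm_cnj[OF pos_hermD(1)[OF G], of "E i" w] ES that by simp
  have EQ: "herm Q (E i) w = 0" "herm Q w (E i) = 0" if "i < l" for i
    using orth[OF ES[OF that]] herm_cnj[OF Q, of "E i" w] by simp_all
  let ?E = "E(l := w)"
  have "orthonormal G (Suc l) ?E" using E(1) ES ES' wS by (auto simp: orthonormal_def less_Suc_eq)
  moreover have "\<forall>i<Suc l. ?E i \<in> ?S" using ES wS by (auto simp: less_Suc_eq)
  moreover have "\<forall>i<Suc l. \<forall>j<Suc l. i \<noteq> j \<longrightarrow> herm Q (?E i) (?E j) = 0"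
    using E(3) EQ by (auto simp: less_Suc_eq)
  ultimately show ?case by blast
qed

section \<open>Hermitian metrics along holomorphic discs\<close>

definition metric_on :: "(complex^'m \<Rightarrow> complex^'m^'m) \<Rightarrow> (complex^'m::finite) set \<Rightarrow> bool" where
  "metric_on G U \<longleftrightarrow> open U \<and> (\<forall>k l. smooth_on (\<lambda>z. G z $ k $ l) U) \<and> (\<forall>z\<in>U. pos_herm (G z))"

lemma metric_onD:
  assumes "metric_on G U"
  shows "open U" "Ck_on (Suc (Suc 0)) (\<lambda>z. G z $ k $ l) U" "z \<in> U \<Longrightarrow> pos_herm (G z)"
    "z \<in> U \<Longrightarrow> hermitian_mat (G z)"
  using assms by (auto simp: metric_on_def smooth_on_def pos_herm_def simp del: Ck_on.simps)

lemma ginv_inverse: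
  assumes "pos_herm (G :: complex^'m::finite^'m)"
  shows "(\<Sum>p\<in>UNIV. ginv G p q * G $ p $ l) = (if q = l then 1 else 0)"
proof -
  have "x = 0" if x: "G *v x = 0" for x
  proof (rule ccontr)
    assume "x \<noteq> 0"
    \<comment> \<open>\<open>herm\<close> conjugates its second argument, so conjugating the kernel
      vector makes G *v x appear in the expansion of herm G w w.\<close>
    define w where "w = (\<chi> i. cnj (x $ i))"
    have "w \<noteq> 0" using \<open>x \<noteq> 0\<close> by (auto simp: w_def vec_eq_iff)
    have "herm G w w = (\<Sum>k\<in>UNIV. w $ k * (G *v x) $ k)"
      by (simp add: herm_def w_def matrix_vector_mult_def sum_distrib_left mult_ac)
    then have "herm G w w = 0" using x by simp
    then show False using pos_hermD(2)[OF assms \<open>w \<noteq> 0\<close>] by simp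
  qed
  then obtain B where "B ** G = Finite_Cartesian_Product.mat 1" using matrix_left_invertible_ker[of G] by blast
  then have "invertible G" using matrix_left_right_inverse unfolding invertible_def by blast
  then have inv: "matrix_inv G ** G = Finite_Cartesian_Product.mat 1"
    unfolding invertible_def matrix_inv_def by (metis (mono_tags, lifting) someI_ex)
  have "(\<Sum>p\<in>UNIV. ginv G p q * G $ p $ l) = (matrix_inv G ** G) $ q $ l"
    by (simp add: ginv_def matrix_matrix_mult_def)
  then show "(\<Sum>p\<in>UNIV. ginv G p q * G $ p $ l) = (if q = l then 1 else 0)"
    by (simp add: inv Finite_Cartesian_Product.mat_def)
qed

section \<open>The Chern connection and the second-order jet of a metric\<close>

lemma dz_cnj:
  assumes "open U" "z \<in> U" "\<And>y. y \<in> U \<Longrightarrow> \<phi> y = cnj (\<psi> y)" "\<psi> differentiable at z"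
  shows "dz j \<phi> z = cnj (dzbar j \<psi> z)" "dzbar j \<phi> z = cnj (dz j \<psi> z)"
proof -
  have "(\<psi> has_derivative frechet_derivative \<psi> (at z)) (at z)"
    using assms(4) frechet_derivative_works by blast
  then have "((\<lambda>y. cnj (\<psi> y)) has_derivative (\<lambda>v. cnj (frechet_derivative \<psi> (at z) v))) (at z)"
    by (rule bounded_linear.has_derivative[OF bounded_linear_cnj])
  then have "(\<phi> has_derivative (\<lambda>v. cnj (frechet_derivative \<psi> (at z) v))) (at z)"
    by (rule has_derivative_transform_within_open[OF _ assms(1,2)]) (simp add: assms(3))
  then have "frechet_derivative \<phi> (at z) = (\<lambda>v. cnj (frechet_derivative \<psi> (at z) v))"
    using frechet_derivative_at by fastforce
  then show "dz j \<phi> z = cnj (dzbar j \<psi> z)" "dzbar j \<phi> z = cnj (dz j \<psi> z)"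
    by (simp_all add: dz_def dzbar_def)
qed

lemma metric_on_dz_cnj:
  assumes G: "metric_on G U" and z: "z \<in> U"
  shows "cnj (dz i (\<lambda>y. G y $ k $ l) z) = dzbar i (\<lambda>y. G y $ l $ k) z"
    and "cnj (dz i (dzbar j (\<lambda>y. G y $ k $ l)) z) = dzbar i (dz j (\<lambda>y. G y $ l $ k)) z"
proof -
  have sym: "G y $ l $ k = cnj (G y $ k $ l)" if "y \<in> U" for y
    using metric_onD(4)[OF G that] unfolding hermitian_mat_def by blast
  have d: "(\<lambda>y. G y $ k $ l) differentiable at y" if "y \<in> U" for y
    by (rule Ck_differentiable[OF metric_onD(2)[OF G] that])
  show "cnj (dz i (\<lambda>y. G y $ k $ l) z) = dzbar i (\<lambda>y. G y $ l $ k) z"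
    by (rule dz_cnj(2)[OF metric_onD(1)[OF G] z sym d[OF z], symmetric])
  have "dz j (\<lambda>y. G y $ l $ k) y = cnj (dzbar j (\<lambda>y. G y $ k $ l) y)" if "y \<in> U" for y
    by (rule dz_cnj(1)[OF metric_onD(1)[OF G] that sym d[OF that]])
  from dz_cnj(2)[OF metric_onD(1)[OF G] z this Ck_differentiable_dz(2)[OF metric_onD(2)[OF G] z], of i]
  show "cnj (dz i (dzbar j (\<lambda>y. G y $ k $ l)) z) = dzbar i (dz j (\<lambda>y. G y $ l $ k)) z" by simp
qed

text \<open>\<open>christoffel G z u a\<close> is the zero-order part of the Chern connection: along a holomorphic disc
  with velocity \<open>u\<close> a holomorphic section with value \<open>a\<close> and derivative \<open>b\<close> has covariant
  derivative \<open>b + christoffel G z u a\<close>.\<close>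

definition christoffel :: "(complex^'m \<Rightarrow> complex^'m^'m) \<Rightarrow> complex^'m::finite \<Rightarrow> complex^'m \<Rightarrow> complex^'m \<Rightarrow> complex^'m" where
  "christoffel G z u a = (\<chi> p. \<Sum>q\<in>UNIV. ginv (G z) p q * (\<Sum>k\<in>UNIV. (\<Sum>i\<in>UNIV. dz i (\<lambda>y. G y $ k $ q) z * u $ i) * a $ k))"

text \<open>Lowering the index with G cancels the inverse matrix, and only the derivative of the
  metric components along \<open>u\<close> is left. This is the compatibility of the Chern
  connection with the metric.\<close>

lemma herm_christoffel_left:
  assumes "pos_herm (G z)"
  shows "herm (G z) (christoffel G z u a) w = (\<Sum>k\<in>UNIV. \<Sum>l\<in>UNIV. (\<Sum>i\<in>UNIV. dz i (\<lambda>y. G y $ k $ l) z * u $ i) * a $ k * cnj (w $ l))"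
proof -
  define x where "x q = (\<Sum>k\<in>UNIV. (\<Sum>i\<in>UNIV. dz i (\<lambda>y. G y $ k $ q) z * u $ i) * a $ k)" for q
  have "herm (G z) (christoffel G z u a) w = (\<Sum>p\<in>UNIV. \<Sum>l\<in>UNIV. \<Sum>q\<in>UNIV. ginv (G z) p q * G z $ p $ l * (x q * cnj (w $ l)))"
  proof -
    have "christoffel G z u a $ p = (\<Sum>q\<in>UNIV. ginv (G z) p q * x q)" for p
      by (simp add: christoffel_def x_def)
    then show ?thesis by (simp add: herm_def sum_distrib_left sum_distrib_right mult_ac)
  qed
  also have "\<dots> = (\<Sum>l\<in>UNIV. \<Sum>p\<in>UNIV. \<Sum>q\<in>UNIV. ginv (G z) p q * G z $ p $ l * (x q * cnj (w $ l)))"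
    by (rule sum.swap)
  also have "\<dots> = (\<Sum>l\<in>UNIV. \<Sum>q\<in>UNIV. (\<Sum>p\<in>UNIV. ginv (G z) p q * G z $ p $ l) * (x q * cnj (w $ l)))"
    unfolding sum_distrib_right by (rule sum.cong[OF refl], rule sum.swap)
  also have "\<dots> = (\<Sum>l\<in>UNIV. \<Sum>q\<in>UNIV. if q = l then x q * cnj (w $ l) else 0)"
    unfolding ginv_inverse[OF assms] by (intro sum.cong) auto
  also have "\<dots> = (\<Sum>l\<in>UNIV. x l * cnj (w $ l))" by simp
  also have "\<dots> = (\<Sum>l\<in>UNIV. \<Sum>k\<in>UNIV. (\<Sum>i\<in>UNIV. dz i (\<lambda>y. G y $ k $ l) z * u $ i) * a $ k * cnj (w $ l))"
    unfolding x_def sum_distrib_right ..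
  also have "\<dots> = (\<Sum>k\<in>UNIV. \<Sum>l\<in>UNIV. (\<Sum>i\<in>UNIV. dz i (\<lambda>y. G y $ k $ l) z * u $ i) * a $ k * cnj (w $ l))"
    by (rule sum.swap)
  finally show ?thesis .
qed

lemma herm_christoffel_right:
  assumes G: "metric_on G U" and z: "z \<in> U"
  shows "herm (G z) w (christoffel G z u a) = (\<Sum>k\<in>UNIV. \<Sum>l\<in>UNIV. (\<Sum>i\<in>UNIV. dzbar i (\<lambda>y. G y $ k $ l) z * cnj (u $ i)) * w $ k * cnj (a $ l))"
proof -
  have "herm (G z) w (christoffel G z u a) = cnj (herm (G z) (christoffel G z u a) w)"
    by (rule herm_cnj[OF metric_onD(4)[OF G z], symmetric])
  also have "\<dots> = (\<Sum>k\<in>UNIV. \<Sum>l\<in>UNIV. (\<Sum>i\<in>UNIV. dzbar i (\<lambda>y. G y $ l $ k) z * cnj (u $ i)) * cnj (a $ k) * w $ l)"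
    unfolding herm_christoffel_left[where G = G and z = z, OF metric_onD(3)[OF G z]] by (simp add: metric_on_dz_cnj(1)[OF G z])
  also have "\<dots> = (\<Sum>l\<in>UNIV. \<Sum>k\<in>UNIV. (\<Sum>i\<in>UNIV. dzbar i (\<lambda>y. G y $ l $ k) z * cnj (u $ i)) * cnj (a $ k) * w $ l)"
    by (rule sum.swap)
  finally show ?thesis by (simp add: mult_ac)
qed

lemma sum_swap4:
  "(\<Sum>k\<in>K. \<Sum>l\<in>L. \<Sum>j\<in>J. \<Sum>i\<in>I. f i j k l) = (\<Sum>i\<in>I. \<Sum>j\<in>J. \<Sum>k\<in>K. \<Sum>l\<in>L. f i j k l)"
proof -
  have "(\<Sum>k\<in>K. \<Sum>l\<in>L. \<Sum>j\<in>J. \<Sum>i\<in>I. f i j k l) = (\<Sum>k\<in>K. \<Sum>l\<in>L. \<Sum>i\<in>I. \<Sum>j\<in>J. f i j k l)"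
    by (intro sum.cong refl sum.swap)
  also have "\<dots> = (\<Sum>k\<in>K. \<Sum>i\<in>I. \<Sum>l\<in>L. \<Sum>j\<in>J. f i j k l)" by (intro sum.cong refl sum.swap)
  also have "\<dots> = (\<Sum>i\<in>I. \<Sum>k\<in>K. \<Sum>l\<in>L. \<Sum>j\<in>J. f i j k l)" by (rule sum.swap)
  also have "\<dots> = (\<Sum>i\<in>I. \<Sum>k\<in>K. \<Sum>j\<in>J. \<Sum>l\<in>L. f i j k l)" by (intro sum.cong refl sum.swap)
  also have "\<dots> = (\<Sum>i\<in>I. \<Sum>j\<in>J. \<Sum>k\<in>K. \<Sum>l\<in>L. f i j k l)" by (intro sum.cong refl sum.swap)
  finally show ?thesis .
qed

lemma sum_rotate: "(\<Sum>i\<in>I. \<Sum>p\<in>P. \<Sum>q\<in>Q. f i p q) = (\<Sum>p\<in>P. \<Sum>q\<in>Q. \<Sum>i\<in>I. f i p q)"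
proof -
  have "(\<Sum>i\<in>I. \<Sum>p\<in>P. \<Sum>q\<in>Q. f i p q) = (\<Sum>p\<in>P. \<Sum>i\<in>I. \<Sum>q\<in>Q. f i p q)" by (rule sum.swap)
  also have "\<dots> = (\<Sum>p\<in>P. \<Sum>q\<in>Q. \<Sum>i\<in>I. f i p q)" by (intro sum.cong refl sum.swap)
  finally show ?thesis .
qed

lemma sum_product4:
  fixes x y :: "'a \<Rightarrow> 'b \<Rightarrow> complex"
  shows "(\<Sum>i\<in>I. \<Sum>j\<in>J. \<Sum>k\<in>K. \<Sum>l\<in>L. x i k * y j l) = (\<Sum>i\<in>I. \<Sum>k\<in>K. x i k) * (\<Sum>j\<in>J. \<Sum>l\<in>L. y j l)"
proof -
  have "(\<Sum>i\<in>I. \<Sum>j\<in>J. \<Sum>k\<in>K. \<Sum>l\<in>L. x i k * y j l) = (\<Sum>i\<in>I. \<Sum>k\<in>K. \<Sum>j\<in>J. \<Sum>l\<in>L. x i k * y j l)"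
    by (intro sum.cong refl sum.swap)
  also have "\<dots> = (\<Sum>i\<in>I. \<Sum>k\<in>K. x i k) * (\<Sum>j\<in>J. \<Sum>l\<in>L. y j l)"
    by (simp only: sum_distrib_left[symmetric] sum_distrib_right[symmetric])
  finally show ?thesis .
qed

text \<open>The part of the Chern curvature that is quadratic in first derivatives is the squared
  norm of the connection term; the rest is minus the mixed second derivative of the metric.\<close>

lemma curv_tensor_diagonal:
  assumes G: "metric_on G U" and z: "z \<in> U"
  shows "curv_tensor G z u u a a = herm (G z) (christoffel G z u a) (christoffel G z u a)
    - (\<Sum>i\<in>UNIV. \<Sum>j\<in>UNIV. \<Sum>k\<in>UNIV. \<Sum>l\<in>UNIV. dz i (dzbar j (\<lambda>y. G y $ k $ l)) z * u $ i * cnj (u $ j) * a $ k * cnj (a $ l))"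
proof -
  let ?B = "\<lambda>q i k. dz i (\<lambda>y. G y $ k $ q) z * u $ i * a $ k"
  let ?C = "\<lambda>p j l. dzbar j (\<lambda>y. G y $ p $ l) z * cnj (u $ j) * cnj (a $ l)"
  let ?g = "ginv (G z)"
  have chr: "christoffel G z u a $ p = (\<Sum>q\<in>UNIV. ?g p q * (\<Sum>i\<in>UNIV. \<Sum>k\<in>UNIV. ?B q i k))" for p
    unfolding christoffel_def sum_distrib_right
    by (simp, intro sum.cong refl arg_cong2[where f = "(*)"] sum.swap)
  have "herm (G z) (christoffel G z u a) (christoffel G z u a)
     = (\<Sum>p\<in>UNIV. \<Sum>l\<in>UNIV. \<Sum>j\<in>UNIV. christoffel G z u a $ p * ?C p j l)"
    unfolding herm_christoffel_right[OF G z] by (simp add: sum_distrib_left sum_distrib_right mult_ac)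
  also have "\<dots> = (\<Sum>p\<in>UNIV. christoffel G z u a $ p * (\<Sum>j\<in>UNIV. \<Sum>l\<in>UNIV. ?C p j l))"
    unfolding sum_distrib_left by (intro sum.cong refl sum.swap)
  also have "\<dots> = (\<Sum>p\<in>UNIV. \<Sum>q\<in>UNIV. ?g p q * ((\<Sum>i\<in>UNIV. \<Sum>k\<in>UNIV. ?B q i k) * (\<Sum>j\<in>UNIV. \<Sum>l\<in>UNIV. ?C p j l)))"
  proof -
    have "(\<Sum>q\<in>UNIV. r q * b q) * c = (\<Sum>q\<in>UNIV. r q * (b q * c))" for r b :: "'a \<Rightarrow> complex" and c
      by (simp add: sum_distrib_right mult.assoc)
    then show ?thesis unfolding chr by simp
  qed
  also have "\<dots> = (\<Sum>p\<in>UNIV. \<Sum>q\<in>UNIV. \<Sum>i\<in>UNIV. \<Sum>j\<in>UNIV. \<Sum>k\<in>UNIV. \<Sum>l\<in>UNIV. ?g p q * (?B q i k * ?C p j l))"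
    unfolding sum_product4[symmetric] by (simp only: sum_distrib_left)
  also have "\<dots> = (\<Sum>i\<in>UNIV. \<Sum>p\<in>UNIV. \<Sum>q\<in>UNIV. \<Sum>j\<in>UNIV. \<Sum>k\<in>UNIV. \<Sum>l\<in>UNIV. ?g p q * (?B q i k * ?C p j l))"
    by (rule sum_rotate[symmetric])
  also have "\<dots> = (\<Sum>i\<in>UNIV. \<Sum>j\<in>UNIV. \<Sum>p\<in>UNIV. \<Sum>q\<in>UNIV. \<Sum>k\<in>UNIV. \<Sum>l\<in>UNIV. ?g p q * (?B q i k * ?C p j l))"
    by (rule sum.cong[OF refl], rule sum_rotate[symmetric])
  also have "\<dots> = (\<Sum>i\<in>UNIV. \<Sum>j\<in>UNIV. \<Sum>k\<in>UNIV. \<Sum>p\<in>UNIV. \<Sum>q\<in>UNIV. \<Sum>l\<in>UNIV. ?g p q * (?B q i k * ?C p j l))"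
    by (rule sum.cong[OF refl], rule sum.cong[OF refl], rule sum_rotate[symmetric])
  also have "\<dots> = (\<Sum>i\<in>UNIV. \<Sum>j\<in>UNIV. \<Sum>k\<in>UNIV. \<Sum>l\<in>UNIV. \<Sum>p\<in>UNIV. \<Sum>q\<in>UNIV. ?g p q * (?B q i k * ?C p j l))"
    by (rule sum.cong[OF refl], rule sum.cong[OF refl], rule sum.cong[OF refl], rule sum_rotate[symmetric])
  finally have *: "herm (G z) (christoffel G z u a) (christoffel G z u a) = \<dots>" .
  show ?thesis unfolding * curv_tensor_def chern_curv_def sum_subtractf[symmetric]
    by (intro sum.cong refl) (simp add: sum_distrib_left sum_distrib_right algebra_simps)
qed

text \<open>For a holomorphic section s with covariant derivative \<nabla>s, the mixed second
  derivative of |s|^2 is |\<nabla>s|^2 - R(u, u, s, s), while the linear coefficients are the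
  pairings with \<nabla>s. Every curvature term in the argument originates here.\<close>

lemma herm_jet:
  fixes y :: "complex \<Rightarrow> complex^'m::finite"
  assumes G: "metric_on G V" and z: "z \<in> V"
    and y: "\<And>k. jet (\<lambda>t. y t $ k) (z $ k) (u $ k) 0 0"
    and s: "\<And>k. jet (\<lambda>t. s t $ k) (a $ k) (b $ k) 0 0"
    and s': "\<And>k. jet (\<lambda>t. s' t $ k) (a' $ k) (b' $ k) 0 0"
  shows "\<exists>e. jet (\<lambda>t. herm (G (y t)) (s t) (s' t)) (herm (G z) a a')
      (herm (G z) (b + christoffel G z u a) a') (herm (G z) a (b' + christoffel G z u a')) e
    \<and> (a = a' \<and> b = b' \<longrightarrow> Re e = Re (herm (G z) (b + christoffel G z u a) (b + christoffel G z u a)) - Re (curv_tensor G z u u a a))"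
proof -
  let ?B = "\<lambda>k l. \<Sum>j\<in>UNIV. dz j (\<lambda>y. G y $ k $ l) z * u $ j"
  let ?C = "\<lambda>k l. \<Sum>j\<in>UNIV. dzbar j (\<lambda>y. G y $ k $ l) z * cnj (u $ j)"
  let ?E = "\<lambda>k l. (\<Sum>j\<in>UNIV. \<Sum>i\<in>UNIV. dzbar i (dz j (\<lambda>y. G y $ k $ l)) z * cnj (u $ i) * u $ j
       + dz i (dzbar j (\<lambda>y. G y $ k $ l)) z * u $ i * cnj (u $ j)) / 2"
  define e where "e = (\<Sum>k\<in>UNIV. \<Sum>l\<in>UNIV. ?E k l * a $ k * cnj (a' $ l) + ?B k l * a $ k * cnj (b' $ l)
      + ?C k l * b $ k * cnj (a' $ l) + G z $ k $ l * b $ k * cnj (b' $ l))"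
  have g: "jet (\<lambda>t. G (y t) $ k $ l) (G z $ k $ l) (?B k l) (?C k l) (?E k l)" for k l
    by (rule jet_compose[OF metric_onD(1)[OF G] z metric_onD(2)[OF G] y])
  have J: "jet (\<lambda>t. herm (G (y t)) (s t) (s' t)) (herm (G z) a a')
      (\<Sum>k\<in>UNIV. \<Sum>l\<in>UNIV. G z $ k $ l * b $ k * cnj (a' $ l) + ?B k l * a $ k * cnj (a' $ l))
      (\<Sum>k\<in>UNIV. \<Sum>l\<in>UNIV. G z $ k $ l * a $ k * cnj (b' $ l) + ?C k l * a $ k * cnj (a' $ l)) e"
    unfolding herm_def e_def
    by (rule jet_cong[OF jet_sum[OF jet_sum[OF jet_mult[OF jet_mult[OF g s] jet_cnj[OF s']]]]])
       (simp_all add: algebra_simps)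
  have Bb: "herm (G z) (christoffel G z u a) w = (\<Sum>k\<in>UNIV. \<Sum>l\<in>UNIV. ?B k l * a $ k * cnj (w $ l))" for w
    by (rule herm_christoffel_left[where G = G and z = z, OF metric_onD(3)[OF G z]])
  have Cc: "herm (G z) w (christoffel G z u a') = (\<Sum>k\<in>UNIV. \<Sum>l\<in>UNIV. ?C k l * w $ k * cnj (a' $ l))" for w
    by (rule herm_christoffel_right[OF G z])
  have 1: "(\<Sum>k\<in>UNIV. \<Sum>l\<in>UNIV. G z $ k $ l * b $ k * cnj (a' $ l) + ?B k l * a $ k * cnj (a' $ l)) = herm (G z) (b + christoffel G z u a) a'"
    unfolding herm_add_left Bb by (simp only: herm_def[of _ b] sum.distrib)
  have 2: "(\<Sum>k\<in>UNIV. \<Sum>l\<in>UNIV. G z $ k $ l * a $ k * cnj (b' $ l) + ?C k l * a $ k * cnj (a' $ l)) = herm (G z) a (b' + christoffel G z u a')"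
    unfolding herm_add_right Cc by (simp only: herm_def[of _ a] sum.distrib)
  have 3: "Re e = Re (herm (G z) (b + christoffel G z u a) (b + christoffel G z u a)) - Re (curv_tensor G z u u a a)"
    if eq: "a = a'" "b = b'"
  proof -
    define T where "T = (\<Sum>i\<in>UNIV. \<Sum>j\<in>UNIV. \<Sum>k\<in>UNIV. \<Sum>l\<in>UNIV. dz i (dzbar j (\<lambda>y. G y $ k $ l)) z * u $ i * cnj (u $ j) * a $ k * cnj (a $ l))"
    have T: "(\<Sum>k\<in>UNIV. \<Sum>l\<in>UNIV. \<Sum>j\<in>UNIV. \<Sum>i\<in>UNIV. dz i (dzbar j (\<lambda>y. G y $ k $ l)) z * u $ i * cnj (u $ j) * a $ k * cnj (a $ l)) = T"
      unfolding T_def by (rule sum_swap4)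
    \<comment> \<open>Hermitian symmetry turns the conjugate of T into the sum with the two
      derivatives taken in the other order. The half-sum from the Taylor expansion is therefore Re
      T.\<close>
    have "cnj T = (\<Sum>k\<in>UNIV. \<Sum>l\<in>UNIV. \<Sum>j\<in>UNIV. \<Sum>i\<in>UNIV. dzbar i (dz j (\<lambda>y. G y $ l $ k)) z * cnj (u $ i) * u $ j * cnj (a $ k) * a $ l)"
      unfolding T[symmetric] by (simp add: metric_on_dz_cnj(2)[OF G z])
    also have "\<dots> = (\<Sum>l\<in>UNIV. \<Sum>k\<in>UNIV. \<Sum>j\<in>UNIV. \<Sum>i\<in>UNIV. dzbar i (dz j (\<lambda>y. G y $ l $ k)) z * cnj (u $ i) * u $ j * cnj (a $ k) * a $ l)"
      by (rule sum.swap)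
    finally have T': "(\<Sum>k\<in>UNIV. \<Sum>l\<in>UNIV. \<Sum>j\<in>UNIV. \<Sum>i\<in>UNIV. dzbar i (dz j (\<lambda>y. G y $ k $ l)) z * cnj (u $ i) * u $ j * a $ k * cnj (a $ l)) = cnj T"
      by (simp add: mult_ac)
    have "(\<Sum>k\<in>UNIV. \<Sum>l\<in>UNIV. ?E k l * a $ k * cnj (a $ l)) = (cnj T + T) / 2"
      unfolding T'[symmetric] unfolding T[symmetric]
      by (simp add: sum_distrib_left sum_distrib_right sum.distrib sum_divide_distrib add_divide_distrib algebra_simps)
    then have "e = (cnj T + T) / 2 + herm (G z) (christoffel G z u a) b + herm (G z) b (christoffel G z u a) + herm (G z) b b"
      unfolding Bb Cc[folded eq(1)] herm_def[of _ b b] unfolding e_def eq[symmetric] sum.distrib by simp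
    moreover have "curv_tensor G z u u a a = herm (G z) (christoffel G z u a) (christoffel G z u a) - T"
      unfolding T_def by (rule curv_tensor_diagonal[OF G z])
    ultimately show ?thesis by (simp add: herm_add_left herm_add_right)
  qed
  show ?thesis
    using J[unfolded 1 2] 3 by blast
qed

section \<open>Second-order conditions at a maximum\<close>

locale local_map =
  fixes G :: "complex^'m::finite \<Rightarrow> complex^'m^'m" and U
    and H :: "complex^'n::finite \<Rightarrow> complex^'n^'n" and V
    and F :: "complex^'m \<Rightarrow> complex^'n"
  assumes G: "metric_on G U" and H: "metric_on H V" and F: "holo_on F U" and FV: "F ` U \<subseteq> V"
begin

abbreviation DF :: "complex^'m \<Rightarrow> complex^'m \<Rightarrow> complex^'n" where
  "DF z \<equiv> frechet_derivative F (at z)"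

definition pb :: "complex^'m \<Rightarrow> complex^'m^'m" where
  "pb z = pullback (H (F z)) (DF z)"

lemma open_U: "open U" by (rule metric_onD(1)[OF G])

lemma FzV: "z \<in> U \<Longrightarrow> F z \<in> V" using FV by blast

lemma DF_linear:
  assumes "z \<in> U"
  shows "linear (DF z)" "DF z (c *s v) = c *s DF z v" "DF z (v + w) = DF z v + DF z w"
    "DF z (\<Sum>i\<in>S. f i) = (\<Sum>i\<in>S. DF z (f i))"
proof -
  show *: "linear (DF z)" using holo_on_derivative(1)[OF F assms] has_derivative_linear by blast
  show "DF z (c *s v) = c *s DF z v" by (rule holo_on_derivative(2)[OF F assms])
  show "DF z (v + w) = DF z v + DF z w" "DF z (\<Sum>i\<in>S. f i) = (\<Sum>i\<in>S. DF z (f i))"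
    using linear_add[OF *] linear_sum[OF *] by simp_all
qed

lemma herm_pb: "z \<in> U \<Longrightarrow> herm (pb z) v w = herm (H (F z)) (DF z v) (DF z w)"
  unfolding pb_def by (rule herm_pullback) (rule DF_linear; assumption)+

lemma hermitian_pb: "z \<in> U \<Longrightarrow> hermitian_mat (pb z)"
  unfolding pb_def by (intro hermitian_pullback metric_onD(4)[OF H] FzV)

lemma pb_nonneg: "z \<in> U \<Longrightarrow> Re (herm (pb z) v v) \<ge> 0"
  unfolding herm_pb by (intro pos_hermD(3) metric_onD(3)[OF H] FzV)

lemma line_eventually:
  assumes "z \<in> U"
  shows "\<forall>\<^sub>F t in nhds 0. z + t *s u \<in> U"
proof -
  have "(\<lambda>t. z + t *s u) = (\<lambda>t. \<chi> k. z $ k + t * u $ k)"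
    by (simp add: fun_eq_iff vec_eq_iff)
  then have "continuous_on UNIV (\<lambda>t. z + t *s u)"
    by (simp only:) (intro continuous_on_vec_lambda continuous_intros)
  then have "open ((\<lambda>t. z + t *s u) -` U)" using open_U by (simp add: continuous_on_open_vimage)
  moreover have "0 \<in> (\<lambda>t. z + t *s u) -` U" using assms by simp
  ultimately show ?thesis unfolding eventually_nhds
    by (intro exI[of _ "(\<lambda>t. z + t *s u) -` U"]) simp
qed

lemma jet_line: "jet (\<lambda>t. (z + t *s u) $ k) (z $ k) (u $ k) 0 0"
  using jet_add[OF jet_const[of "z $ k"] jet_cmult[OF jet_id, of "u $ k"]] by (simp add: mult.commute)

text \<open>The entries of the differential have holomorphic jets, hence so does the image of a
  section that has one. The derivative \<open>c\<close> of the image contains second derivatives of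
  F and stays unspecified; only its existence is used.\<close>

lemma jet_push:
  assumes z: "z \<in> U" and e: "\<And>k. jet (\<lambda>t. e t $ k) (a $ k) (b $ k) 0 0"
  shows "\<exists>c. \<forall>k. jet (\<lambda>t. DF (z + t *s u) (e t) $ k) (DF z a $ k) (c $ k) 0 0"
proof -
  have expand: "DF x v $ k = (\<Sum>j\<in>UNIV. v $ j * DF x (axis j 1) $ k)" if "x \<in> U" for x v k
  proof -
    have "DF x v = DF x (\<Sum>j\<in>UNIV. v $ j *s axis j 1)" by (simp only: basis_expansion)
    also have "\<dots> = (\<Sum>j\<in>UNIV. v $ j *s DF x (axis j 1))" by (simp only: DF_linear(2,4)[OF that])
    finally show ?thesis by simp
  qed
  have "\<forall>j k. \<exists>d. jet (\<lambda>t. DF (z + t *s u) (axis j 1) $ k) (DF z (axis j 1) $ k) d 0 0"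
    using holo_on_derivative_jet[OF F open_U z] by blast
  then obtain d where d: "\<And>j k. jet (\<lambda>t. DF (z + t *s u) (axis j 1) $ k) (DF z (axis j 1) $ k) (d j k) 0 0" by metis
  define c where "c = (\<chi> k. \<Sum>j\<in>UNIV. a $ j * d j k + b $ j * DF z (axis j 1) $ k)"
  have "jet (\<lambda>t. DF (z + t *s u) (e t) $ k) (DF z a $ k) (c $ k) 0 0" for k
  proof (rule jet_transform)
    show "jet (\<lambda>t. \<Sum>j\<in>UNIV. e t $ j * DF (z + t *s u) (axis j 1) $ k) (DF z a $ k) (c $ k) 0 0"
      by (rule jet_cong[OF jet_sum[OF jet_mult[OF e d]]]) (simp_all add: c_def expand[OF z, of a])
    show "\<forall>\<^sub>F t in nhds 0. (\<Sum>j\<in>UNIV. e t $ j * DF (z + t *s u) (axis j 1) $ k) = DF (z + t *s u) (e t) $ k"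
      using line_eventually[OF z, of u] by eventually_elim (rule expand[symmetric])
  qed
  then show ?thesis by blast
qed

text \<open>Writing \<open>f\<close> as a matrix times a unitary frame multiplies both sides by the
  same |det X|^2, so a bound on unitary frames extends to arbitrary \<open>l\<close>-tuples, where
  moving frames can be tested directly.\<close>

lemma detn_frame_bound:
  assumes l: "l \<le> CARD('m)" and z: "z \<in> U"
    and max: "\<And>e. orthonormal (G z) l e \<Longrightarrow> Re (detn l (\<lambda>i j. herm (pb z) (e i) (e j))) \<le> K"
  shows "Re (detn l (\<lambda>i j. herm (pb z) (f i) (f j))) \<le> K * Re (detn l (\<lambda>i j. herm (G z) (f i) (f j)))"
proof -
  obtain v where v: "orthonormal (G z) l v" "\<And>i. i < l \<Longrightarrow> f i \<in> vec.span (v ` {..<l})"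
    using orthonormal_spanning[OF metric_onD(3)[OF G z] l, of f] by blast
  define X where "X i p = herm (G z) (f i) (v p)" for i p
  have f: "f i = (\<Sum>p<l. X i p *s v p)" if "i < l" for i
    unfolding X_def by (rule orthonormal_expand[OF v(1) v(2)[OF that]])
  have "Re (detn l (\<lambda>i j. herm (pb z) (f i) (f j))) = (norm (detn l X))\<^sup>2 * Re (detn l (\<lambda>i j. herm (pb z) (v i) (v j)))"
    by (subst detn_gram_change[where X = X and u = v]) (simp_all add: f)
  also have "\<dots> \<le> (norm (detn l X))\<^sup>2 * K" by (intro mult_left_mono max v) simp
  also have "\<dots> = K * Re (detn l (\<lambda>i j. herm (G z) (f i) (f j)))"
    by (subst detn_gram_change[where X = X and u = v]) (simp_all add: f detn_gram_orthonormal[OF v(1)])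
  finally show ?thesis .
qed

text \<open>With \<open>v\<close> orthonormal and \<open>f = X v\<close>, the vectors \<open>v r - \<Sum>i. cnj (X i r) *s f i\<close> have nonnegative
  norm; summed over \<open>r\<close> this is the trace form of \<open>inverse G \<ge> 2 - G\<close> for the Gram matrix \<open>G\<close> of \<open>f\<close>.\<close>

lemma trace_frame_bound:
  assumes l: "l \<le> CARD('m)" and z: "z \<in> U"
    and max: "\<And>e. orthonormal (G z) l e \<Longrightarrow> Re (\<Sum>i<l. herm (pb z) (e i) (e i)) \<le> K"
  shows "Re (2 * (\<Sum>i<l. herm (pb z) (f i) (f i)) - (\<Sum>i<l. \<Sum>j<l. herm (G z) (f j) (f i) * herm (pb z) (f i) (f j))) \<le> K"
proof -
  obtain v where v: "orthonormal (G z) l v" "\<And>i. i < l \<Longrightarrow> f i \<in> vec.span (v ` {..<l})"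
    using orthonormal_spanning[OF metric_onD(3)[OF G z] l, of f] by blast
  define X where "X i p = herm (G z) (f i) (v p)" for i p
  have f: "f i = (\<Sum>p<l. X i p *s v p)" if "i < l" for i
    unfolding X_def by (rule orthonormal_expand[OF v(1) v(2)[OF that]])
  have gram: "herm (G z) (f j) (f i) = (\<Sum>r<l. X j r * cnj (X i r))" if "i < l" "j < l" for i j
  proof -
    have "herm (G z) (f j) (f i) = (\<Sum>p<l. \<Sum>q<l. X j p * (if p = q then 1 else 0) * cnj (X i q))"
      by (subst gram_change[where X = X and u = v, OF _ that(2,1)], erule f)
         (use v(1) in \<open>auto simp: orthonormal_def intro!: sum.cong\<close>)
    also have "\<dots> = (\<Sum>p<l. X j p * cnj (X i p))"
    proof (rule sum.cong[OF refl])
      fix p assume "p \<in> {..<l}"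
      then show "(\<Sum>q<l. X j p * (if p = q then 1 else 0) * cnj (X i q)) = X j p * cnj (X i p)"
        by (subst sum.remove[of _ p]) auto
    qed
    finally show ?thesis .
  qed
  let ?P = "herm (pb z)"
  define g where "g r = v r - (\<Sum>i<l. cnj (X i r) *s f i)" for r
  have "(\<Sum>r<l. ?P (g r) (g r)) = (\<Sum>r<l. ?P (v r) (v r)) - (\<Sum>r<l. \<Sum>i<l. X i r * ?P (v r) (f i))
      - (\<Sum>r<l. \<Sum>i<l. cnj (X i r) * ?P (f i) (v r)) + (\<Sum>r<l. \<Sum>i<l. \<Sum>j<l. cnj (X i r) * X j r * ?P (f i) (f j))"
  proof -
    have "?P (g r) (g r) = ?P (v r) (v r) - (\<Sum>i<l. X i r * ?P (v r) (f i)) - (\<Sum>i<l. cnj (X i r) * ?P (f i) (v r))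
       + (\<Sum>i<l. \<Sum>j<l. cnj (X i r) * X j r * ?P (f i) (f j))" for r
      unfolding g_def herm_diff_left herm_diff_right herm_sum_left
      by (simp add: herm_sum_right herm_scale_left herm_scale_right sum_distrib_left mult_ac)
    then show ?thesis by (simp add: sum.distrib sum_subtractf)
  qed
  moreover have "(\<Sum>r<l. \<Sum>i<l. X i r * ?P (v r) (f i)) = (\<Sum>i<l. ?P (f i) (f i))"
  proof -
    have "(\<Sum>r<l. \<Sum>i<l. X i r * ?P (v r) (f i)) = (\<Sum>i<l. ?P (\<Sum>r<l. X i r *s v r) (f i))"
      by (subst sum.swap) (simp add: herm_sum_left herm_scale_left)
    then show ?thesis using f by simp
  qed
  moreover have "(\<Sum>r<l. \<Sum>i<l. cnj (X i r) * ?P (f i) (v r)) = (\<Sum>i<l. ?P (f i) (f i))"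
  proof -
    have "(\<Sum>r<l. \<Sum>i<l. cnj (X i r) * ?P (f i) (v r)) = (\<Sum>i<l. ?P (f i) (\<Sum>r<l. X i r *s v r))"
      by (subst sum.swap) (simp add: herm_sum_right herm_scale_right)
    then show ?thesis using f by simp
  qed
  moreover have "(\<Sum>r<l. \<Sum>i<l. \<Sum>j<l. cnj (X i r) * X j r * ?P (f i) (f j)) = (\<Sum>i<l. \<Sum>j<l. herm (G z) (f j) (f i) * ?P (f i) (f j))"
    by (subst sum_rotate) (intro sum.cong refl, simp add: gram sum_distrib_left sum_distrib_right mult_ac)
  ultimately have "Re (\<Sum>r<l. ?P (v r) (v r)) - Re (2 * (\<Sum>i<l. ?P (f i) (f i)) - (\<Sum>i<l. \<Sum>j<l. herm (G z) (f j) (f i) * ?P (f i) (f j)))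
     = (\<Sum>r<l. Re (?P (g r) (g r)))"
    by (simp flip: Re_sum)
  moreover have "(\<Sum>r<l. Re (?P (g r) (g r))) \<ge> 0" by (intro sum_nonneg pb_nonneg z)
  ultimately show ?thesis using max[OF v(1)] by linarith
qed

section \<open>Frames and image sections along a complex line\<close>

lemma jet_parallel_section:
  "jet (\<lambda>t. (a - t *s b) $ k) (a $ k) ((- b) $ k) 0 0"
  using jet_diff[OF jet_const[of "a $ k"] jet_cmult[OF jet_id, of "b $ k"]] by (simp add: mult.commute)

lemma bounded_choice2:
  "(\<And>i j. i < l \<Longrightarrow> j < l \<Longrightarrow> \<exists>x. Q i j x) \<Longrightarrow> \<exists>x. \<forall>i<l. \<forall>j<(l::nat). Q i j (x i j)"
  by metis

text \<open>Each section has derivative minus its connection term, so its covariant derivative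
  vanishes at t = 0. The Gram matrix then has no linear terms, and its diagonal mixed coefficients
  consist of curvature alone.\<close>

lemma jet_parallel_frame:
  assumes z: "z \<in> U" and E: "orthonormal (G z) l E"
  shows "\<exists>\<gamma>. \<forall>i<l. \<forall>j<l. jet (\<lambda>t. herm (G (z + t *s u)) (E i - t *s christoffel G z u (E i)) (E j - t *s christoffel G z u (E j)))
      (if i = j then 1 else 0) 0 0 (\<gamma> i j) \<and> (i = j \<longrightarrow> Re (\<gamma> i j) = - Re (curv_tensor G z u u (E i) (E i)))"
proof (rule bounded_choice2)
  fix i j assume "i < l" "j < l"
  with E show "\<exists>\<gamma>. jet (\<lambda>t. herm (G (z + t *s u)) (E i - t *s christoffel G z u (E i)) (E j - t *s christoffel G z u (E j)))
      (if i = j then 1 else 0) 0 0 \<gamma> \<and> (i = j \<longrightarrow> Re \<gamma> = - Re (curv_tensor G z u u (E i) (E i)))"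
    using herm_jet[OF G z jet_line jet_parallel_section[of "E i" "christoffel G z u (E i)"] jet_parallel_section[of "E j" "christoffel G z u (E j)"], of u]
    by (auto simp: herm_zero orthonormal_def)
qed

text \<open>The base curve is the image of the line under F. The squared norm of the covariant
  derivative D i is dropped from the diagonal mixed coefficients, which leaves a lower bound by the
  curvature of the target.\<close>

lemma jet_sections:
  fixes u :: "complex^'m" and l :: nat
  assumes z: "z \<in> U" and s: "\<And>i k. i < l \<Longrightarrow> jet (\<lambda>t. s i t $ k) (a i $ k) (b i $ k) 0 0"
  defines "D \<equiv> \<lambda>i. b i + christoffel H (F z) (DF z u) (a i)"
  obtains \<eta> where "\<And>i j. i < l \<Longrightarrow> j < l \<Longrightarrow> jet (\<lambda>t. herm (H (F (z + t *s u))) (s i t) (s j t))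
        (herm (H (F z)) (a i) (a j)) (herm (H (F z)) (D i) (a j)) (herm (H (F z)) (a i) (D j)) (\<eta> i j)"
    and "\<And>i. i < l \<Longrightarrow> Re (\<eta> i i) \<ge> - Re (curv_tensor H (F z) (DF z u) (DF z u) (a i) (a i))"
proof -
  have "\<exists>\<eta>. \<forall>i<l. \<forall>j<l. jet (\<lambda>t. herm (H (F (z + t *s u))) (s i t) (s j t))
        (herm (H (F z)) (a i) (a j)) (herm (H (F z)) (D i) (a j)) (herm (H (F z)) (a i) (D j)) (\<eta> i j)
      \<and> (i = j \<longrightarrow> Re (\<eta> i j) \<ge> - Re (curv_tensor H (F z) (DF z u) (DF z u) (a i) (a i)))"
  proof (rule bounded_choice2)
  fix i j assume ij: "i < l" "j < l"
  from herm_jet[OF H FzV[OF z] holo_on_jet[OF F open_U z] s[OF ij(1)] s[OF ij(2)]] obtain \<eta> where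
    1: "jet (\<lambda>t. herm (H (F (z + t *s u))) (s i t) (s j t))
        (herm (H (F z)) (a i) (a j)) (herm (H (F z)) (D i) (a j)) (herm (H (F z)) (a i) (D j)) \<eta>"
    "i = j \<Longrightarrow> Re \<eta> = Re (herm (H (F z)) (D i) (D i)) - Re (curv_tensor H (F z) (DF z u) (DF z u) (a i) (a i))"
    unfolding D_def by blast
  have "Re (herm (H (F z)) (D i) (D i)) \<ge> 0"
    by (rule pos_hermD(3)[OF metric_onD(3)[OF H FzV[OF z]]])
  then have "i = j \<longrightarrow> Re \<eta> \<ge> - Re (curv_tensor H (F z) (DF z u) (DF z u) (a i) (a i))"
    using 1(2) by (intro impI) linarith
  with 1(1) show "\<exists>\<eta>. jet (\<lambda>t. herm (H (F (z + t *s u))) (s i t) (s j t))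
        (herm (H (F z)) (a i) (a j)) (herm (H (F z)) (D i) (a j)) (herm (H (F z)) (a i) (D j)) \<eta>
      \<and> (i = j \<longrightarrow> Re \<eta> \<ge> - Re (curv_tensor H (F z) (DF z u) (DF z u) (a i) (a i)))" by blast
  qed
  then show ?thesis using that by blast
qed

lemma detn_zero_column:
  assumes "k < l" "\<And>i. i < l \<Longrightarrow> X i k = 0"
  shows "detn l X = 0"
  unfolding detn_leibniz
proof (rule sum.neutral, rule ballI)
  fix p assume "p \<in> {p. p permutes {..<l}}"
  then have p: "p permutes {..<l}" by simp
  then obtain i where i: "p i = k" using permutes_surj by (metis surj_def)
  with assms(1) have "i < l" using permutes_in_image[OF p, of i] by auto
  then have "(\<Prod>i<l. X i (p i)) = 0" using assms(2)[of i] i by (intro prod_zero) auto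
  then show "of_int (sign p) * (\<Prod>i<l. X i (p i)) = 0" by simp
qed

text \<open>A nonzero Gram determinant of the pullback means that the differential is injective on
  the span of E; an orthonormal basis of the \<open>l\<close>-dimensional image is then lifted back
  to that span.\<close>

lemma orthonormal_image_frame:
  assumes z: "z \<in> U" and l: "l \<le> CARD('n)" and E: "orthonormal (G z) l E"
    and nz: "detn l (\<lambda>i j. herm (pb z) (E i) (E j)) \<noteq> 0"
  obtains f where "\<And>i. i < l \<Longrightarrow> f i \<in> vec.span (E ` {..<l})" "orthonormal (H (F z)) l (\<lambda>i. DF z (f i))"
proof -
  let ?S = "vec.span (E ` {..<l})"
  let ?T = "DF z ` ?S"
  have T: "vec.subspace ?T"
  proof (rule vec.subspaceI)
    show "0 \<in> ?T" using vec.span_zero[of "E ` {..<l}"] DF_linear(2)[OF z, of 0 0] by (auto intro!: image_eqI[of _ _ 0])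
    fix x y assume "x \<in> ?T" "y \<in> ?T"
    then show "x + y \<in> ?T" using DF_linear(3)[OF z] vec.span_add by (smt (verit, best) image_iff)
  next
    fix c x assume "x \<in> ?T"
    then show "c *s x \<in> ?T" using DF_linear(2)[OF z] vec.span_scale by (smt (verit, best) image_iff)
  qed
  have pos: "pos_herm (H (F z))" by (rule metric_onD(3)[OF H FzV[OF z]])
  \<comment> \<open>The empty system from which the orthonormal extensions start; the value
    \<open>undefined\<close> is never inspected.\<close>
  have "orthonormal (H (F z)) 0 undefined" by (simp add: orthonormal_def)
  have "l \<le> vec.dim ?T"
  proof (rule ccontr)
    assume "\<not> l \<le> vec.dim ?T"
    then have k: "vec.dim ?T < l" by simp
    from orthonormal_extend[OF pos \<open>orthonormal (H (F z)) 0 undefined\<close> T, of "vec.dim ?T"]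
    obtain w where w: "orthonormal (H (F z)) (vec.dim ?T) w" "\<forall>i<vec.dim ?T. w i \<in> ?T" by auto
    obtain w' where w': "orthonormal (H (F z)) l w'" "\<forall>i<vec.dim ?T. w' i = w i"
      using orthonormal_UNIV[OF w(1) pos less_imp_le[OF k] l] by blast
    have span: "vec.span (w ` {..<vec.dim ?T}) = ?T"
      by (rule orthonormal_span_eq[OF w(1) T]) (use w in auto)
    define X where "X i p = herm (H (F z)) (DF z (E i)) (w' p)" for i p
    \<comment> \<open>Indices start at 0, so the vector with index vec.dim ?T is the first basis
      vector outside the image and is orthogonal to it. Its column of X vanishes, and with it the
      determinant.\<close>
    have X0: "X i (vec.dim ?T) = 0" if "i < l" for i
    proof -
      have "DF z (E i) \<in> vec.span (w ` {..<vec.dim ?T})" unfolding span using that by (auto intro: vec.span_base)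
      from orthonormal_expand[OF w(1) this]
      have "X i (vec.dim ?T) = herm (H (F z)) (\<Sum>p<vec.dim ?T. herm (H (F z)) (DF z (E i)) (w p) *s w p) (w' (vec.dim ?T))"
        unfolding X_def by simp
      also have "\<dots> = 0" unfolding herm_sum_left
      proof (intro sum.neutral ballI)
        fix p assume "p \<in> {..<vec.dim ?T}"
        then have p: "p < vec.dim ?T" by simp
        then have "herm (H (F z)) (w' p) (w' (vec.dim ?T)) = 0"
          using w'(1)[unfolded orthonormal_def, rule_format, of p "vec.dim ?T"] k by simp
        then show "herm (H (F z)) (herm (H (F z)) (DF z (E i)) (w p) *s w p) (w' (vec.dim ?T)) = 0"
          using w'(2) p by (simp add: herm_scale_left)
      qed
      finally show ?thesis .
    qed
    have "DF z (E i) = (\<Sum>p<l. X i p *s w' p)" if "i < l" for i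
    proof -
      have "vec.span (w ` {..<vec.dim ?T}) \<subseteq> vec.span (w' ` {..<l})"
      proof (rule vec.span_mono, rule subsetI)
        fix x assume "x \<in> w ` {..<vec.dim ?T}"
        then obtain i where "i < vec.dim ?T" "x = w i" by auto
        then show "x \<in> w' ` {..<l}" using w'(2) k by (intro image_eqI[of _ _ i]) auto
      qed
      then have "DF z (E i) \<in> vec.span (w' ` {..<l})" using that vec.span_base[of "E i" "E ` {..<l}"] unfolding span by auto
      from orthonormal_expand[OF w'(1) this] show ?thesis unfolding X_def .
    qed
    then have "detn l (\<lambda>i j. herm (H (F z)) (DF z (E i)) (DF z (E j)))
        = of_real ((norm (detn l X))\<^sup>2) * detn l (\<lambda>i j. herm (H (F z)) (w' i) (w' j))"
      by (rule detn_gram_change)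
    then have "detn l (\<lambda>i j. herm (H (F z)) (DF z (E i)) (DF z (E j))) = 0"
      using detn_zero_column[of "vec.dim ?T" l X, OF k X0] by simp
    then show False using nz by (simp add: herm_pb[OF z])
  qed
  from orthonormal_extend[OF pos \<open>orthonormal (H (F z)) 0 undefined\<close> T _ _ this]
  obtain w where w: "orthonormal (H (F z)) l w" "\<forall>i<l. w i \<in> ?T" by auto
  then have "\<forall>i. \<exists>x. i < l \<longrightarrow> w i = DF z x \<and> x \<in> ?S" by blast
  from choice[OF this] obtain f where f: "\<forall>i<l. w i = DF z (f i) \<and> f i \<in> ?S" by blast
  have "orthonormal (H (F z)) l (\<lambda>i. DF z (f i))" using w(1) f by (simp add: orthonormal_def)
  then show ?thesis using that f by blast
qed

text \<open>On the image side the frame is \<open>f\<close>, whose image is unitary at the base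
  point, so that all determinants there are taken near the identity matrix. The moving image frame
  is corrected until its Gram matrix has no linear terms; the price is a factor |det A|^2, whose
  linear coefficient the first-order condition shows to be zero.\<close>

theorem determinant_maximum:
  assumes l: "l \<le> CARD('m)" and z: "z \<in> U" and E: "orthonormal (G z) l E"
    and K: "detn l (\<lambda>i j. herm (pb z) (E i) (E j)) = of_real K"
    and max: "\<And>z e. z \<in> U \<Longrightarrow> orthonormal (G z) l e \<Longrightarrow> Re (detn l (\<lambda>i j. herm (pb z) (e i) (e j))) \<le> K"
    and f: "\<And>i. i < l \<Longrightarrow> f i \<in> vec.span (E ` {..<l})" "orthonormal (H (F z)) l (\<lambda>i. DF z (f i))"
  shows "(\<Sum>i<l. Re (curv_tensor G z u u (E i) (E i)))
    \<le> (\<Sum>i<l. Re (curv_tensor H (F z) (DF z u) (DF z u) (DF z (f i)) (DF z (f i))))"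
proof -
  let ?R = "\<lambda>i. Re (curv_tensor H (F z) (DF z u) (DF z u) (DF z (f i)) (DF z (f i)))"
  define \<beta> where "\<beta> i p = herm (G z) (f i) (E p)" for i p
  have f_eq: "f i = (\<Sum>p<l. \<beta> i p *s E p)" if "i < l" for i
    unfolding \<beta>_def by (rule orthonormal_expand[OF E f(1)[OF that]])
  \<comment> \<open>The image of f = \<beta> E is unitary, so |det \<beta>|^2 normalises the maximal
    value K to 1.\<close>
  have K\<beta>: "(norm (detn l \<beta>))\<^sup>2 * K = 1"
  proof -
    have "detn l (\<lambda>i j. herm (H (F z)) (DF z (f i)) (DF z (f j))) = 1"
      by (rule detn_gram_orthonormal[OF f(2)])
    then have "detn l (\<lambda>i j. herm (pb z) (f i) (f j)) = 1" by (simp add: herm_pb[OF z])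
    moreover have "detn l (\<lambda>i j. herm (pb z) (f i) (f j)) = of_real ((norm (detn l \<beta>))\<^sup>2) * of_real K"
      unfolding K[symmetric] by (rule detn_gram_change) (rule f_eq)
    ultimately have "of_real ((norm (detn l \<beta>))\<^sup>2 * K) = (1 :: complex)" by simp
    then show ?thesis unfolding of_real_eq_1_iff .
  qed
  define e where "e i t = E i - t *s christoffel G z u (E i)" for i t
  obtain \<gamma> where \<gamma>: "\<And>i j. i < l \<Longrightarrow> j < l \<Longrightarrow> jet (\<lambda>t. herm (G (z + t *s u)) (e i t) (e j t)) (if i = j then 1 else 0) 0 0 (\<gamma> i j)"
    "\<And>i. i < l \<Longrightarrow> Re (\<gamma> i i) = - Re (curv_tensor G z u u (E i) (E i))"
    using jet_parallel_frame[OF z E, of u] unfolding e_def by blast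
  have ej: "jet (\<lambda>t. e i t $ k) (E i $ k) ((- christoffel G z u (E i)) $ k) 0 0" for i k
    unfolding e_def by (rule jet_parallel_section)
  \<comment> \<open>The coefficients \<beta> are kept constant along the line, so \<open>ft\<close>
    is parallel at the base point like \<open>e\<close>.\<close>
  define ft where "ft i t = (\<Sum>p<l. \<beta> i p *s e p t)" for i t
  have fj: "jet (\<lambda>t. ft i t $ k) (f i $ k) ((\<chi> k. \<Sum>p<l. \<beta> i p * (- christoffel G z u (E p) $ k)) $ k) 0 0" if "i < l" for i k
  proof -
    have "jet (\<lambda>t. \<Sum>p<l. \<beta> i p * e p t $ k) (f i $ k) ((\<chi> k. \<Sum>p<l. \<beta> i p * (- christoffel G z u (E p) $ k)) $ k) 0 0"
      by (rule jet_cong[OF jet_sum[OF jet_cmult[OF ej]]]) (simp_all add: f_eq[OF that])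
    then show ?thesis by (simp add: ft_def)
  qed
  have "\<forall>i. \<exists>c. i < l \<longrightarrow> (\<forall>k. jet (\<lambda>t. DF (z + t *s u) (ft i t) $ k) (DF z (f i) $ k) (c $ k) 0 0)"
    using jet_push[OF z fj] by blast
  from choice[OF this] obtain c where
    c: "\<And>i k. i < l \<Longrightarrow> jet (\<lambda>t. DF (z + t *s u) (ft i t) $ k) (DF z (f i) $ k) (c i $ k) 0 0" by blast
  let ?h = "H (F z)" and ?\<Gamma> = "\<lambda>a. christoffel H (F z) (DF z u) a"
  define D where "D i = c i + ?\<Gamma> (DF z (f i))" for i
  define \<alpha> where "\<alpha> i j = herm ?h (D i) (DF z (f j))" for i j
  \<comment> \<open>\<alpha> holds the components of the covariant derivative of the image frame
    along the image itself. Multiplication by 1 - t \<alpha> subtracts exactly this part at first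
    order.\<close>
  define A where "A t i j = (if i = j then 1 else 0) - t * \<alpha> i j" for t i j
  define s where "s i t = (\<Sum>j<l. A t i j *s DF (z + t *s u) (ft j t))" for i t
  define b where "b i = c i - (\<Sum>j<l. \<alpha> i j *s DF z (f j))" for i
  have Aj: "jet (\<lambda>t. A t i j) (if i = j then 1 else 0) (- \<alpha> i j) 0 0" for i j
    unfolding A_def using jet_diff[OF jet_const jet_cmult[OF jet_id, of "\<alpha> i j"]] by (simp add: mult.commute)
  have sj: "jet (\<lambda>t. s i t $ k) (DF z (f i) $ k) (b i $ k) 0 0" if "i < l" for i k
  proof -
    have pick: "(\<Sum>j<l. (if i = j then 1 else 0) * x j) = x i" for x :: "nat \<Rightarrow> complex"
      using that by (subst sum.remove[of _ i]) auto
    have "jet (\<lambda>t. \<Sum>j<l. A t i j * DF (z + t *s u) (ft j t) $ k)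
       (\<Sum>j<l. (if i = j then 1 else 0) * DF z (f j) $ k)
       (\<Sum>j<l. (if i = j then 1 else 0) * c j $ k + - \<alpha> i j * DF z (f j) $ k) (\<Sum>j<l. 0) (\<Sum>j<l. 0)"
      by (rule jet_sum) (rule jet_cong[OF jet_mult[OF Aj c]], simp_all)
    then show ?thesis
      by (simp only: sum.distrib pick s_def b_def) (simp add: sum_negf)
  qed
  have b\<Gamma>: "b i + ?\<Gamma> (DF z (f i)) = D i - (\<Sum>j<l. \<alpha> i j *s DF z (f j))" for i
    by (simp add: b_def D_def)
  \<comment> \<open>After the correction the covariant derivative is D i minus its orthogonal
    projection to the span of the image frame.\<close>
  have perp: "herm ?h (b i + ?\<Gamma> (DF z (f i))) (DF z (f j)) = 0" if "i < l" "j < l" for i j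
  proof -
    have "herm ?h (\<Sum>j<l. \<alpha> i j *s DF z (f j)) (DF z (f j)) = (\<Sum>p<l. \<alpha> i p * (if p = j then 1 else 0))"
      unfolding herm_sum_left using f(2) that by (intro sum.cong refl) (simp add: herm_scale_left orthonormal_def)
    also have "\<dots> = \<alpha> i j" using that by (subst sum.remove[of _ j]) auto
    finally show ?thesis unfolding b\<Gamma> herm_diff_left by (simp add: \<alpha>_def)
  qed
  have perp': "herm ?h (DF z (f i)) (b j + ?\<Gamma> (DF z (f j))) = 0" if "i < l" "j < l" for i j
    using perp[OF that(2,1)] herm_cnj[OF metric_onD(4)[OF H FzV[OF z]], of "b j + ?\<Gamma> (DF z (f j))" "DF z (f i)"] by simp
  obtain \<eta> where \<eta>0: "\<And>i j. i < l \<Longrightarrow> j < l \<Longrightarrow> jet (\<lambda>t. herm (H (F (z + t *s u))) (s i t) (s j t))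
        (herm ?h (DF z (f i)) (DF z (f j))) (herm ?h (b i + ?\<Gamma> (DF z (f i))) (DF z (f j)))
        (herm ?h (DF z (f i)) (b j + ?\<Gamma> (DF z (f j)))) (\<eta> i j)"
    and \<eta>_ge: "\<And>i. i < l \<Longrightarrow> Re (\<eta> i i) \<ge> - ?R i"
    by (rule jet_sections[where l = l and s = s and a = "\<lambda>i. DF z (f i)" and b = b and u = u, OF z sj]) blast+
  have \<eta>: "jet (\<lambda>t. herm (H (F (z + t *s u))) (s i t) (s j t)) (if i = j then 1 else 0) 0 0 (\<eta> i j)" if "i < l" "j < l" for i j
    by (rule jet_cong[OF \<eta>0[OF that]]) (use f(2) perp perp' that in \<open>simp_all add: orthonormal_def\<close>)
  define \<tau> where "\<tau> = (\<Sum>i<l. \<alpha> i i)"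
  define LH where "LH t = detn l (\<lambda>i j. herm (H (F (z + t *s u))) (s i t) (s j t))" for t
  define LG where "LG t = detn l (\<lambda>i j. herm (G (z + t *s u)) (e i t) (e j t))" for t
  have jH: "jet LH 1 0 0 (\<Sum>i<l. \<eta> i i)"
    unfolding LH_def using jet_detn[of l _ "\<lambda>i j. 0" \<eta>, OF \<eta>] by simp
  have jG: "jet LG 1 0 0 (\<Sum>i<l. \<gamma> i i)"
    unfolding LG_def using jet_detn[of l _ "\<lambda>i j. 0" \<gamma>, OF \<gamma>(1)] by simp
  have jA: "jet (\<lambda>t. detn l (A t)) 1 (- \<tau>) 0 0"
    using jet_detn[of l A "\<lambda>i j. - \<alpha> i j" "\<lambda>i j. 0", OF Aj] by (simp add: \<tau>_def sum_negf)
  \<comment> \<open>This difference is 0 at t = 0 and, by maximality, has nonpositive real part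
    nearby. Its mixed coefficient still contains -|\<tau>|^2 from the factor |det A|^2.\<close>
  have j: "jet (\<lambda>t. LH t - detn l (A t) * cnj (detn l (A t)) * LG t) 0 \<tau> (cnj \<tau>)
      ((\<Sum>i<l. \<eta> i i) - (\<tau> * cnj \<tau> + (\<Sum>i<l. \<gamma> i i)))"
    by (rule jet_cong[OF jet_diff[OF jH jet_mult[OF jet_mult[OF jA jet_cnj[OF jA]] jG]]]) simp_all
  have ineq: "\<forall>\<^sub>F t in nhds 0. Re (LH t - detn l (A t) * cnj (detn l (A t)) * LG t) \<le> Re 0"
    using line_eventually[OF z, of u]
  proof eventually_elim
    case (elim t)
    \<comment> \<open>The sections s are images of the frame f', whose matrix in the frame e is the
      product A \<beta>. Multiplicativity of the determinant separates the two factors.\<close>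
    define Y where "Y i p = (\<Sum>j<l. A t i j * \<beta> j p)" for i p
    define f' where "f' i = (\<Sum>p<l. Y i p *s e p t)" for i
    have "s i t = DF (z + t *s u) (f' i)" for i
    proof -
      have "s i t = DF (z + t *s u) (\<Sum>j<l. A t i j *s ft j t)"
        by (simp add: s_def DF_linear(2,4)[OF elim])
      also have "(\<Sum>j<l. A t i j *s ft j t) = (\<Sum>j<l. \<Sum>p<l. (A t i j * \<beta> j p) *s e p t)"
        by (simp add: ft_def vec.scale_sum_right)
      also have "\<dots> = f' i"
        unfolding f'_def Y_def by (subst sum.swap) (simp add: vec.scale_sum_left)
      finally show ?thesis .
    qed
    then have "Re (LH t) = Re (detn l (\<lambda>i j. herm (pb (z + t *s u)) (f' i) (f' j)))"
      by (simp add: LH_def herm_pb[OF elim])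
    also have "\<dots> \<le> K * Re (detn l (\<lambda>i j. herm (G (z + t *s u)) (f' i) (f' j)))"
      by (rule detn_frame_bound[OF l elim max[OF elim]])
    also have "\<dots> = K * ((norm (detn l Y))\<^sup>2 * Re (LG t))"
      unfolding detn_gram_change[where l = l and e = f' and X = Y and u = "\<lambda>p. e p t" and G = "G (z + t *s u)", OF f'_def] LG_def by simp
    also have "detn l Y = detn l (A t) * detn l \<beta>" unfolding Y_def by (rule detn_mult)
    also have "K * ((norm (detn l (A t) * detn l \<beta>))\<^sup>2 * Re (LG t)) = ((norm (detn l \<beta>))\<^sup>2 * K) * ((norm (detn l (A t)))\<^sup>2 * Re (LG t))"
      by (simp add: norm_mult power_mult_distrib)
    also have "\<dots> = Re (detn l (A t) * cnj (detn l (A t)) * LG t)"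
      unfolding K\<beta> complex_norm_square[symmetric] by simp
    finally show ?case by simp
  qed
  \<comment> \<open>The linear coefficients \<tau> and cnj \<tau> combine to 2 \<tau> = 0, which
    removes |\<tau>|^2 from the second-order inequality.\<close>
  from jet_local_max(1)[OF j ineq] have "\<tau> = 0" by simp
  with jet_local_max(2)[OF j ineq] have "(\<Sum>i<l. Re (\<eta> i i)) \<le> (\<Sum>i<l. Re (\<gamma> i i))" by simp
  moreover have "(\<Sum>i<l. - ?R i) \<le> (\<Sum>i<l. Re (\<eta> i i))"
    by (intro sum_mono \<eta>_ge) simp
  moreover have "(\<Sum>i<l. Re (\<gamma> i i)) = (\<Sum>i<l. - Re (curv_tensor G z u u (E i) (E i)))"
    by (intro sum.cong refl \<gamma>(2)) simp
  ultimately show ?thesis by (simp add: sum_negf)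
qed

text \<open>Diagonality of the pulled-back form at the base point makes the off-diagonal corrections
  of the Gram matrix meet vanishing entries, so the curvature of M enters only on the diagonal,
  weighted by the squared singular values.\<close>

theorem trace_maximum:
  assumes l: "l \<le> CARD('m)" and z: "z \<in> U" and E: "orthonormal (G z) l E"
    and diag: "\<And>i j. i < l \<Longrightarrow> j < l \<Longrightarrow> i \<noteq> j \<Longrightarrow> herm (pb z) (E i) (E j) = 0"
    and K: "K = (\<Sum>i<l. Re (herm (pb z) (E i) (E i)))"
    and max: "\<And>z e. z \<in> U \<Longrightarrow> orthonormal (G z) l e \<Longrightarrow> Re (\<Sum>i<l. herm (pb z) (e i) (e i)) \<le> K"
  shows "(\<Sum>i<l. Re (herm (pb z) (E i) (E i)) * Re (curv_tensor G z u u (E i) (E i)))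
    \<le> (\<Sum>i<l. Re (curv_tensor H (F z) (DF z u) (DF z u) (DF z (E i)) (DF z (E i))))"
proof -
  let ?R = "\<lambda>i. Re (curv_tensor H (F z) (DF z u) (DF z u) (DF z (E i)) (DF z (E i)))"
  define \<Lambda> where "\<Lambda> i = Re (herm (pb z) (E i) (E i))" for i
  have \<Lambda>: "herm (pb z) (E i) (E i) = of_real (\<Lambda> i)" for i
    unfolding \<Lambda>_def by (rule herm_real[OF hermitian_pb[OF z]])
  define e where "e i t = E i - t *s christoffel G z u (E i)" for i t
  obtain \<gamma> where \<gamma>: "\<And>i j. i < l \<Longrightarrow> j < l \<Longrightarrow> jet (\<lambda>t. herm (G (z + t *s u)) (e i t) (e j t)) (if i = j then 1 else 0) 0 0 (\<gamma> i j)"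
    "\<And>i. i < l \<Longrightarrow> Re (\<gamma> i i) = - Re (curv_tensor G z u u (E i) (E i))"
    using jet_parallel_frame[OF z E, of u] unfolding e_def by blast
  have ej: "jet (\<lambda>t. e i t $ k) (E i $ k) ((- christoffel G z u (E i)) $ k) 0 0" for i k
    unfolding e_def by (rule jet_parallel_section)
  have "\<forall>i. \<exists>c. \<forall>k. jet (\<lambda>t. DF (z + t *s u) (e i t) $ k) (DF z (E i) $ k) (c $ k) 0 0"
    using jet_push[OF z ej] by blast
  from choice[OF this] obtain c where
    c: "\<And>i k. jet (\<lambda>t. DF (z + t *s u) (e i t) $ k) (DF z (E i) $ k) (c i $ k) 0 0" by blast
  let ?h = "H (F z)" and ?\<Gamma> = "\<lambda>a. christoffel H (F z) (DF z u) a"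
  define b where "b i j = herm ?h (c i + ?\<Gamma> (DF z (E i))) (DF z (E j))" for i j
  define c' where "c' i j = herm ?h (DF z (E i)) (c j + ?\<Gamma> (DF z (E j)))" for i j
  obtain \<eta> where \<eta>0: "\<And>i j. i < l \<Longrightarrow> j < l \<Longrightarrow> jet (\<lambda>t. herm (H (F (z + t *s u))) (DF (z + t *s u) (e i t)) (DF (z + t *s u) (e j t)))
        (herm ?h (DF z (E i)) (DF z (E j))) (b i j) (c' i j) (\<eta> i j)"
    and \<eta>_ge: "\<And>i. i < l \<Longrightarrow> Re (\<eta> i i) \<ge> - ?R i"
    unfolding b_def c'_def
    by (rule jet_sections[where l = l and s = "\<lambda>i t. DF (z + t *s u) (e i t)" and a = "\<lambda>i. DF z (E i)" and b = c and u = u, OF z c]) blast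
  define P where "P t i j = herm (H (F (z + t *s u))) (DF (z + t *s u) (e i t)) (DF (z + t *s u) (e j t))" for t i j
  define g where "g t i j = herm (G (z + t *s u)) (e i t) (e j t)" for t i j
  \<comment> \<open>At t = 0 this is 2 K - K = K, so the comparison is sharp there. As g has no
    linear terms, the mixed coefficient is the sum over i of 2 \<eta> - (\<eta> + \<gamma>
    \<Lambda>) = \<eta> - \<gamma> \<Lambda>.\<close>
  define \<phi> where "\<phi> t = 2 * (\<Sum>i<l. P t i i) - (\<Sum>i<l. \<Sum>j<l. g t j i * P t i j)" for t
  have P: "jet (\<lambda>t. P t i j) (if i = j then of_real (\<Lambda> i) else 0) (b i j) (c' i j) (\<eta> i j)" if "i < l" "j < l" for i j
    unfolding P_def
    by (rule jet_cong[OF \<eta>0[OF that]]) (use diag[OF that] \<Lambda>[of i] in \<open>auto simp: herm_pb[OF z]\<close>)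
  have g: "jet (\<lambda>t. g t j i) (if i = j then 1 else 0) 0 0 (\<gamma> j i)" if "i < l" "j < l" for i j
    using \<gamma>(1)[OF that(2,1)] unfolding g_def by (auto simp: eq_commute)
  have pick: "(\<Sum>j<l. if i = j then x j else 0) = x i" if "i < l" for x :: "nat \<Rightarrow> complex" and i
    using that by (subst sum.remove[of _ i]) auto
  have j1: "jet (\<lambda>t. \<Sum>i<l. P t i i) (\<Sum>i<l. of_real (\<Lambda> i)) (\<Sum>i<l. b i i) (\<Sum>i<l. c' i i) (\<Sum>i<l. \<eta> i i)"
    using jet_sum[of "{..<l}" "\<lambda>i t. P t i i" "\<lambda>i. of_real (\<Lambda> i)" "\<lambda>i. b i i" "\<lambda>i. c' i i" "\<lambda>i. \<eta> i i"] P by force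
  have j2: "jet (\<lambda>t. \<Sum>i<l. \<Sum>j<l. g t j i * P t i j)
      (\<Sum>i<l. \<Sum>j<l. if i = j then of_real (\<Lambda> j) else 0) (\<Sum>i<l. \<Sum>j<l. if i = j then b i j else 0)
      (\<Sum>i<l. \<Sum>j<l. if i = j then c' i j else 0) (\<Sum>i<l. \<Sum>j<l. if i = j then \<eta> i j + \<gamma> j i * of_real (\<Lambda> i) else 0)"
    by (intro jet_sum) (rule jet_cong[OF jet_mult[OF g P]], auto)
  have j: "jet \<phi> (of_real K) (\<Sum>i<l. b i i) (\<Sum>i<l. c' i i) ((\<Sum>i<l. \<eta> i i) - (\<Sum>i<l. \<gamma> i i * of_real (\<Lambda> i)))"
    unfolding \<phi>_def
    by (rule jet_cong[OF jet_diff[OF jet_cmult[OF j1] j2]]) (simp_all add: pick sum.distrib K \<Lambda>_def)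
  have ineq: "\<forall>\<^sub>F t in nhds 0. Re (\<phi> t) \<le> Re (of_real K)"
    using line_eventually[OF z, of u]
  proof eventually_elim
    case (elim t)
    then show ?case
      using trace_frame_bound[OF l elim max[OF elim], of "\<lambda>i. e i t"]
      by (simp add: \<phi>_def P_def g_def herm_pb[OF elim])
  qed
  have "(\<Sum>i<l. Re (\<eta> i i)) \<le> (\<Sum>i<l. Re (\<gamma> i i) * \<Lambda> i)"
    using jet_local_max(2)[OF j ineq] by simp
  moreover have "(\<Sum>i<l. - ?R i) \<le> (\<Sum>i<l. Re (\<eta> i i))"
    by (intro sum_mono \<eta>_ge) simp
  moreover have "(\<Sum>i<l. Re (\<gamma> i i) * \<Lambda> i) = (\<Sum>i<l. - (\<Lambda> i * Re (curv_tensor G z u u (E i) (E i))))"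
    by (intro sum.cong refl) (simp add: \<gamma>(2))
  ultimately show ?thesis by (simp add: sum_negf \<Lambda>_def)
qed

end

section \<open>Maxima over unitary frames on a compact manifold\<close>

lemma finite_type_enumeration:
  obtains \<iota> :: "nat \<Rightarrow> 'm::finite" and \<kappa> where "bij_betw \<iota> {..<CARD('m)} UNIV"
    "\<And>j. j < CARD('m) \<Longrightarrow> \<kappa> (\<iota> j) = j" "\<And>i. \<kappa> i < CARD('m)" "\<And>i. \<iota> (\<kappa> i) = i"
proof -
  obtain \<iota> :: "nat \<Rightarrow> 'm" where "bij_betw \<iota> {0..<CARD('m)} UNIV"
    using ex_bij_betw_nat_finite[of "UNIV :: 'm set"] by auto
  then have b: "bij_betw \<iota> {..<CARD('m)} UNIV" by (simp add: atLeast0LessThan)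
  show ?thesis
    by (rule that[OF b, of "the_inv_into {..<CARD('m)} \<iota>"])
       (use b the_inv_into_into[of \<iota> "{..<CARD('m)}" _ "{..<CARD('m)}"] in
         \<open>auto simp: bij_betw_def the_inv_into_f_f f_the_inv_into_f\<close>)
qed

lemma is_chartD:
  assumes "is_chart c"
  shows "open (fst c)" "open (chart_image c)" "continuous_on (fst c) (snd c)"
    "x \<in> fst c \<Longrightarrow> inv_chart c (snd c x) = x"
  using assms unfolding is_chart_def homeomorphism_def by auto

lemma chart_open_image:
  assumes c: "is_chart c" and W: "open W"
  shows "open (snd c ` (fst c \<inter> W))"
proof -
  have hom: "homeomorphism (fst c) (chart_image c) (snd c) (inv_chart c)" using c by (simp add: is_chart_def)
  have "openin (top_of_set (fst c)) (fst c \<inter> W)" using W by (simp add: openin_open_Int)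
  from homeomorphism_imp_open_map[OF hom this] show ?thesis
    using is_chartD(2)[OF c] openin_open_trans by blast
qed

lemma Ck_on_subset: "Ck_on k \<phi> U \<Longrightarrow> W \<subseteq> U \<Longrightarrow> Ck_on k \<phi> W"
  by (induction k arbitrary: \<phi>) (auto intro: continuous_on_subset)

lemma metric_on_subset: "metric_on G U \<Longrightarrow> open W \<Longrightarrow> W \<subseteq> U \<Longrightarrow> metric_on G W"
  unfolding metric_on_def smooth_on_def using Ck_on_subset by blast

lemma metric_on_continuous: "metric_on G U \<Longrightarrow> continuous_on U (\<lambda>z. G z $ k $ l)"
  unfolding metric_on_def smooth_on_def by (metis Ck_on.simps(1))

lemma (in local_map) pb_continuous: "continuous_on U (\<lambda>z. pb z $ k $ l)"
proof -
  have "continuous_on U F"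
    using holo_on_derivative(1)[OF F] by (meson has_derivative_continuous continuous_at_imp_continuous_on)
  then have h: "continuous_on U (\<lambda>z. H (F z) $ p $ q)" for p q
    using continuous_on_compose2[OF metric_on_continuous[OF H] _ FV] by blast
  have d: "continuous_on U (\<lambda>z. DF z w $ p)" for w p
    by (intro continuous_intros holo_on_continuous_derivative[OF F open_U])
  show ?thesis unfolding pb_def pullback_def herm_def
    by (simp, intro continuous_intros h d)
qed

locale holomorphic_setting =
  fixes A :: "('a::{t2_space, second_countable_topology}, 'm::finite) chart set"
    and g :: "('a, 'm) metric"
    and B :: "('b::{t2_space, second_countable_topology}, 'n::finite) chart set"
    and h :: "('b, 'n) metric"
    and f :: "'a \<Rightarrow> 'b"
  assumes M: "hermitian_manifold A g" and N: "hermitian_manifold B h" and f: "holomorphic_map A B f"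
begin

definition dom :: "('a, 'm) chart \<Rightarrow> ('b, 'n) chart \<Rightarrow> (complex^'m) set" where
  "dom c d = snd c ` (fst c \<inter> f -` fst d)"

abbreviation drep :: "('a, 'm) chart \<Rightarrow> ('b, 'n) chart \<Rightarrow> complex^'m \<Rightarrow> complex^'m \<Rightarrow> complex^'n" where
  "drep c d z \<equiv> frechet_derivative (coord_rep c d f) (at z)"

definition form :: "('a, 'm) chart \<Rightarrow> ('b, 'n) chart \<Rightarrow> complex^'m \<Rightarrow> complex^'m^'m" where
  "form c d z = local_map.pb (h d) (coord_rep c d f) z"

lemma chart: "c \<in> A \<Longrightarrow> is_chart c" "d \<in> B \<Longrightarrow> is_chart d"
  using M N by (auto simp: hermitian_manifold_def complex_atlas_def)

lemma charts_cover: "\<exists>c\<in>A. \<exists>d\<in>B. p \<in> fst c \<and> f p \<in> fst d"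
  using M N unfolding hermitian_manifold_def complex_atlas_def by (metis UNIV_I UN_E)

lemma f_continuous: "continuous_on UNIV f"
  using f by (simp add: holomorphic_map_def)

lemma open_preimage: "open W \<Longrightarrow> open (f -` W)"
  using f_continuous by (simp add: continuous_on_open_vimage)

lemma open_dom: "c \<in> A \<Longrightarrow> d \<in> B \<Longrightarrow> open (dom c d)"
  unfolding dom_def by (intro chart_open_image chart open_preimage is_chartD(1))

lemma metric_chart:
  "c \<in> A \<Longrightarrow> metric_on (g c) (chart_image c)" "d \<in> B \<Longrightarrow> metric_on (h d) (chart_image d)"
proof -
  have gM: "hermitian_metric A g" and hN: "hermitian_metric B h" using M N by (auto simp: hermitian_manifold_def)
  show "metric_on (g c) (chart_image c)" if "c \<in> A"
    using gM that is_chartD(2)[OF chart(1)[OF that]]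
    unfolding hermitian_metric_def metric_on_def pos_herm_def hermitian_mat_def by blast
  show "metric_on (h d) (chart_image d)" if "d \<in> B"
    using hN that is_chartD(2)[OF chart(2)[OF that]]
    unfolding hermitian_metric_def metric_on_def pos_herm_def hermitian_mat_def by blast
qed

lemma local: "c \<in> A \<Longrightarrow> d \<in> B \<Longrightarrow> local_map (g c) (dom c d) (h d) (chart_image d) (coord_rep c d f)"
proof
  assume c: "c \<in> A" and d: "d \<in> B"
  show "metric_on (g c) (dom c d)"
    by (rule metric_on_subset[OF metric_chart(1)[OF c] open_dom[OF c d]]) (auto simp: dom_def)
  show "metric_on (h d) (chart_image d)" by (rule metric_chart(2)[OF d])
  show "holo_on (coord_rep c d f) (dom c d)" using f c d by (simp add: holomorphic_map_def dom_def)
  show "coord_rep c d f ` dom c d \<subseteq> chart_image d"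
    using is_chartD(4)[OF chart(1)[OF c]] by (auto simp: dom_def coord_rep_def)
qed

lemma dom_point:
  assumes "c \<in> A" "z \<in> dom c d"
  shows "inv_chart c z \<in> fst c" "f (inv_chart c z) \<in> fst d" "snd c (inv_chart c z) = z"
  using assms is_chartD(4)[OF chart(1)[OF assms(1)]] by (auto simp: dom_def)

lemma transition_derivative:
  assumes c: "c \<in> A" "c' \<in> A" and p: "p \<in> fst c" "p \<in> fst c'"
  shows "(transition c c' has_derivative frechet_derivative (transition c c') (at (snd c p))) (at (snd c p))"
    "transition c c' (snd c p) = snd c' p"
proof -
  have "holo_on (transition c c') (snd c ` (fst c \<inter> fst c'))"
    using M c by (auto simp: hermitian_manifold_def complex_atlas_def holo_compatible_def)
  then show "(transition c c' has_derivative frechet_derivative (transition c c') (at (snd c p))) (at (snd c p))"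
    using p by (intro holo_on_derivative(1)) auto
  show "transition c c' (snd c p) = snd c' p"
    using is_chartD(4)[OF chart(1)[OF c(1)] p(1)] by (simp add: transition_def)
qed

text \<open>Near p the two representatives satisfy \<psi> o F = F' o \<phi> with the transition maps
  \<phi> and \<psi>. The chain rule and the invariance of \<open>h\<close> give the second claim.
  Values on frames can therefore be moved between charts.\<close>

lemma change_of_charts:
  assumes c: "c \<in> A" "c' \<in> A" and d: "d \<in> B" "d' \<in> B"
    and p: "p \<in> fst c" "p \<in> fst c'" "f p \<in> fst d" "f p \<in> fst d'"
  defines "\<phi>' \<equiv> frechet_derivative (transition c c') (at (snd c p))"
  shows "herm (g c (snd c p)) v w = herm (g c' (snd c' p)) (\<phi>' v) (\<phi>' w)"
    and "herm (form c d (snd c p)) v w = herm (form c' d' (snd c' p)) (\<phi>' v) (\<phi>' w)"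
proof -
  have "snd c p \<in> snd c ` (fst c \<inter> fst c')" using p by auto
  then show "herm (g c (snd c p)) v w = herm (g c' (snd c' p)) (\<phi>' v) (\<phi>' w)"
    using M c transition_derivative(2)[OF c p(1,2)]
    unfolding hermitian_manifold_def hermitian_metric_def \<phi>'_def by metis
  interpret L: local_map "g c" "dom c d" "h d" "chart_image d" "coord_rep c d f" by (rule local[OF c(1) d(1)])
  interpret L': local_map "g c'" "dom c' d'" "h d'" "chart_image d'" "coord_rep c' d' f" by (rule local[OF c(2) d(2)])
  let ?F = "coord_rep c d f" and ?F' = "coord_rep c' d' f" and ?\<psi> = "transition d d'" and ?\<phi> = "transition c c'"
  let ?z = "snd c p" and ?z' = "snd c' p"
  have z: "?z \<in> dom c d" "?z' \<in> dom c' d'" using p by (auto simp: dom_def)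
  have Fz: "?F ?z = snd d (f p)" using is_chartD(4)[OF chart(1)[OF c(1)] p(1)] by (simp add: coord_rep_def)
  have \<phi>z: "?\<phi> ?z = ?z'" by (rule transition_derivative(2)[OF c p(1,2)])
  have F'z: "?F' ?z' = snd d' (f p)" using is_chartD(4)[OF chart(1)[OF c(2)] p(2)] by (simp add: coord_rep_def)
  have \<psi>z: "?\<psi> (?F ?z) = ?F' ?z'"
    using is_chartD(4)[OF chart(2)[OF d(1)] p(3)] by (simp add: Fz F'z transition_def)
  have Fin: "?F ?z \<in> snd d ` (fst d \<inter> fst d')" using Fz p by auto
  have "holo_on ?\<psi> (snd d ` (fst d \<inter> fst d'))"
    using N d by (auto simp: hermitian_manifold_def complex_atlas_def holo_compatible_def)
  then have \<psi>d: "(?\<psi> has_derivative frechet_derivative ?\<psi> (at (?F ?z))) (at (?F ?z))"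
    using Fin by (rule holo_on_derivative(1))
  have 1: "((\<lambda>y. ?\<psi> (?F y)) has_derivative (\<lambda>v. frechet_derivative ?\<psi> (at (?F ?z)) (L.DF ?z v))) (at ?z)"
    by (rule has_derivative_compose[OF holo_on_derivative(1)[OF L.F z(1)] \<psi>d])
  have 2: "((\<lambda>y. ?F' (?\<phi> y)) has_derivative (\<lambda>v. L'.DF ?z' (\<phi>' v))) (at ?z)"
    using has_derivative_compose[OF transition_derivative(1)[OF c p(1,2)], of ?F' "L'.DF ?z'"]
      holo_on_derivative(1)[OF L'.F z(2)] by (simp add: \<phi>z \<phi>'_def)
  define W where "W = snd c ` (fst c \<inter> (fst c' \<inter> f -` (fst d \<inter> fst d')))"
  have W: "open W" "?z \<in> W" unfolding W_def
    using p by (auto intro!: chart_open_image chart c open_Int open_preimage is_chartD(1) d)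
  have "?F' (?\<phi> y) = ?\<psi> (?F y)" if "y \<in> W" for y
  proof -
    from that obtain q where q: "q \<in> fst c" "q \<in> fst c'" "f q \<in> fst d" "y = snd c q" unfolding W_def by auto
    then show ?thesis
      using is_chartD(4)[OF chart(1)[OF c(1)]] is_chartD(4)[OF chart(1)[OF c(2)]] is_chartD(4)[OF chart(2)[OF d(1)]]
      by (simp add: transition_def coord_rep_def)
  qed
  then have "((\<lambda>y. ?\<psi> (?F y)) has_derivative (\<lambda>v. L'.DF ?z' (\<phi>' v))) (at ?z)"
    by (rule has_derivative_transform_within_open[OF 2 W])
  then have eq: "frechet_derivative ?\<psi> (at (?F ?z)) (L.DF ?z v) = L'.DF ?z' (\<phi>' v)" for v
    using has_derivative_unique[OF 1] by metis
  have "herm (form c d ?z) v w = herm (h d (?F ?z)) (L.DF ?z v) (L.DF ?z w)"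
    unfolding form_def by (rule L.herm_pb[OF z(1)])
  also have "\<dots> = herm (h d' (?\<psi> (?F ?z))) (frechet_derivative ?\<psi> (at (?F ?z)) (L.DF ?z v)) (frechet_derivative ?\<psi> (at (?F ?z)) (L.DF ?z w))"
    using N d Fin unfolding hermitian_manifold_def hermitian_metric_def by blast
  also have "\<dots> = herm (form c' d' ?z') (\<phi>' v) (\<phi>' w)"
    unfolding form_def L'.herm_pb[OF z(2)] eq \<psi>z ..
  finally show "herm (form c d ?z) v w = herm (form c' d' ?z') (\<phi>' v) (\<phi>' w)" .
qed

text \<open>Full unitary frames, stored as the rows of a matrix. The length \<open>l\<close> is not
  a type, so an \<open>l\<close>-frame is represented by \<open>l\<close> selected rows of a full
  frame; every \<open>l\<close>-frame has such a completion.\<close>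

definition frames :: "('a, 'm) chart \<Rightarrow> (complex^'m) set \<Rightarrow> ((complex^'m) \<times> (complex^'m^'m)) set" where
  "frames c Z = {x. fst x \<in> Z \<and> (\<forall>i j. herm (g c (fst x)) (snd x $ i) (snd x $ j) = (if i = j then 1 else 0))}"

lemma compact_frames:
  assumes c: "c \<in> A" and Z: "compact Z" "Z \<subseteq> chart_image c"
  shows "compact (frames c Z)"
proof -
  have cont: "continuous_on Z (\<lambda>z. g c z $ k $ l)" for k l
    by (rule continuous_on_subset[OF metric_on_continuous[OF metric_chart(1)[OF c]] Z(2)])
  obtain \<mu> where \<mu>: "\<mu> > 0" "\<And>z v. z \<in> Z \<Longrightarrow> \<mu> * (norm v)\<^sup>2 \<le> Re (herm (g c z) v v)"
    using herm_coercive[OF Z(1) cont] metric_onD(3)[OF metric_chart(1)[OF c]] Z(2) by blast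
  \<comment> \<open>Each of the CARD('m) rows of a unitary frame has norm at most sqrt (1 /
    \<mu>).\<close>
  define R where "R = real CARD('m) * sqrt (1 / \<mu>)"
  let ?S = "Z \<times> cball (0 :: complex^'m^'m) R"
  have "norm (snd x) \<le> R" if x: "x \<in> frames c Z" for x
  proof -
    have "norm (snd x $ i) \<le> sqrt (1 / \<mu>)" for i
    proof -
      have "\<mu> * (norm (snd x $ i))\<^sup>2 \<le> 1" using \<mu>(2)[of "fst x" "snd x $ i"] x by (simp add: frames_def)
      then have "(norm (snd x $ i))\<^sup>2 \<le> 1 / \<mu>" using \<mu>(1) by (simp add: field_simps)
      then show ?thesis by (rule real_le_rsqrt)
    qed
    then have "(\<Sum>i\<in>UNIV. norm (snd x $ i)) \<le> (\<Sum>i\<in>(UNIV::'m set). sqrt (1 / \<mu>))" by (intro sum_mono)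
    also have "\<dots> = R" by (simp add: R_def)
    finally show ?thesis unfolding norm_vec_def[of "snd x"] using L2_set_le_sum[of UNIV "\<lambda>i. norm (snd x $ i)"] by simp
  qed
  then have eq: "frames c Z = (\<Inter>i. \<Inter>j. {x \<in> ?S. herm (g c (fst x)) (snd x $ i) (snd x $ j) = (if i = j then 1 else 0)})"
    by (auto simp: frames_def mem_Times_iff)
  have S: "compact ?S" using Z(1) by (intro compact_Times) auto
  have gc: "continuous_on ?S (\<lambda>x. g c (fst x) $ k $ l)" for k l
    by (rule continuous_on_compose2[OF cont]) (auto intro: continuous_intros)
  have "continuous_on ?S (\<lambda>x. herm (g c (fst x)) (snd x $ i) (snd x $ j))" for i j
    unfolding herm_def by (intro continuous_intros gc)
  then have "closed (frames c Z)" unfolding eq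
    by (intro closed_INT ballI continuous_closed_preimage_constant compact_imp_closed S)
  moreover have "frames c Z = ?S \<inter> frames c Z" unfolding eq by auto
  ultimately show ?thesis using compact_Int_closed[OF S] by metis
qed

text \<open>Finitely many closed coordinate balls carry all points, the unitary frames over each
  form a compact set, and any frame in any chart can be transported to one of these balls. \<Phi> is
  abstract so that determinant and trace are treated together; \<open>cong\<close> makes it blind to
  the vectors that complete an \<open>l\<close>-frame.\<close>

lemma maximum_over_frames:
  fixes \<Phi> :: "(nat \<Rightarrow> nat \<Rightarrow> complex) \<Rightarrow> real"
  assumes compact: "compact (UNIV :: 'a set)" and l: "l \<le> CARD('m)"
    and cong: "\<And>M N. (\<And>i j. i < l \<Longrightarrow> j < l \<Longrightarrow> M i j = N i j) \<Longrightarrow> \<Phi> M = \<Phi> N"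
    and cont: "\<And>(T :: ((complex^'m) \<times> (complex^'m^'m)) set) M. (\<And>i j. i < l \<Longrightarrow> j < l \<Longrightarrow> continuous_on T (\<lambda>x. M x i j)) \<Longrightarrow> continuous_on T (\<lambda>x. \<Phi> (M x))"
  obtains c d z E where "c \<in> A" "d \<in> B" "z \<in> dom c d" "orthonormal (g c z) l E"
    "\<And>c' d' z' e. c' \<in> A \<Longrightarrow> d' \<in> B \<Longrightarrow> z' \<in> dom c' d' \<Longrightarrow> orthonormal (g c' z') l e \<Longrightarrow>
       \<Phi> (\<lambda>i j. herm (form c' d' z') (e i) (e j)) \<le> \<Phi> (\<lambda>i j. herm (form c d z) (E i) (E j))"
proof -
  obtain \<iota> :: "nat \<Rightarrow> 'm" and \<kappa> where inv: "\<And>j. j < CARD('m) \<Longrightarrow> \<kappa> (\<iota> j) = j"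
    and inv': "\<And>i. \<kappa> i < CARD('m)" "\<And>i. \<iota> (\<kappa> i) = i"
    by (rule finite_type_enumeration) blast
  have \<iota>_inj: "\<iota> i = \<iota> j \<longleftrightarrow> i = j" if "i < l" "j < l" for i j
    using inv that l by (metis order.strict_trans2)
  \<comment> \<open>Around each point a closed coordinate ball on which f is represented in one pair
    of charts: the open balls give the cover, the closed ones the compact frame sets.\<close>
  have "\<forall>p. \<exists>c d r. c \<in> A \<and> d \<in> B \<and> p \<in> fst c \<and> r > 0 \<and> cball (snd c p) r \<subseteq> dom c d"
  proof
    fix p
    obtain c d where cd: "c \<in> A" "d \<in> B" "p \<in> fst c" "f p \<in> fst d" using charts_cover by blast
    then have "snd c p \<in> dom c d" by (auto simp: dom_def)
    with open_dom[OF cd(1,2)] obtain r where "r > 0" "cball (snd c p) r \<subseteq> dom c d"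
      using open_contains_cball by blast
    with cd show "\<exists>c d r. c \<in> A \<and> d \<in> B \<and> p \<in> fst c \<and> r > 0 \<and> cball (snd c p) r \<subseteq> dom c d" by blast
  qed
  then obtain C D r where CD: "\<And>p. C p \<in> A" "\<And>p. D p \<in> B" "\<And>p. p \<in> fst (C p)" "\<And>p. r p > 0"
    "\<And>p. cball (snd (C p) p) (r p) \<subseteq> dom (C p) (D p)" by metis
  define Z where "Z p = cball (snd (C p) p) (r p)" for p
  define O' where "O' p = fst (C p) \<inter> snd (C p) -` ball (snd (C p) p) (r p)" for p
  have O': "open (O' p)" "p \<in> O' p" for p
    unfolding O'_def using is_chartD[OF chart(1)[OF CD(1)[of p]]] CD[of p]
    by (auto intro: continuous_open_preimage)
  obtain P where P: "finite P" "UNIV = (\<Union>p\<in>P. O' p)"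
    using compactE_image[OF compact, of UNIV O'] O' by (metis UNIV_I UNIV_eq_I UN_iff subset_UNIV top.extremum_uniqueI)
  have ZI: "Z p \<subseteq> chart_image (C p)" "Z p \<subseteq> dom (C p) (D p)" for p using CD(5)[of p] by (auto simp: Z_def dom_def)
  define val where "val p x = \<Phi> (\<lambda>i j. herm (form (C p) (D p) (fst x)) (snd x $ \<iota> i) (snd x $ \<iota> j))" for p x
  have "continuous_on (frames (C p) (Z p)) (val p)" for p
    unfolding val_def
  proof (rule cont)
    interpret L: local_map "g (C p)" "dom (C p) (D p)" "h (D p)" "chart_image (D p)" "coord_rep (C p) (D p) f"
      by (rule local[OF CD(1,2)])
    have fc: "continuous_on (frames (C p) (Z p)) (\<lambda>x. form (C p) (D p) (fst x) $ k $ q)" for k q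
      unfolding form_def
      by (rule continuous_on_compose2[OF L.pb_continuous]) (use ZI in \<open>auto simp: frames_def intro: continuous_intros\<close>)
    show "continuous_on (frames (C p) (Z p)) (\<lambda>x. herm (form (C p) (D p) (fst x)) (snd x $ \<iota> i) (snd x $ \<iota> j))" for i j
      unfolding herm_def by (intro continuous_intros fc)
  qed
  then have S_compact: "compact (\<Union>p\<in>P. val p ` frames (C p) (Z p))"
    using ZI CD by (intro compact_UN P compact_continuous_image compact_frames) (auto simp: Z_def)
  have bound: "\<exists>p\<in>P. \<exists>x\<in>frames (C p) (Z p). val p x = \<Phi> (\<lambda>i j. herm (form c' d' z') (e i) (e j))"
    if c': "c' \<in> A" "d' \<in> B" "z' \<in> dom c' d'" and e: "orthonormal (g c' z') l e" for c' d' z' e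
  proof -
    define q where "q = inv_chart c' z'"
    have q: "q \<in> fst c'" "f q \<in> fst d'" "snd c' q = z'" unfolding q_def using dom_point[OF c'(1,3)] by auto
    obtain p where p: "p \<in> P" "q \<in> O' p" using P(2) by blast
    have qp: "q \<in> fst (C p)" "snd (C p) q \<in> Z p" using p(2) by (auto simp: O'_def Z_def)
    then have "snd (C p) q \<in> dom (C p) (D p)" using ZI by blast
    from dom_point(2)[OF CD(1) this] have fq: "f q \<in> fst (D p)"
      using is_chartD(4)[OF chart(1)[OF CD(1)] qp(1)] by simp
    have "pos_herm (g c' z')" using metric_onD(3)[OF metric_chart(1)[OF c'(1)]] q by auto
    from orthonormal_UNIV[OF e this l order_refl] obtain e' where
      e': "orthonormal (g c' z') CARD('m) e'" "\<forall>i<l. e' i = e i" by blast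
    define T where "T = frechet_derivative (transition c' (C p)) (at z')"
    have T: "herm (g c' z') v w = herm (g (C p) (snd (C p) q)) (T v) (T w)"
      "herm (form c' d' z') v w = herm (form (C p) (D p) (snd (C p) q)) (T v) (T w)" for v w
      using change_of_charts[OF c'(1) CD(1) c'(2) CD(2) q(1) qp(1) q(2) fq] unfolding T_def q(3) by auto
    \<comment> \<open>The completed frame, moved to the chart of the ball by the derivative of the
      transition map and indexed by the type through \<kappa>.\<close>
    define x where "x = (snd (C p) q, \<chi> k. T (e' (\<kappa> k)))"
    have "x \<in> frames (C p) (Z p)"
    proof -
      have "\<kappa> i = \<kappa> j \<longleftrightarrow> i = j" for i j
        using inv'(2) by metis
      then show ?thesis using e'(1) inv'(1) qp(2)
        by (simp add: frames_def x_def T(1)[symmetric] orthonormal_def)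
    qed
    moreover have "val p x = \<Phi> (\<lambda>i j. herm (form c' d' z') (e i) (e j))"
      unfolding val_def by (rule cong) (use l e'(2) inv in \<open>simp add: x_def T(2)\<close>)
    ultimately show ?thesis using p(1) by blast
  qed
  have S_nonempty: "(\<Union>p\<in>P. val p ` frames (C p) (Z p)) \<noteq> {}"
  proof -
    let ?p = "undefined :: 'a"
    have z: "snd (C ?p) ?p \<in> dom (C ?p) (D ?p)" using CD(4,5)[of ?p] by auto
    have "pos_herm (g (C ?p) (snd (C ?p) ?p))"
      using metric_onD(3)[OF metric_chart(1)[OF CD(1)]] CD(3) by auto
    then obtain u where "orthonormal (g (C ?p) (snd (C ?p) ?p)) l u" using orthonormal_spanning[OF _ l] by blast
    from bound[OF CD(1) CD(2) z this] show ?thesis by blast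
  qed
  obtain s where s: "s \<in> (\<Union>p\<in>P. val p ` frames (C p) (Z p))" "\<And>t. t \<in> (\<Union>p\<in>P. val p ` frames (C p) (Z p)) \<Longrightarrow> t \<le> s"
    using compact_attains_sup[OF S_compact S_nonempty] by blast
  then obtain p x where px: "x \<in> frames (C p) (Z p)" "s = val p x" by auto
  show ?thesis
  proof (rule that[of "C p" "D p" "fst x" "\<lambda>i. snd x $ \<iota> i"])
    show "C p \<in> A" "D p \<in> B" by (rule CD)+
    show "fst x \<in> dom (C p) (D p)" using px(1) ZI by (auto simp: frames_def)
    show "orthonormal (g (C p) (fst x)) l (\<lambda>i. snd x $ \<iota> i)"
      using px(1) \<iota>_inj by (auto simp: frames_def orthonormal_def)
    fix c' d' z' e assume "c' \<in> A" "d' \<in> B" "z' \<in> dom c' d'" "orthonormal (g c' z') l e"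
    from bound[OF this] obtain p' x' where "p' \<in> P" "x' \<in> frames (C p') (Z p')"
      and x': "val p' x' = \<Phi> (\<lambda>i j. herm (form c' d' z') (e i) (e j))" by blast
    then have "val p' x' \<le> s" by (intro s(2)) blast
    then have "\<Phi> (\<lambda>i j. herm (form c' d' z') (e i) (e j)) \<le> s" unfolding x' .
    then show "\<Phi> (\<lambda>i j. herm (form c' d' z') (e i) (e j))
      \<le> \<Phi> (\<lambda>i j. herm (form (C p) (D p) (fst x)) (snd x $ \<iota> i) (snd x $ \<iota> j))"
      unfolding px(2) val_def .
  qed
qed

end

section \<open>Rank estimates and constancy\<close>

context holomorphic_setting
begin

lemma orthonormal_nonzero: "orthonormal G l E \<Longrightarrow> i < l \<Longrightarrow> E i \<noteq> 0"
  unfolding orthonormal_def by (metis herm_zero(1) zero_neq_one)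

text \<open>Rank at least \<open>l\<close> at one point makes the maximal Gram determinant positive.
  The differential is then injective on the span of a maximising frame, and the curvature inequality
  there contradicts each of the four alternatives.\<close>

theorem rank_less:
  assumes compact: "compact (UNIV :: 'a set)" and l: "1 \<le> l" "l \<le> CARD('m)"
    and curvature: "scal_l_sign (\<lambda>t. t \<ge> 0) l A g \<and> ric1_sign (\<lambda>t. t < 0) l B h \<or>
       scal_l_sign (\<lambda>t. t > 0) l A g \<and> ric1_sign (\<lambda>t. t \<le> 0) l B h \<or>
       ric1_sign (\<lambda>t. t \<ge> 0) l A g \<and> scal_l_sign (\<lambda>t. t < 0) l B h \<or>
       ric1_sign (\<lambda>t. t > 0) l A g \<and> scal_l_sign (\<lambda>t. t \<le> 0) l B h"
    and c0: "c0 \<in> A" "d0 \<in> B" "z0 \<in> dom c0 d0"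
  shows "vec.dim (range (drep c0 d0 z0)) < l"
proof (rule ccontr)
  assume "\<not> ?thesis"
  then have rank: "l \<le> vec.dim (range (drep c0 d0 z0))" by simp
  have cont: "continuous_on T (\<lambda>x. Re (detn l (M x)))" if "\<And>i j. i < l \<Longrightarrow> j < l \<Longrightarrow> continuous_on T (\<lambda>x. M x i j)"
    for T :: "((complex^'m) \<times> (complex^'m^'m)) set" and M
    unfolding detn_leibniz
  proof (intro continuous_intros)
    fix p i assume "p \<in> {p. p permutes {..<l}}" "i \<in> {..<l}"
    then show "continuous_on T (\<lambda>x. M x i (p i))" using permutes_in_image[of p "{..<l}" i] by (intro that) auto
  qed
  obtain c d z E where cd: "c \<in> A" "d \<in> B" "z \<in> dom c d" and E: "orthonormal (g c z) l E"
    and max: "\<And>c' d' z' e. c' \<in> A \<Longrightarrow> d' \<in> B \<Longrightarrow> z' \<in> dom c' d' \<Longrightarrow> orthonormal (g c' z') l e \<Longrightarrow>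
       Re (detn l (\<lambda>i j. herm (form c' d' z') (e i) (e j))) \<le> Re (detn l (\<lambda>i j. herm (form c d z) (E i) (E j)))"
    using maximum_over_frames[OF compact l(2), of "\<lambda>M. Re (detn l M)"] cont detn_cong by (smt (verit, best))
  define K where "K = Re (detn l (\<lambda>i j. herm (form c d z) (E i) (E j)))"
  have "K > 0"
  proof -
    interpret L: local_map "g c0" "dom c0 d0" "h d0" "chart_image d0" "coord_rep c0 d0 f" by (rule local[OF c0(1,2)])
    let ?H = "h d0 (coord_rep c0 d0 f z0)"
    have H: "pos_herm ?H" by (rule metric_onD(3)[OF L.H L.FzV[OF c0(3)]])
    have T: "vec.subspace (range (L.DF z0))"
    proof (rule vec.subspaceI)
      show "0 \<in> range (L.DF z0)" using linear_0[OF L.DF_linear(1)[OF c0(3)]] by (metis rangeI)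
    qed (auto simp flip: L.DF_linear(2,3)[OF c0(3)])
    have "orthonormal ?H 0 undefined" by (simp add: orthonormal_def)
    \<comment> \<open>A unitary \<open>l\<close>-frame of the image has Gram determinant 1. Lifting
      it to M and comparing with a unitary frame there yields a positive value of the
      functional.\<close>
    from orthonormal_extend[OF H this T _ _ rank] obtain w where
      w: "orthonormal ?H l w" "\<forall>i<l. w i \<in> range (L.DF z0)" by auto
    then have "\<forall>i. \<exists>v. i < l \<longrightarrow> w i = L.DF z0 v" by blast
    from choice[OF this] obtain v where v: "\<And>i. i < l \<Longrightarrow> w i = L.DF z0 (v i)" by blast
    obtain x where x: "orthonormal (g c0 z0) l x" "\<And>i. i < l \<Longrightarrow> v i \<in> vec.span (x ` {..<l})"
      using orthonormal_spanning[OF metric_onD(3)[OF L.G c0(3)] l(2)] by blast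
    define X where "X i p = herm (g c0 z0) (v i) (x p)" for i p
    have "v i = (\<Sum>p<l. X i p *s x p)" if "i < l" for i
      unfolding X_def by (rule orthonormal_expand[OF x(1) x(2)[OF that]])
    then have "detn l (\<lambda>i j. herm (form c0 d0 z0) (v i) (v j))
      = of_real ((norm (detn l X))\<^sup>2) * detn l (\<lambda>i j. herm (form c0 d0 z0) (x i) (x j))"
      by (rule detn_gram_change)
    moreover have "detn l (\<lambda>i j. herm (form c0 d0 z0) (v i) (v j)) = detn l (\<lambda>i j. herm ?H (w i) (w j))"
      by (rule detn_cong) (simp add: form_def L.herm_pb[OF c0(3)] v)
    ultimately have "1 = of_real ((norm (detn l X))\<^sup>2) * detn l (\<lambda>i j. herm (form c0 d0 z0) (x i) (x j))"
      using detn_gram_orthonormal[OF w(1)] by simp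
    from arg_cong[OF this, of Re] have "1 = (norm (detn l X))\<^sup>2 * Re (detn l (\<lambda>i j. herm (form c0 d0 z0) (x i) (x j)))"
      by simp
    then have "0 < Re (detn l (\<lambda>i j. herm (form c0 d0 z0) (x i) (x j)))"
      using zero_less_mult_pos[of "(norm (detn l X))\<^sup>2"] by (cases "detn l X = 0") auto
    then show ?thesis unfolding K_def using max[OF c0 x(1)] by linarith
  qed
  interpret L: local_map "g c" "dom c d" "h d" "chart_image d" "coord_rep c d f" by (rule local[OF cd(1,2)])
  have pb: "form c d z' = L.pb z'" for z' by (simp add: form_def)
  have "cnj (detn l (\<lambda>i j. herm (L.pb z) (E i) (E j))) = detn l (\<lambda>i j. herm (L.pb z) (E i) (E j))"
    unfolding detn_cnj[symmetric] herm_cnj[OF L.hermitian_pb[OF cd(3)]]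
    by (rule detn_transpose[where M = "\<lambda>i j. herm (L.pb z) (E i) (E j)"])
  then have K: "detn l (\<lambda>i j. herm (L.pb z) (E i) (E j)) = of_real K"
    unfolding K_def pb by (simp add: complex_eq_iff)
  have "l \<le> CARD('n)"
    using rank vec.dim_subset[OF subset_UNIV, of "range (drep c0 d0 z0)"] unfolding vec_dim_card by simp
  from L.orthonormal_image_frame[OF cd(3) this E] K \<open>K > 0\<close> obtain e where
    e: "\<And>i. i < l \<Longrightarrow> e i \<in> vec.span (E ` {..<l})" "orthonormal (h d (coord_rep c d f z)) l (\<lambda>i. L.DF z (e i))"
    by (metis of_real_eq_0_iff order_less_irrefl)
  \<comment> \<open>Orthonormality for the pulled-back form gives the expansion of vectors of the
    span in \<open>e\<close>; it also shows that the differential has no kernel in that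
    span.\<close>
  have pe: "orthonormal (L.pb z) l e" using e(2) by (simp add: orthonormal_def L.herm_pb[OF cd(3)])
  have span: "vec.span (e ` {..<l}) = vec.span (E ` {..<l})"
    by (rule orthonormal_span_eq[OF pe vec.subspace_span]) (use e(1) orthonormal_dim[OF E] in auto)
  have expand: "x = (\<Sum>i<l. herm (L.pb z) x (e i) *s e i)" if "x \<in> vec.span (E ` {..<l})" for x
    by (rule orthonormal_expand[OF pe]) (use that span in simp)
  have Dspan: "L.DF z x \<in> vec.span ((\<lambda>i. L.DF z (e i)) ` {..<l})" if x: "x \<in> vec.span (E ` {..<l})" for x
  proof -
    have "L.DF z x = (\<Sum>i<l. herm (L.pb z) x (e i) *s L.DF z (e i))"
      by (subst expand[OF x]) (simp only: L.DF_linear(2,4)[OF cd(3)])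
    also have "\<dots> \<in> vec.span ((\<lambda>i. L.DF z (e i)) ` {..<l})"
      by (intro vec.span_sum vec.span_scale vec.span_base) auto
    finally show ?thesis .
  qed
  have Dinj: "L.DF z x \<noteq> 0" if x: "x \<in> vec.span (E ` {..<l})" "x \<noteq> 0" for x
  proof
    assume "L.DF z x = 0"
    then have "herm (L.pb z) x (e i) = 0" for i by (simp add: L.herm_pb[OF cd(3)] herm_zero)
    then show False using expand[OF x(1)] x(2) by simp
  qed
  have ineq: "(\<Sum>i<l. Re (curv_tensor (g c) z u u (E i) (E i)))
      \<le> (\<Sum>i<l. Re (curv_tensor (h d) (coord_rep c d f z) (L.DF z u) (L.DF z u) (L.DF z (e i)) (L.DF z (e i))))" for u
    by (rule L.determinant_maximum[OF l(2) cd(3) E K _ e]) (use max[OF cd(1,2)] in \<open>auto simp: K_def pb\<close>)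
  let ?s = "\<lambda>i. L.DF z (e i)" and ?y = "coord_rep c d f z"
  have z: "z \<in> chart_image c" using cd(3) by (auto simp: dom_def)
  have y: "?y \<in> chart_image d" by (rule L.FzV[OF cd(3)])
  have UE: "unitary_basis (g c z) l (vec.span (E ` {..<l})) E" by (rule orthonormal_unitary_basis[OF E])
  have US: "unitary_basis (h d ?y) l (vec.span (?s ` {..<l})) ?s" by (rule orthonormal_unitary_basis[OF e(2)])
  have ric: "Re (ric1 (g c) z l E u) \<le> Re (ric1 (h d) ?y l ?s (L.DF z u))" for u
    using ineq[of u] by (simp add: ric1_def)
  have E': "E j \<in> vec.span (E ` {..<l})" "E j \<noteq> 0" if "j < l" for j
    using that orthonormal_nonzero[OF E] by (auto intro: vec.span_base)
  have e': "e j \<noteq> 0" if "j < l" for j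
    using orthonormal_nonzero[OF e(2) that] linear_0[OF L.DF_linear(1)[OF cd(3)]] by auto
  have s: "(\<Sum>j<l. Re (ric1 (g c) z l E (E j))) = Re (scal_l (g c) z l E)"
    "(\<Sum>j<l. Re (ric1 (h d) ?y l ?s (?s j))) = Re (scal_l (h d) ?y l ?s)"
    by (simp_all add: scal_l_def ric1_def)
  \<comment> \<open>E is unitary for \<open>g\<close>, so summing over u = E j produces the scalar
    curvature of M. The images of e are unitary for \<open>h\<close>, so in the next fact summing
    over u = e j produces that of N.\<close>
  have 1: "Re (scal_l (g c) z l E) \<le> (\<Sum>j<l. Re (ric1 (h d) ?y l ?s (L.DF z (E j))))"
    unfolding s(1)[symmetric] by (intro sum_mono ric)
  have 2: "(\<Sum>j<l. Re (ric1 (g c) z l E (e j))) \<le> Re (scal_l (h d) ?y l ?s)"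
    unfolding s(2)[symmetric] by (intro sum_mono ric)
  have scalM: "P (Re (scal_l (g c) z l E))" if "scal_l_sign P l A g" for P
    using that UE cd(1) z unfolding scal_l_sign_def by blast
  have scalN: "P (Re (scal_l (h d) ?y l ?s))" if "scal_l_sign P l B h" for P
    using that US cd(2) y unfolding scal_l_sign_def by blast
  have ricM: "P (Re (ric1 (g c) z l E (e j)))" if "ric1_sign P l A g" "j < l" for P j
    using that UE cd(1) z e(1)[OF that(2)] e'[OF that(2)] unfolding ric1_sign_def by blast
  have ricN: "P (Re (ric1 (h d) ?y l ?s (L.DF z (E j))))" if "ric1_sign P l B h" "j < l" for P j
    using that US cd(2) y Dspan[OF E'(1)[OF that(2)]] Dinj[OF E'[OF that(2)]] unfolding ric1_sign_def by blast
  have ne: "{..<l} \<noteq> {}" using l by (auto simp: lessThan_empty_iff)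
  from curvature show False
  proof (elim disjE conjE)
    assume a: "scal_l_sign (\<lambda>t. t \<ge> 0) l A g" "ric1_sign (\<lambda>t. t < 0) l B h"
    have "(\<Sum>j<l. Re (ric1 (h d) ?y l ?s (L.DF z (E j)))) < (\<Sum>j<l. 0)"
      by (rule sum_strict_mono) (use ne ricN[OF a(2)] in auto)
    then show False using 1 scalM[OF a(1)] by simp
  next
    assume a: "scal_l_sign (\<lambda>t. t > 0) l A g" "ric1_sign (\<lambda>t. t \<le> 0) l B h"
    have "(\<Sum>j<l. Re (ric1 (h d) ?y l ?s (L.DF z (E j)))) \<le> 0"
      by (rule sum_nonpos) (use ricN[OF a(2)] in auto)
    then show False using 1 scalM[OF a(1)] by simp
  next
    assume a: "ric1_sign (\<lambda>t. t \<ge> 0) l A g" "scal_l_sign (\<lambda>t. t < 0) l B h"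
    have "(\<Sum>j<l. Re (ric1 (g c) z l E (e j))) \<ge> 0"
      by (rule sum_nonneg) (use ricM[OF a(1)] in auto)
    then show False using 2 scalN[OF a(2)] by simp
  next
    assume a: "ric1_sign (\<lambda>t. t > 0) l A g" "scal_l_sign (\<lambda>t. t \<le> 0) l B h"
    have "(\<Sum>j<l. 0) < (\<Sum>j<l. Re (ric1 (g c) z l E (e j)))"
      by (rule sum_strict_mono) (use ne ricM[OF a(1)] in auto)
    then show False using 2 scalN[OF a(2)] by simp
  qed
qed

section \<open>Maps with vanishing differential\<close>

lemma constant_if_derivative_zero:
  assumes conn: "connected (UNIV :: 'a set)"
    and zero: "\<And>c d z v. c \<in> A \<Longrightarrow> d \<in> B \<Longrightarrow> z \<in> dom c d \<Longrightarrow> drep c d z v = 0"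
  shows "f constant_on UNIV"
proof -
  have "\<forall>\<^sub>F q in at p within UNIV. f p = f q" for p
  proof -
    obtain c d where cd: "c \<in> A" "d \<in> B" "p \<in> fst c" "f p \<in> fst d" using charts_cover by blast
    interpret L: local_map "g c" "dom c d" "h d" "chart_image d" "coord_rep c d f" by (rule local[OF cd(1,2)])
    have "snd c p \<in> dom c d" using cd by (auto simp: dom_def)
    then obtain r where r: "r > 0" "ball (snd c p) r \<subseteq> dom c d" using L.open_U openE by blast
    have der: "(coord_rep c d f has_derivative (\<lambda>_. 0)) (at z within ball (snd c p) r)" if "z \<in> ball (snd c p) r" for z
    proof -
      have "z \<in> dom c d" using that r by blast
      then show ?thesis
        using holo_on_derivative(1)[OF L.F] zero[OF cd(1,2)] by (metis (no_types, lifting) ext has_derivative_at_withinI)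
    qed
    define W where "W = fst c \<inter> snd c -` ball (snd c p) r"
    have W: "open W" "p \<in> W" unfolding W_def
      using is_chartD[OF chart(1)[OF cd(1)]] cd(3) r(1) by (auto intro: continuous_open_preimage)
    have W_const: "f q = f p" if q: "q \<in> W" for q
    proof -
      have "coord_rep c d f (snd c q) = coord_rep c d f (snd c p)"
      proof (rule has_derivative_zero_unique[where s = "ball (snd c p) r" and f = "coord_rep c d f", OF convex_ball])
        show "snd c q \<in> ball (snd c p) r" "snd c p \<in> ball (snd c p) r" using q r by (auto simp: W_def)
      qed (rule der)
      then have eq: "snd d (f q) = snd d (f p)"
        using is_chartD(4)[OF chart(1)[OF cd(1)]] q cd(3) by (simp add: coord_rep_def W_def)
      have "snd c q \<in> dom c d" using q r by (auto simp: W_def)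
      from dom_point(2)[OF cd(1) this] have "f q \<in> fst d"
        using is_chartD(4)[OF chart(1)[OF cd(1)]] q by (simp add: W_def)
      then show ?thesis using eq is_chartD(4)[OF chart(2)[OF cd(2)]] cd(4) by metis
    qed
    then show ?thesis unfolding eventually_at_topological
      by (intro exI[of _ W] conjI ballI impI W) (simp add: W_const)
  qed
  then have "f x = f y" for x y
    by (intro connected_local_const[OF conn]) auto
  then show ?thesis unfolding constant_on_def by blast
qed

end

lemma curv_tensor_zero: "curv_tensor G z 0 0 w x = 0" "curv_tensor G z u v 0 0 = 0"
  by (simp_all add: curv_tensor_def)

lemma curv_tensor_scale:
  "curv_tensor G z (of_real a *s u) (of_real a *s u) (of_real b *s w) (of_real b *s w) = of_real (a\<^sup>2 * b\<^sup>2) * curv_tensor G z u u w w"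
  by (simp add: curv_tensor_def sum_distrib_left power2_eq_square mult_ac)

text \<open>The unitary frame consists of the normalised nonzero \<open>s i\<close>, completed
  arbitrarily, and the weights are the squared lengths: R is quadratic in the length of each pair of
  arguments, so R(s i, s i, s j, s j) carries exactly the factor \<open>a i * a j\<close>.\<close>

lemma real_bisectional_orthogonal:
  fixes s :: "nat \<Rightarrow> complex^'n::finite"
  assumes H: "pos_herm (H y)" and l: "l \<le> CARD('n)"
    and orth: "\<And>i j. i < l \<Longrightarrow> j < l \<Longrightarrow> i \<noteq> j \<Longrightarrow> herm (H y) (s i) (s j) = 0"
    and nz: "k < l" "s k \<noteq> 0"
  obtains e :: "'n \<Rightarrow> complex^'n" and a where "\<And>i j. herm (H y) (e i) (e j) = (if i = j then 1 else 0)"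
    "\<And>i. a i \<ge> 0" "(\<Sum>i\<in>UNIV. (a i)\<^sup>2) > 0"
    "Re (real_bisectional H y e a) * (\<Sum>i\<in>UNIV. (a i)\<^sup>2) = (\<Sum>i<l. \<Sum>j<l. Re (curv_tensor H y (s i) (s i) (s j) (s j)))"
proof -
  \<comment> \<open>Zero vectors cannot be normalised; their curvature terms vanish, so they are
    left out here and put back at the end by \<open>toI\<close>.\<close>
  define I where "I = {i. i < l \<and> s i \<noteq> 0}"
  define m where "m = card I"
  have I: "finite I" "I \<subseteq> {..<l}" "k \<in> I" using nz by (auto simp: I_def)
  have ml: "m \<le> CARD('n)" using card_mono[OF _ I(2)] l by (simp add: m_def)
  have m0: "m > 0" using I by (auto simp: m_def card_gt_0_iff)
  obtain \<sigma> where \<sigma>: "bij_betw \<sigma> {0..<m} I" using ex_bij_betw_nat_finite[OF I(1)] by (auto simp: m_def)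
  have \<sigma>I: "\<sigma> j \<in> I" if "j < m" for j using \<sigma> that by (auto simp: bij_betw_def)
  have \<sigma>inj: "\<sigma> i = \<sigma> j \<longleftrightarrow> i = j" if "i < m" "j < m" for i j
    using \<sigma> that by (auto simp: bij_betw_def inj_on_def)
  define \<Lambda> where "\<Lambda> i = Re (herm (H y) (s i) (s i))" for i
  have \<Lambda>: "\<Lambda> i > 0" if "i \<in> I" for i unfolding \<Lambda>_def using that by (intro pos_hermD(2)[OF H]) (simp add: I_def)
  have h\<Lambda>: "herm (H y) (s i) (s i) = of_real (\<Lambda> i)" for i
    unfolding \<Lambda>_def by (rule herm_real[OF pos_hermD(1)[OF H]])
  define \<epsilon> where "\<epsilon> j = of_real (1 / sqrt (\<Lambda> (\<sigma> j))) *s s (\<sigma> j)" for j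
  have s\<epsilon>: "s (\<sigma> j) = of_real (sqrt (\<Lambda> (\<sigma> j))) *s \<epsilon> j" if "j < m" for j
    using \<Lambda>[OF \<sigma>I[OF that]] by (simp add: \<epsilon>_def vector_smult_assoc)
  have "orthonormal (H y) m \<epsilon>" unfolding orthonormal_def
  proof (intro allI impI)
    fix i j assume ij: "i < m" "j < m"
    show "herm (H y) (\<epsilon> i) (\<epsilon> j) = (if i = j then 1 else 0)"
    proof (cases "i = j")
      case True
      have "1 / sqrt x * (1 / sqrt x * x) = 1" if "x > 0" for x :: real using that by (simp add: field_simps)
      from this[OF \<Lambda>[OF \<sigma>I[OF ij(1)]]]
      have "complex_of_real (1 / sqrt (\<Lambda> (\<sigma> i)) * (1 / sqrt (\<Lambda> (\<sigma> i)) * \<Lambda> (\<sigma> i))) = 1" by (simp only: of_real_1)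
      then show ?thesis unfolding True[symmetric] \<epsilon>_def herm_scale_left herm_scale_right h\<Lambda> complex_cnj_complex_of_real
        by (simp only: of_real_mult simp_thms if_True)
    next
      case False
      then have "herm (H y) (s (\<sigma> i)) (s (\<sigma> j)) = 0"
        using \<sigma>I[OF ij(1)] \<sigma>I[OF ij(2)] \<sigma>inj[OF ij] I(2) by (intro orth) auto
      then show ?thesis using False by (simp add: \<epsilon>_def herm_scale_left herm_scale_right)
    qed
  qed
  from orthonormal_UNIV[OF this H ml order_refl] obtain w where
    w: "orthonormal (H y) CARD('n) w" "\<forall>i<m. w i = \<epsilon> i" by blast
  obtain \<iota> :: "nat \<Rightarrow> 'n" and \<kappa> where \<iota>: "bij_betw \<iota> {..<CARD('n)} UNIV"
    and \<kappa>\<iota>: "\<And>j. j < CARD('n) \<Longrightarrow> \<kappa> (\<iota> j) = j" and \<kappa>: "\<And>i. \<kappa> i < CARD('n)" "\<And>i. \<iota> (\<kappa> i) = i"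
    by (rule finite_type_enumeration) blast
  define e where "e i = w (\<kappa> i)" for i
  \<comment> \<open>Weight 0 on the vectors that only complete the frame.\<close>
  define b where "b j = (if j < m then \<Lambda> (\<sigma> j) else 0)" for j
  define a where "a i = b (\<kappa> i)" for i
  have reindex: "(\<Sum>i\<in>UNIV. F (\<kappa> i)) = (\<Sum>j<CARD('n). F j)" for F :: "nat \<Rightarrow> real"
    using sum.reindex_bij_betw[OF \<iota>, of "\<lambda>i. F (\<kappa> i)"] \<kappa>\<iota> by simp
  have cut: "(\<Sum>j<CARD('n). F j) = (\<Sum>j<m. F j)" if "\<And>j. j \<ge> m \<Longrightarrow> F j = 0" for F :: "nat \<Rightarrow> real"
    using that ml by (intro sum.mono_neutral_right) auto
  have toI: "(\<Sum>j<m. F (\<sigma> j)) = (\<Sum>i<l. F i)" if "\<And>i. i < l \<Longrightarrow> s i = 0 \<Longrightarrow> F i = 0" for F :: "nat \<Rightarrow> real"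
  proof -
    have "(\<Sum>j<m. F (\<sigma> j)) = (\<Sum>i\<in>I. F i)"
      using sum.reindex_bij_betw[OF \<sigma>, of F] by (simp add: atLeast0LessThan)
    also have "\<dots> = (\<Sum>i<l. F i)" using that I by (intro sum.mono_neutral_left) (auto simp: I_def)
    finally show ?thesis .
  qed
  show ?thesis
  proof (rule that)
    show "herm (H y) (e i) (e j) = (if i = j then 1 else 0)" for i j
    proof -
      have "\<kappa> i = \<kappa> j \<longleftrightarrow> i = j" using \<kappa>(2) by metis
      then show ?thesis using w(1) \<kappa>(1) by (simp add: e_def orthonormal_def)
    qed
    show "a i \<ge> 0" for i using \<Lambda>[OF \<sigma>I] by (simp add: a_def b_def less_imp_le)
    have "a (\<iota> 0) > 0" using \<Lambda>[OF \<sigma>I[OF m0]] m0 ml by (simp add: a_def b_def \<kappa>\<iota>)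
    then show pos: "(\<Sum>i\<in>UNIV. (a i)\<^sup>2) > 0"
      by (intro sum_pos2[of _ "\<iota> 0"]) auto
    let ?R = "\<lambda>u v. Re (curv_tensor H y u u v v)"
    have "Re (real_bisectional H y e a) = (\<Sum>i\<in>UNIV. \<Sum>j\<in>UNIV. ?R (e i) (e j) * (a i * a j)) / (\<Sum>i\<in>UNIV. (a i)\<^sup>2)"
      unfolding real_bisectional_def Re_divide_of_real by (simp flip: of_real_mult)
    then have "Re (real_bisectional H y e a) * (\<Sum>i\<in>UNIV. (a i)\<^sup>2) = (\<Sum>i\<in>UNIV. \<Sum>j\<in>UNIV. ?R (e i) (e j) * (a i * a j))"
      using pos by simp
    also have "\<dots> = (\<Sum>i<CARD('n). \<Sum>j<CARD('n). ?R (w i) (w j) * (b i * b j))"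
      unfolding e_def a_def by (simp only: reindex[of "\<lambda>j. ?R (w _) (w j) * (b _ * b j)"] reindex[of "\<lambda>i. \<Sum>j<CARD('n). ?R (w i) (w j) * (b i * b j)"])
    also have "\<dots> = (\<Sum>i<m. \<Sum>j<m. ?R (w i) (w j) * (b i * b j))"
      by (subst cut, simp add: b_def, rule sum.cong[OF refl], rule cut, simp add: b_def)
    also have "\<dots> = (\<Sum>i<m. \<Sum>j<m. ?R (s (\<sigma> i)) (s (\<sigma> j)))"
    proof (intro sum.cong refl)
      fix i j assume "i \<in> {..<m}" "j \<in> {..<m}"
      then have ij: "i < m" "j < m" by auto
      have "?R (s (\<sigma> i)) (s (\<sigma> j)) = ((sqrt (\<Lambda> (\<sigma> i)))\<^sup>2 * (sqrt (\<Lambda> (\<sigma> j)))\<^sup>2) * ?R (\<epsilon> i) (\<epsilon> j)"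
        by (subst s\<epsilon>[OF ij(1)], subst s\<epsilon>[OF ij(1)], subst s\<epsilon>[OF ij(2)], subst s\<epsilon>[OF ij(2)], subst curv_tensor_scale) simp
      then show "?R (w i) (w j) * (b i * b j) = ?R (s (\<sigma> i)) (s (\<sigma> j))"
        using \<Lambda>[OF \<sigma>I[OF ij(1)]] \<Lambda>[OF \<sigma>I[OF ij(2)]] w(2) ij by (simp add: b_def)
    qed
    also have "\<dots> = (\<Sum>i<m. \<Sum>j<l. ?R (s (\<sigma> i)) (s j))"
      by (rule sum.cong[OF refl], rule toI) (simp add: curv_tensor_zero)
    also have "\<dots> = (\<Sum>i<l. \<Sum>j<l. ?R (s i) (s j))"
      by (rule toI) (simp add: curv_tensor_zero)
    finally show "Re (real_bisectional H y e a) * (\<Sum>i\<in>UNIV. (a i)\<^sup>2) = (\<Sum>i<l. \<Sum>j<l. ?R (s i) (s j))" .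
  qed
qed

context holomorphic_setting
begin

text \<open>If some differential is nonzero, the maximal trace K is positive. The bound on
  \<open>l\<close> by the dimension of N leaves room for the images of the diagonalising frame
  inside one unitary frame of N.\<close>

theorem constant_map:
  assumes compact: "compact (UNIV :: 'a set)" and conn: "connected (UNIV :: 'a set)"
    and l: "1 \<le> l" "l \<le> CARD('m)" "l \<le> CARD('n)"
    and curvature: "ric2_sign (\<lambda>t. t > 0) l A g \<and> real_bisectional_sign (\<lambda>t. t \<le> 0) B h \<or>
       ric2_sign (\<lambda>t. t \<ge> 0) l A g \<and> real_bisectional_sign (\<lambda>t. t < 0) B h"
  shows "f constant_on UNIV"
proof (rule constant_if_derivative_zero[OF conn], rule ccontr)
  fix c0 d0 z0 v0
  assume c0: "c0 \<in> A" "d0 \<in> B" "z0 \<in> dom c0 d0" and v0: "drep c0 d0 z0 v0 \<noteq> 0"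
  have cont: "continuous_on T (\<lambda>x. Re (\<Sum>i<l. M x i i))" if "\<And>i j. i < l \<Longrightarrow> j < l \<Longrightarrow> continuous_on T (\<lambda>x. M x i j)"
    for T :: "((complex^'m) \<times> (complex^'m^'m)) set" and M
    by (intro continuous_intros that) auto
  obtain c d z E0 where cd: "c \<in> A" "d \<in> B" "z \<in> dom c d" and E0: "orthonormal (g c z) l E0"
    and max: "\<And>c' d' z' e. c' \<in> A \<Longrightarrow> d' \<in> B \<Longrightarrow> z' \<in> dom c' d' \<Longrightarrow> orthonormal (g c' z') l e \<Longrightarrow>
       Re (\<Sum>i<l. herm (form c' d' z') (e i) (e i)) \<le> Re (\<Sum>i<l. herm (form c d z) (E0 i) (E0 i))"
    using maximum_over_frames[OF compact l(2), of "\<lambda>M. Re (\<Sum>i<l. M i i)"] cont by (smt (verit, best) lessThan_iff sum.cong)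
  define K where "K = Re (\<Sum>i<l. herm (form c d z) (E0 i) (E0 i))"
  have "K > 0"
  proof -
    interpret L: local_map "g c0" "dom c0 d0" "h d0" "chart_image d0" "coord_rep c0 d0 f" by (rule local[OF c0(1,2)])
    have pos: "pos_herm (g c0 z0)" by (rule metric_onD(3)[OF L.G c0(3)])
    obtain x where x: "orthonormal (g c0 z0) l x" and "\<forall>i<l. v0 \<in> vec.span (x ` {..<l})"
      using orthonormal_spanning[OF pos l(2), of "\<lambda>_. v0"] by blast
    then have xv: "v0 \<in> vec.span (x ` {..<l})" using l(1) by (auto dest: spec[of _ 0])
    have "\<exists>i<l. L.DF z0 (x i) \<noteq> 0"
    proof (rule ccontr)
      assume "\<not> ?thesis"
      then have "L.DF z0 (\<Sum>i<l. herm (g c0 z0) v0 (x i) *s x i) = 0"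
        by (simp add: L.DF_linear(2,4)[OF c0(3)])
      then show False using orthonormal_expand[OF x xv] v0 by simp
    qed
    then obtain i where i: "i < l" "L.DF z0 (x i) \<noteq> 0" by blast
    have "0 < Re (herm (L.pb z0) (x i) (x i))"
      unfolding L.herm_pb[OF c0(3)] by (rule pos_hermD(2)[OF metric_onD(3)[OF L.H L.FzV[OF c0(3)]] i(2)])
    also have "\<dots> \<le> (\<Sum>i<l. Re (herm (L.pb z0) (x i) (x i)))"
      using i(1) by (intro member_le_sum L.pb_nonneg c0) auto
    also have "\<dots> \<le> K" using max[OF c0 x] by (simp add: K_def form_def)
    finally show ?thesis .
  qed
  interpret L: local_map "g c" "dom c d" "h d" "chart_image d" "coord_rep c d f" by (rule local[OF cd(1,2)])
  have pb: "form c d z' = L.pb z'" for z' by (simp add: form_def)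
  have pos: "pos_herm (g c z)" by (rule metric_onD(3)[OF L.G cd(3)])
  \<comment> \<open>The maximiser \<open>E0\<close> need not diagonalise the pulled-back form.
    Another unitary basis of the same span does, and it has the same trace, so it is a maximiser as
    well.\<close>
  obtain E where E: "orthonormal (g c z) l E" "\<And>i. i < l \<Longrightarrow> E i \<in> vec.span (E0 ` {..<l})"
    and diag: "\<And>i j. i < l \<Longrightarrow> j < l \<Longrightarrow> i \<noteq> j \<Longrightarrow> herm (L.pb z) (E i) (E j) = 0"
    using orthonormal_diagonalise[OF pos L.hermitian_pb[OF cd(3)] E0] by blast
  have span: "vec.span (E ` {..<l}) = vec.span (E0 ` {..<l})"
    by (rule orthonormal_span_eq[OF E(1) vec.subspace_span]) (use E(2) orthonormal_dim[OF E0] in auto)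
  have K: "K = (\<Sum>i<l. Re (herm (L.pb z) (E i) (E i)))"
  proof -
    have 1: "E0 i = (\<Sum>p<l. herm (g c z) (E0 i) (E p) *s E p)" if "i < l" for i
      by (rule orthonormal_expand[OF E(1)]) (use that span in \<open>auto intro: vec.span_base\<close>)
    have 2: "E p = (\<Sum>i<l. herm (g c z) (E p) (E0 i) *s E0 i)" if "p < l" for p
      by (rule orthonormal_expand[OF E0 E(2)[OF that]])
    have "(\<Sum>i<l. herm (L.pb z) (E0 i) (E0 i)) = (\<Sum>i<l. \<Sum>p<l. herm (g c z) (E0 i) (E p) * herm (L.pb z) (E p) (E0 i))"
    proof (rule sum.cong[OF refl])
      fix i assume "i \<in> {..<l}"
      then have "herm (L.pb z) (E0 i) (E0 i) = herm (L.pb z) (\<Sum>p<l. herm (g c z) (E0 i) (E p) *s E p) (E0 i)"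
        using 1 by simp
      then show "herm (L.pb z) (E0 i) (E0 i) = (\<Sum>p<l. herm (g c z) (E0 i) (E p) * herm (L.pb z) (E p) (E0 i))"
        by (simp add: herm_sum_left herm_scale_left)
    qed
    also have "\<dots> = (\<Sum>p<l. \<Sum>i<l. herm (g c z) (E0 i) (E p) * herm (L.pb z) (E p) (E0 i))" by (rule sum.swap)
    also have "\<dots> = (\<Sum>p<l. herm (L.pb z) (E p) (E p))"
    proof (rule sum.cong[OF refl])
      fix p assume "p \<in> {..<l}"
      then have "herm (L.pb z) (E p) (E p) = herm (L.pb z) (E p) (\<Sum>i<l. herm (g c z) (E p) (E0 i) *s E0 i)"
        using 2 by simp
      then show "(\<Sum>i<l. herm (g c z) (E0 i) (E p) * herm (L.pb z) (E p) (E0 i)) = herm (L.pb z) (E p) (E p)"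
        by (simp add: herm_sum_right herm_scale_right herm_cnj[OF pos_hermD(1)[OF pos]])
    qed
    finally show ?thesis by (simp add: K_def pb)
  qed
  define \<Lambda> where "\<Lambda> i = Re (herm (L.pb z) (E i) (E i))" for i
  have \<Lambda>: "\<Lambda> i \<ge> 0" for i unfolding \<Lambda>_def by (rule L.pb_nonneg[OF cd(3)])
  \<comment> \<open>The eigenvalues sum to K > 0. A positive one makes the weighted Ricci sum
    strictly positive in the first case and provides the nonzero image vector needed for the
    bisectional curvature.\<close>
  obtain k where k: "k < l" "\<Lambda> k > 0"
    using \<open>K > 0\<close> sum_nonpos[of "{..<l}" \<Lambda>] unfolding K \<Lambda>_def[symmetric] by (meson lessThan_iff not_le)
  let ?s = "\<lambda>i. L.DF z (E i)" and ?y = "coord_rep c d f z"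
  have sk: "?s k \<noteq> 0" using k(2) by (auto simp: \<Lambda>_def L.herm_pb[OF cd(3)] herm_zero)
  have H: "pos_herm (h d ?y)" by (rule metric_onD(3)[OF L.H L.FzV[OF cd(3)]])
  have "(\<Sum>i<l. \<Lambda> i * Re (curv_tensor (g c) z u u (E i) (E i))) \<le> (\<Sum>i<l. Re (curv_tensor (h d) ?y (L.DF z u) (L.DF z u) (?s i) (?s i)))" for u
    unfolding \<Lambda>_def
    by (rule L.trace_maximum[OF l(2) cd(3) E(1) diag K]) (use max[OF cd(1,2)] in \<open>auto simp: K_def pb\<close>)
  \<comment> \<open>Taking u = E a and summing over a fills the first pair of slots: second Ricci
    curvature on the side of M, and the double curvature sum of the orthogonal images on the side of
    N.\<close>
  then have "(\<Sum>a<l. \<Sum>i<l. \<Lambda> i * Re (curv_tensor (g c) z (E a) (E a) (E i) (E i)))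
      \<le> (\<Sum>a<l. \<Sum>i<l. Re (curv_tensor (h d) ?y (?s a) (?s a) (?s i) (?s i)))"
    by (rule sum_mono)
  also have "(\<Sum>a<l. \<Sum>i<l. \<Lambda> i * Re (curv_tensor (g c) z (E a) (E a) (E i) (E i))) = (\<Sum>i<l. \<Lambda> i * Re (ric2 (g c) z l E (E i)))"
    by (subst sum.swap) (simp add: ric2_def sum_distrib_left)
  finally have ineq: "(\<Sum>i<l. \<Lambda> i * Re (ric2 (g c) z l E (E i))) \<le> (\<Sum>a<l. \<Sum>i<l. Re (curv_tensor (h d) ?y (?s a) (?s a) (?s i) (?s i)))" .
  obtain e :: "'n \<Rightarrow> complex^'n" and a where ea: "\<And>i j. herm (h d ?y) (e i) (e j) = (if i = j then 1 else 0)"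
    "\<And>i. a i \<ge> 0" "(\<Sum>i\<in>UNIV. (a i)\<^sup>2) > 0"
    "Re (real_bisectional (h d) ?y e a) * (\<Sum>i\<in>UNIV. (a i)\<^sup>2) = (\<Sum>i<l. \<Sum>j<l. Re (curv_tensor (h d) ?y (?s i) (?s i) (?s j) (?s j)))"
    by (rule real_bisectional_orthogonal[of "h d" ?y l ?s k, OF H l(3) _ k(1) sk]) (use diag in \<open>auto simp: L.herm_pb[OF cd(3)]\<close>)
  have z: "z \<in> chart_image c" using cd(3) by (auto simp: dom_def)
  have ricM: "P (Re (ric2 (g c) z l E (E i)))" if "ric2_sign P l A g" "i < l" for P i
    using that orthonormal_unitary_basis[OF E(1)] cd(1) z orthonormal_nonzero[OF E(1) that(2)] vec.span_base[of "E i" "E ` {..<l}"]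
    unfolding ric2_sign_def by blast
  have bisN: "P (Re (real_bisectional (h d) ?y e a))" if "real_bisectional_sign P B h" for P
    using that ea(1-3) cd(2) L.FzV[OF cd(3)] unfolding real_bisectional_sign_def by blast
  from curvature show False
  proof (elim disjE conjE)
    assume as: "ric2_sign (\<lambda>t. t > 0) l A g" "real_bisectional_sign (\<lambda>t. t \<le> 0) B h"
    have "0 < (\<Sum>i<l. \<Lambda> i * Re (ric2 (g c) z l E (E i)))"
      using k ricM[OF as(1)] \<Lambda> by (intro sum_pos2[of _ k]) (auto intro: mult_nonneg_nonneg less_imp_le)
    moreover have "Re (real_bisectional (h d) ?y e a) * (\<Sum>i\<in>UNIV. (a i)\<^sup>2) \<le> 0"
      using bisN[OF as(2)] ea(3) by (simp add: mult_nonpos_nonneg)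
    ultimately show False using ineq ea(4) by linarith
  next
    assume as: "ric2_sign (\<lambda>t. t \<ge> 0) l A g" "real_bisectional_sign (\<lambda>t. t < 0) B h"
    have "0 \<le> (\<Sum>i<l. \<Lambda> i * Re (ric2 (g c) z l E (E i)))"
      using ricM[OF as(1)] \<Lambda> by (intro sum_nonneg mult_nonneg_nonneg) auto
    moreover have "Re (real_bisectional (h d) ?y e a) * (\<Sum>i\<in>UNIV. (a i)\<^sup>2) < 0"
      using bisN[OF as(2)] ea(3) by (simp add: mult_neg_pos)
    ultimately show False using ineq ea(4) by linarith
  qed
qed

end

section \<open>Degenerate maps\<close>

text \<open>Sard's theorem for equal dimensions, carried over from real coordinate space by a
  real-linear isomorphism p with inverse q.\<close>

lemma negligible_singular_image:
  fixes \<Theta> :: "complex^'m::finite \<Rightarrow> complex^'m"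
  assumes der: "\<And>z. z \<in> S \<Longrightarrow> (\<Theta> has_derivative D z) (at z)" and sing: "\<And>z. z \<in> S \<Longrightarrow> \<not> surj (D z)"
  shows "negligible (\<Theta> ` S)"
proof -
  \<comment> \<open>The type 'm bit0 has twice as many elements as 'm, which is the real dimension
    of complex^'m.\<close>
  have "DIM(real^('m bit0)) = DIM(complex^'m)" by simp
  then obtain p :: "real^('m bit0) \<Rightarrow> complex^'m" and q where pq: "linear p" "linear q" "\<And>x. q (p x) = x" "\<And>y. p (q y) = y"
    using isomorphisms_UNIV_UNIV by metis
  have "negligible ((\<lambda>x. q (\<Theta> (p x))) ` (q ` S))"
  proof (rule baby_Sard)
    fix x assume "x \<in> q ` S"
    then have x: "p x \<in> S" using pq by auto
    have p': "(p has_derivative p) (at x)" and q': "(q has_derivative q) (at (\<Theta> (p x)))"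
      using pq linear_imp_has_derivative by auto
    have d: "((\<lambda>x. q (\<Theta> (p x))) has_derivative (\<lambda>v. q (D (p x) (p v)))) (at x)"
      by (rule has_derivative_compose[OF has_derivative_compose[OF p' der[OF x]] q'])
    then show "((\<lambda>x. q (\<Theta> (p x))) has_derivative (\<lambda>v. q (D (p x) (p v)))) (at x within q ` S)"
      by (rule has_derivative_at_withinI)
    have lin: "linear (\<lambda>v. q (D (p x) (p v)))" using d by (rule has_derivative_linear)
    have "\<not> surj (\<lambda>v. q (D (p x) (p v)))"
    proof
      assume s: "surj (\<lambda>v. q (D (p x) (p v)))"
      have "y \<in> range (D (p x))" for y
      proof -
        have "q y \<in> range (\<lambda>v. q (D (p x) (p v)))" unfolding s by simp
        then obtain v where "q y = q (D (p x) (p v))" by blast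
        then have "y = D (p x) (p v)" using pq(4) by metis
        then show ?thesis by blast
      qed
      then show False using sing[OF x] by blast
    qed
    then have "\<not> inj (\<lambda>v. q (D (p x) (p v)))" using linear_injective_imp_surjective[OF lin] by blast
    then show "rank (matrix (\<lambda>v. q (D (p x) (p v)))) < CARD('m bit0)"
      unfolding less_rank_noninjective matrix_works[OF lin[folded linear_matrix_vector_mul_eq]] by (simp add: matrix_works lin)
  qed simp
  then have "negligible (p ` ((\<lambda>x. q (\<Theta> (p x))) ` (q ` S)))"
    by (rule negligible_differentiable_image_negligible[rotated])
       (use pq(1) in \<open>auto intro!: linear_imp_differentiable_on\<close>)
  moreover have "p ` ((\<lambda>x. q (\<Theta> (p x))) ` (q ` S)) = \<Theta> ` S"
    by (simp add: image_image pq)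
  ultimately show ?thesis by simp
qed

lemma dim_image_le:
  fixes L :: "complex^'n::finite \<Rightarrow> complex^'m::finite"
  assumes L: "linear L" "\<And>c v. L (c *s v) = c *s L v"
  shows "vec.dim (L ` T) \<le> vec.dim T"
proof -
  obtain b where b: "b \<subseteq> T" "vec.independent b" "T \<subseteq> vec.span b" "card b = vec.dim T"
    using vec.basis_exists[of T] by blast
  have fin: "finite b" using b(2) by (rule vec.finiteI_independent)
  have "vec.span b \<subseteq> {x. L x \<in> vec.span (L ` b)}"
  proof (rule vec.span_minimal)
    show "b \<subseteq> {x. L x \<in> vec.span (L ` b)}" by (auto intro: vec.span_base)
    show "vec.subspace {x. L x \<in> vec.span (L ` b)}"
      by (rule vec.subspaceI) (auto simp: linear_0[OF L(1)] linear_add[OF L(1)] L(2) vec.span_zero intro: vec.span_add vec.span_scale)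
  qed
  then have "L ` T \<subseteq> vec.span (L ` b)" using b(3) by blast
  then have "vec.dim (L ` T) \<le> card (L ` b)" by (rule vec.dim_le_card) (simp add: fin)
  also have "\<dots> \<le> card b" by (rule card_image_le[OF fin])
  finally show ?thesis using b(4) by simp
qed

lemma pos_herm_identity: "pos_herm (Finite_Cartesian_Product.mat 1 :: complex^'n::finite^'n)"
proof -
  let ?I = "Finite_Cartesian_Product.mat 1 :: complex^'n^'n"
  have "herm ?I v v = (\<Sum>k\<in>UNIV. of_real ((norm (v $ k))\<^sup>2))" for v
  proof -
    have "herm ?I v v = (\<Sum>k\<in>UNIV. \<Sum>l\<in>UNIV. if k = l then v $ k * cnj (v $ l) else 0)"
      unfolding herm_def by (intro sum.cong refl) (simp add: Finite_Cartesian_Product.mat_def)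
    then have "herm ?I v v = (\<Sum>k\<in>UNIV. v $ k * cnj (v $ k))" by simp
    then show ?thesis by (simp only: complex_norm_square)
  qed
  moreover have "(\<Sum>k\<in>UNIV. (norm (v $ k))\<^sup>2) > 0" if v: "v \<noteq> 0" for v :: "complex^'n"
  proof -
    obtain k where "v $ k \<noteq> 0" using v by (metis vec_eq_iff zero_index)
    then show ?thesis by (intro sum_pos2[of _ k]) auto
  qed
  moreover have "hermitian_mat ?I" by (auto simp: hermitian_mat_def Finite_Cartesian_Product.mat_def)
  ultimately show ?thesis by (simp add: pos_herm_def)
qed

context holomorphic_setting
begin

lemma map_rank_less:
  assumes "\<And>c d z. c \<in> A \<Longrightarrow> d \<in> B \<Longrightarrow> z \<in> dom c d \<Longrightarrow> vec.dim (range (drep c d z)) < l"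
  shows "map_rank A B f < l"
proof -
  let ?R = "{vec.dim (range (frechet_derivative (coord_rep c d f) (at (snd c p)))) | c d p. c \<in> A \<and> d \<in> B \<and> p \<in> fst c \<and> f p \<in> fst d}"
  have "?R \<subseteq> {..<l}" using assms by (auto simp: dom_def)
  moreover have "?R \<noteq> {}" using charts_cover by blast
  ultimately show ?thesis unfolding map_rank_def
    using Max_in[of ?R] finite_subset[of ?R "{..<l}"] by blast
qed

text \<open>A regular point of dimension at least m would make a projection of f(M) cover an open
  subset of complex m-space. By compactness finitely many charts produce this set, each as the image
  of a map without surjective derivative, hence as a null set.\<close>

theorem degenerate_if_rank_less:
  assumes compact: "compact (UNIV :: 'a set)"
    and rank: "\<And>c d z. c \<in> A \<Longrightarrow> d \<in> B \<Longrightarrow> z \<in> dom c d \<Longrightarrow> vec.dim (range (drep c d z)) < CARD('m)"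
  shows "degenerate A B f"
proof (rule ccontr)
  assume "\<not> degenerate A B f"
  define K where "K = {k. \<exists>x. regular_point B (range f) k x}"
  have big: "CARD('m) \<le> Sup K" using \<open>\<not> degenerate A B f\<close> by (simp add: degenerate_def analytic_dim_def K_def)
  have "K \<subseteq> {..CARD('n)}"
  proof
    fix k assume "k \<in> K"
    then obtain L :: "(complex^'n) set" where "vec.dim L = k" by (auto simp: K_def regular_point_def)
    then show "k \<in> {..CARD('n)}" using vec.dim_subset[OF subset_UNIV, of L] unfolding vec_dim_card by simp
  qed
  then have "finite K" by (rule finite_subset) simp
  \<comment> \<open>On the naturals the supremum of the empty set is 0, which is less than m. So K
    is nonempty and, being finite, attains its supremum.\<close>
  moreover have "K \<noteq> {}" using big by (auto simp: Sup_nat_def)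
  ultimately have "Sup K \<in> K" by (simp add: Sup_nat_def)
  then obtain x where "regular_point B (range f) (Sup K) x" unfolding K_def by blast
  then obtain d L where d: "d \<in> maximal_atlas B" and x: "x \<in> range f" "x \<in> fst d"
    and L: "vec.subspace L" "CARD('m) \<le> vec.dim L" "snd d ` (range f \<inter> fst d) = chart_image d \<inter> L"
    using big unfolding regular_point_def by metis
  have dc: "is_chart d" and compat: "\<And>e. e \<in> B \<Longrightarrow> holo_on (transition e d) (snd e ` (fst d \<inter> fst e))"
    using d by (auto simp: maximal_atlas_def holo_compatible_def)
  let ?I = "Finite_Cartesian_Product.mat 1 :: complex^'n^'n"
  have "orthonormal ?I 0 undefined" by (simp add: orthonormal_def)
  from orthonormal_extend[OF pos_herm_identity this L(1) _ _ L(2)] obtain w0 where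
    w0: "orthonormal ?I CARD('m) w0" "\<forall>i<CARD('m). w0 i \<in> L" by auto
  obtain \<iota> :: "nat \<Rightarrow> 'm" and \<kappa> where \<kappa>: "\<And>i. \<kappa> i < CARD('m)" and "\<And>i. \<iota> (\<kappa> i) = i"
    by (rule finite_type_enumeration) blast
  then have \<kappa>_inj: "\<kappa> i = \<kappa> j \<longleftrightarrow> i = j" for i j by metis
  define w where "w i = w0 (\<kappa> i)" for i
  have w: "herm ?I (w i) (w j) = (if i = j then 1 else 0)" "w i \<in> L" for i j
    using w0 \<kappa> \<kappa>_inj by (auto simp: w_def orthonormal_def)
  \<comment> \<open>\<sigma> parametrises an m-dimensional subspace of L by its unitary basis w, and
    \<pi> is the orthogonal projection to these coordinates, a left inverse of \<sigma>.\<close>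
  define \<sigma> where "\<sigma> \<zeta> = (\<Sum>i\<in>UNIV. \<zeta> $ i *s w i)" for \<zeta> :: "complex^'m"
  define \<pi> where "\<pi> y = (\<chi> i. herm ?I y (w i))" for y
  have \<pi>lin: "linear \<pi>" "\<pi> (c *s y) = c *s \<pi> y" for c y
    by (auto intro!: linearI simp: \<pi>_def vec_eq_iff herm_add_left herm_scale_left)
       (simp add: herm_def scaleR_sum_right)
  have \<pi>\<sigma>: "\<pi> (\<sigma> \<zeta>) = \<zeta>" for \<zeta>
  proof -
    have "herm ?I (\<sigma> \<zeta>) (w j) = (\<Sum>i\<in>UNIV. if i = j then \<zeta> $ i else 0)" for j
      unfolding \<sigma>_def herm_sum_left by (intro sum.cong) (auto simp: herm_scale_left w)
    then show ?thesis by (simp add: \<pi>_def vec_eq_iff)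
  qed
  define y0 where "y0 = snd d x"
  have "y0 \<in> snd d ` (range f \<inter> fst d)" using x by (auto simp: y0_def)
  then have y0: "y0 \<in> chart_image d" "y0 \<in> L" unfolding L(3) by auto
  \<comment> \<open>Parameters for which y0 + \<sigma> \<zeta> lies in the chart image. Such points
    also lie in L, hence are coordinates of points of f(M).\<close>
  define W where "W = {\<zeta>. y0 + \<sigma> \<zeta> \<in> chart_image d}"
  have "open W"
  proof -
    have "(\<lambda>\<zeta>. y0 + \<sigma> \<zeta>) = (\<lambda>\<zeta>. \<chi> k. y0 $ k + (\<Sum>i\<in>UNIV. \<zeta> $ i * w i $ k))"
      by (simp add: fun_eq_iff vec_eq_iff \<sigma>_def)
    then have "continuous_on UNIV (\<lambda>\<zeta>. y0 + \<sigma> \<zeta>)"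
      by (simp only:) (intro continuous_on_vec_lambda continuous_intros)
    then have "open ((\<lambda>\<zeta>. y0 + \<sigma> \<zeta>) -` chart_image d)"
      using is_chartD(2)[OF dc] by (simp add: continuous_on_open_vimage)
    then show ?thesis by (simp add: W_def vimage_def)
  qed
  moreover have "W \<noteq> {}" using y0 by (auto simp: W_def \<sigma>_def intro: exI[of _ 0])
  ultimately have not_neg: "\<not> negligible W" by (rule open_not_negligible)
  have "\<forall>p. \<exists>c e. c \<in> A \<and> e \<in> B \<and> p \<in> fst c \<and> f p \<in> fst e" using charts_cover by blast
  then obtain C E where CE: "\<And>p. C p \<in> A" "\<And>p. E p \<in> B" "\<And>p. p \<in> fst (C p)" "\<And>p. f p \<in> fst (E p)" by metis
  define N where "N p = fst (C p) \<inter> f -` fst (E p)" for p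
  have N: "open (N p)" "p \<in> N p" for p
    using CE is_chartD(1)[OF chart(1)[OF CE(1)]] open_preimage[OF is_chartD(1)[OF chart(2)[OF CE(2)]]] by (auto simp: N_def)
  obtain P where P: "finite P" "UNIV = (\<Union>p\<in>P. N p)"
    using compactE_image[OF compact, of UNIV N] N by (metis UNIV_I UNIV_eq_I UN_iff subset_UNIV top.extremum_uniqueI)
  define S where "S p = snd (C p) ` (fst (C p) \<inter> f -` (fst (E p) \<inter> fst d))" for p
  \<comment> \<open>Normalised by \<pi> y0, so that a point of M mapped to y0 + \<sigma> \<zeta> is
    sent to \<zeta>.\<close>
  define \<Theta> where "\<Theta> p z = \<pi> (transition (E p) d (coord_rep (C p) (E p) f z)) - \<pi> y0" for p z
  have "negligible (\<Theta> p ` S p)" for p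
  proof -
    interpret L: local_map "g (C p)" "dom (C p) (E p)" "h (E p)" "chart_image (E p)" "coord_rep (C p) (E p) f"
      by (rule local[OF CE(1,2)])
    let ?F = "coord_rep (C p) (E p) f" and ?\<tau> = "transition (E p) d"
    let ?D = "\<lambda>z v. \<pi> (frechet_derivative ?\<tau> (at (?F z)) (L.DF z v))"
    show ?thesis
    proof (rule negligible_singular_image)
      fix z assume "z \<in> S p"
      then obtain q where q: "q \<in> fst (C p)" "f q \<in> fst (E p)" "f q \<in> fst d" "z = snd (C p) q" by (auto simp: S_def)
      then have z: "z \<in> dom (C p) (E p)" by (auto simp: dom_def)
      have "?F z = snd (E p) (f q)" using is_chartD(4)[OF chart(1)[OF CE(1)] q(1)] q(4) by (simp add: coord_rep_def)
      then have Fz: "?F z \<in> snd (E p) ` (fst d \<inter> fst (E p))" using q by auto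
      note \<tau> = holo_on_derivative[OF compat[OF CE(2)] Fz]
      have \<tau>lin: "linear (frechet_derivative ?\<tau> (at (?F z)))" using \<tau>(1) by (rule has_derivative_linear)
      have "((\<lambda>z. \<pi> (?\<tau> (?F z))) has_derivative ?D z) (at z)"
        by (rule has_derivative_compose[OF has_derivative_compose[OF holo_on_derivative(1)[OF L.F z] \<tau>(1)]
              linear_imp_has_derivative[OF \<pi>lin(1)]])
      from has_derivative_diff[OF this has_derivative_const] show "(\<Theta> p has_derivative ?D z) (at z)"
        unfolding \<Theta>_def[abs_def] by simp
      show "\<not> surj (?D z)"
      proof
        assume "surj (?D z)"
        \<comment> \<open>The complex-linear maps following the differential of f cannot raise its
          rank, which is less than m.\<close>
        have "vec.dim (range (?D z)) \<le> vec.dim (range (L.DF z))"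
          using dim_image_le[of "\<lambda>v. \<pi> (frechet_derivative ?\<tau> (at (?F z)) v)" "range (L.DF z)"]
            linear_compose[OF \<tau>lin \<pi>lin(1)] by (simp add: image_image \<tau>(2) \<pi>lin(2) o_def)
        also have "\<dots> < CARD('m)" by (rule rank[OF CE(1,2) z])
        finally show False using \<open>surj (?D z)\<close> unfolding vec_dim_card[symmetric, where 'a = complex] by simp
      qed
    qed
  qed
  then have "negligible (\<Union>p\<in>P. \<Theta> p ` S p)" using P(1) by (intro negligible_Union) auto
  moreover have "W \<subseteq> (\<Union>p\<in>P. \<Theta> p ` S p)"
  proof
    fix \<zeta> assume "\<zeta> \<in> W"
    moreover have "y0 + \<sigma> \<zeta> \<in> L" unfolding \<sigma>_def
      by (intro vec.subspace_add vec.subspace_sum vec.subspace_scale L(1) y0 w)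
    ultimately have "y0 + \<sigma> \<zeta> \<in> snd d ` (range f \<inter> fst d)" unfolding L(3) by (simp add: W_def)
    then obtain q where q: "f q \<in> fst d" "snd d (f q) = y0 + \<sigma> \<zeta>" by auto
    obtain p where p: "p \<in> P" "q \<in> N p" using P(2) by blast
    then have qp: "q \<in> fst (C p)" "f q \<in> fst (E p)" by (auto simp: N_def)
    have "\<Theta> p (snd (C p) q) = \<pi> (snd d (f q)) - \<pi> y0"
      using is_chartD(4)[OF chart(1)[OF CE(1)] qp(1)] is_chartD(4)[OF chart(2)[OF CE(2)] qp(2)]
      by (simp add: \<Theta>_def coord_rep_def transition_def)
    also have "\<dots> = \<zeta>" by (simp add: q(2) linear_add[OF \<pi>lin(1)] \<pi>\<sigma>)
    finally have "\<zeta> = \<Theta> p (snd (C p) q)" by simp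
    moreover have "snd (C p) q \<in> S p" using q(1) qp by (auto simp: S_def)
    ultimately show "\<zeta> \<in> (\<Union>p\<in>P. \<Theta> p ` S p)" using p(1) by blast
  qed
  ultimately show False using not_neg negligible_subset by blast
qed

end

section \<open>Full traces of the curvature\<close>

text \<open>Expanding the coordinate vectors in E shows that the sum on the right gives a right
  inverse of G, up to the index convention of \<open>ginv\<close>; it coincides with the left
  inverse. Contraction with \<open>ginv\<close> thus becomes summation over a unitary basis.\<close>

lemma ginv_orthonormal:
  assumes G: "pos_herm (G :: complex^'m::finite^'m)" and E: "orthonormal G CARD('m) E"
  shows "ginv G p q = (\<Sum>a<CARD('m). E a $ p * cnj (E a $ q))"
proof -
  let ?N = "\<lambda>p q. \<Sum>a<CARD('m). E a $ p * cnj (E a $ q)"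
  have "vec.span (E ` {..<CARD('m)}) = UNIV"
    by (rule orthonormal_span_eq[OF E vec.subspace_UNIV]) (simp_all only: UNIV_I vec_dim_card order_refl)
  then have expand: "x = (\<Sum>a<CARD('m). herm G x (E a) *s E a)" for x
    by (intro orthonormal_expand[OF E]) simp
  have N: "(\<Sum>l\<in>UNIV. G $ k $ l * ?N p l) = (if k = p then 1 else 0)" for k p
  proof -
    have h: "herm G (axis k 1) y = (\<Sum>l\<in>UNIV. G $ k $ l * cnj (y $ l))" for y
    proof -
      have "herm G (axis k 1) y = (\<Sum>k'\<in>UNIV. if k' = k then (\<Sum>l\<in>UNIV. G $ k' $ l * cnj (y $ l)) else 0)"
        unfolding herm_def by (intro sum.cong refl) (simp add: axis_def)
      then show ?thesis by simp
    qed
    have "axis k 1 $ p = (\<Sum>a<CARD('m). herm G (axis k 1) (E a) *s E a) $ p" using expand[of "axis k 1"] by simp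
    also have "\<dots> = (\<Sum>a<CARD('m). \<Sum>l\<in>UNIV. G $ k $ l * (E a $ p * cnj (E a $ l)))"
      by (simp add: h sum_distrib_left sum_distrib_right mult_ac)
    also have "\<dots> = (\<Sum>l\<in>UNIV. G $ k $ l * ?N p l)"
      by (subst sum.swap) (simp add: sum_distrib_left)
    finally show ?thesis by (simp add: axis_def eq_commute)
  qed
  have "?N p q = (\<Sum>l\<in>UNIV. if q = l then ?N p l else 0)" by simp
  also have "\<dots> = (\<Sum>l\<in>UNIV. (\<Sum>k\<in>UNIV. ginv G k q * G $ k $ l) * ?N p l)"
    unfolding ginv_inverse[OF G] by (intro sum.cong refl) simp
  also have "\<dots> = (\<Sum>k\<in>UNIV. ginv G k q * (\<Sum>l\<in>UNIV. G $ k $ l * ?N p l))"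
    unfolding sum_distrib_right sum_distrib_left[where r = "ginv G _ q"] mult.assoc by (rule sum.swap)
  also have "\<dots> = (\<Sum>k\<in>UNIV. if k = p then ginv G k q else 0)"
    unfolding N by (intro sum.cong refl) simp
  finally show ?thesis by simp
qed

lemma chern_ricci_trace:
  assumes G: "pos_herm (G z)" and E: "orthonormal (G z) CARD('m) (E :: nat \<Rightarrow> complex^'m::finite)"
  shows "(\<Sum>i\<in>UNIV. \<Sum>j\<in>UNIV. chern_ricci G z i j * v $ i * cnj (v $ j)) = ric1 G z CARD('m) E v"
proof -
  let ?F = "\<lambda>i j k l a. chern_curv G z i j k l * v $ i * cnj (v $ j) * E a $ k * cnj (E a $ l)"
  have "(\<Sum>i\<in>UNIV. \<Sum>j\<in>UNIV. chern_ricci G z i j * v $ i * cnj (v $ j))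
      = (\<Sum>i\<in>UNIV. \<Sum>j\<in>UNIV. \<Sum>k\<in>UNIV. \<Sum>l\<in>UNIV. \<Sum>a<CARD('m). ?F i j k l a)"
    unfolding chern_ricci_def ginv_orthonormal[OF G E] by (simp add: sum_distrib_left sum_distrib_right mult_ac)
  also have "\<dots> = (\<Sum>i\<in>UNIV. \<Sum>j\<in>UNIV. \<Sum>k\<in>UNIV. \<Sum>a<CARD('m). \<Sum>l\<in>UNIV. ?F i j k l a)"
    by (intro sum.cong refl sum.swap)
  also have "\<dots> = (\<Sum>i\<in>UNIV. \<Sum>j\<in>UNIV. \<Sum>a<CARD('m). \<Sum>k\<in>UNIV. \<Sum>l\<in>UNIV. ?F i j k l a)"
    by (intro sum.cong refl sum.swap)
  also have "\<dots> = (\<Sum>i\<in>UNIV. \<Sum>a<CARD('m). \<Sum>j\<in>UNIV. \<Sum>k\<in>UNIV. \<Sum>l\<in>UNIV. ?F i j k l a)"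
    by (intro sum.cong refl sum.swap)
  also have "\<dots> = (\<Sum>a<CARD('m). \<Sum>i\<in>UNIV. \<Sum>j\<in>UNIV. \<Sum>k\<in>UNIV. \<Sum>l\<in>UNIV. ?F i j k l a)" by (rule sum.swap)
  finally show ?thesis by (simp add: ric1_def curv_tensor_def)
qed

lemma chern_scalar_trace:
  assumes G: "pos_herm (G z)" and E: "orthonormal (G z) CARD('m) (E :: nat \<Rightarrow> complex^'m::finite)"
  shows "chern_scalar G z = scal_l G z CARD('m) E"
proof -
  let ?F = "\<lambda>i j a. chern_ricci G z i j * E a $ i * cnj (E a $ j)"
  have "chern_scalar G z = (\<Sum>i\<in>UNIV. \<Sum>j\<in>UNIV. ginv (G z) i j * chern_ricci G z i j)"
    unfolding chern_scalar_def chern_ricci_def by (simp add: sum_distrib_left mult.assoc)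
  also have "\<dots> = (\<Sum>i\<in>UNIV. \<Sum>j\<in>UNIV. \<Sum>a<CARD('m). ?F i j a)"
    unfolding ginv_orthonormal[OF G E] by (simp add: sum_distrib_left sum_distrib_right mult_ac)
  also have "\<dots> = (\<Sum>i\<in>UNIV. \<Sum>a<CARD('m). \<Sum>j\<in>UNIV. ?F i j a)" by (intro sum.cong refl sum.swap)
  also have "\<dots> = (\<Sum>a<CARD('m). \<Sum>i\<in>UNIV. \<Sum>j\<in>UNIV. ?F i j a)" by (rule sum.swap)
  finally show ?thesis unfolding chern_ricci_trace[where G = G and z = z, OF G E] by (simp add: scal_l_def ric1_def)
qed

context holomorphic_setting
begin

lemma scalar_sign_scal_l:
  assumes "scalar_sign P A g"
  shows "scal_l_sign P CARD('m) A g"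
  unfolding scal_l_sign_def
proof (intro ballI allI impI)
  fix c z \<Sigma> E assume c: "c \<in> A" and z: "z \<in> chart_image c" and "unitary_basis (g c z) CARD('m) \<Sigma> E"
  then have "orthonormal (g c z) CARD('m) E" by (simp add: unitary_basis_def orthonormal_def)
  from chern_scalar_trace[where G = "g c" and z = z, OF metric_onD(3)[OF metric_chart(1)[OF c] z] this]
  show "P (Re (scal_l (g c) z CARD('m) E))" using assms c z unfolding scalar_sign_def by metis
qed

lemma ricci_sign_ric1:
  assumes "ricci_sign P A g"
  shows "ric1_sign P CARD('m) A g"
  unfolding ric1_sign_def
proof (intro ballI allI impI)
  fix c z \<Sigma> E and v :: "complex^'m"
  assume c: "c \<in> A" and z: "z \<in> chart_image c" and "unitary_basis (g c z) CARD('m) \<Sigma> E" and v: "v \<noteq> 0"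
  then have "orthonormal (g c z) CARD('m) E" by (simp add: unitary_basis_def orthonormal_def)
  note trace = chern_ricci_trace[where G = "g c" and z = z, OF metric_onD(3)[OF metric_chart(1)[OF c] z] this, where v = v]
  show "P (Re (ric1 (g c) z CARD('m) E v))"
    unfolding trace[symmetric] using assms c z v unfolding ricci_sign_def by blast
qed

end

theorem theorem1p5:
  fixes A :: "('a::{t2_space, second_countable_topology}, 'm::finite) chart set"
    and g :: "('a, 'm) metric"
    and B :: "('b::{t2_space, second_countable_topology}, 'n::finite) chart set"
    and h :: "('b, 'n) metric"
    and f :: "'a \<Rightarrow> 'b"
    and l :: nat
  assumes "hermitian_manifold A g" and "connected (UNIV :: 'a set)" and "compact (UNIV :: 'a set)"
    and "hermitian_manifold B h" and "connected (UNIV :: 'b set)"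
    and "CARD('m) \<le> CARD('n)"
    and "holomorphic_map A B f"
    and "1 \<le> l" and "l \<le> CARD('m)"
  shows
    "((scalar_sign (\<lambda>t. t \<ge> 0) A g \<and> ric1_sign (\<lambda>t. t < 0) CARD('m) B h \<or>
       scalar_sign (\<lambda>t. t > 0) A g \<and> ric1_sign (\<lambda>t. t \<le> 0) CARD('m) B h \<or>
       ricci_sign (\<lambda>t. t \<ge> 0) A g \<and> scal_l_sign (\<lambda>t. t < 0) CARD('m) B h \<or>
       ricci_sign (\<lambda>t. t > 0) A g \<and> scal_l_sign (\<lambda>t. t \<le> 0) CARD('m) B h)
      \<longrightarrow> degenerate A B f) \<and>
     (kaehler_metric A g \<and> l < CARD('m) \<and>
      (scal_l_sign (\<lambda>t. t \<ge> 0) l A g \<and> ric1_sign (\<lambda>t. t < 0) l B h \<or>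
       scal_l_sign (\<lambda>t. t > 0) l A g \<and> ric1_sign (\<lambda>t. t \<le> 0) l B h \<or>
       ric1_sign (\<lambda>t. t \<ge> 0) l A g \<and> scal_l_sign (\<lambda>t. t < 0) l B h \<or>
       ric1_sign (\<lambda>t. t > 0) l A g \<and> scal_l_sign (\<lambda>t. t \<le> 0) l B h)
      \<longrightarrow> map_rank A B f < l) \<and>
     ((ric2_sign (\<lambda>t. t > 0) l A g \<and> real_bisectional_sign (\<lambda>t. t \<le> 0) B h \<or>
       ric2_sign (\<lambda>t. t \<ge> 0) l A g \<and> real_bisectional_sign (\<lambda>t. t < 0) B h)
      \<longrightarrow> f constant_on UNIV)"
proof -
  interpret holomorphic_setting A g B h f
    by unfold_locales (use assms in auto)
  have l: "1 \<le> CARD('m)" by (simp add: Suc_leI)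
  show ?thesis
  proof (intro conjI impI)
    assume "scalar_sign (\<lambda>t. t \<ge> 0) A g \<and> ric1_sign (\<lambda>t. t < 0) CARD('m) B h \<or>
       scalar_sign (\<lambda>t. t > 0) A g \<and> ric1_sign (\<lambda>t. t \<le> 0) CARD('m) B h \<or>
       ricci_sign (\<lambda>t. t \<ge> 0) A g \<and> scal_l_sign (\<lambda>t. t < 0) CARD('m) B h \<or>
       ricci_sign (\<lambda>t. t > 0) A g \<and> scal_l_sign (\<lambda>t. t \<le> 0) CARD('m) B h"
    \<comment> \<open>For l = m a unitary basis spans the whole tangent space, so the Chern scalar
      and Ricci curvatures of M are its m-scalar and m-first Ricci curvatures.\<close>
    then have "scal_l_sign (\<lambda>t. t \<ge> 0) CARD('m) A g \<and> ric1_sign (\<lambda>t. t < 0) CARD('m) B h \<or>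
       scal_l_sign (\<lambda>t. t > 0) CARD('m) A g \<and> ric1_sign (\<lambda>t. t \<le> 0) CARD('m) B h \<or>
       ric1_sign (\<lambda>t. t \<ge> 0) CARD('m) A g \<and> scal_l_sign (\<lambda>t. t < 0) CARD('m) B h \<or>
       ric1_sign (\<lambda>t. t > 0) CARD('m) A g \<and> scal_l_sign (\<lambda>t. t \<le> 0) CARD('m) B h"
      using scalar_sign_scal_l ricci_sign_ric1 by blast
    from degenerate_if_rank_less[OF assms(3) rank_less[OF assms(3) l order_refl this]]
    show "degenerate A B f" .
  next
    assume "kaehler_metric A g \<and> l < CARD('m) \<and>
      (scal_l_sign (\<lambda>t. t \<ge> 0) l A g \<and> ric1_sign (\<lambda>t. t < 0) l B h \<or>
       scal_l_sign (\<lambda>t. t > 0) l A g \<and> ric1_sign (\<lambda>t. t \<le> 0) l B h \<or>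
       ric1_sign (\<lambda>t. t \<ge> 0) l A g \<and> scal_l_sign (\<lambda>t. t < 0) l B h \<or>
       ric1_sign (\<lambda>t. t > 0) l A g \<and> scal_l_sign (\<lambda>t. t \<le> 0) l B h)"
    then show "map_rank A B f < l"
      by (intro map_rank_less rank_less[OF assms(3,8,9)]) blast+
  next
    assume curvature: "ric2_sign (\<lambda>t. t > 0) l A g \<and> real_bisectional_sign (\<lambda>t. t \<le> 0) B h \<or>
       ric2_sign (\<lambda>t. t \<ge> 0) l A g \<and> real_bisectional_sign (\<lambda>t. t < 0) B h"
    have "l \<le> CARD('n)" using assms(6,9) by simp
    from constant_map[OF assms(3,2,8,9) this curvature] show "f constant_on UNIV" .
  qed
qed

end
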